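(* The category $\mathbf{LRS}$ of left reductive regular semigroups is equivalent to the category $\mathbf{CC}$ of connected categories.
   Context: Conventions. Mappings, morphisms and functors are composed from left to right ($fg$ means first $f$, then $g$). For a category $\mathcal C$, $v\mathcal C$ denotes its class of objects and $\mathcal C(c,c')$ the set of morphisms from $c$ to $c'$. A monomorphism is a right cancellable morphism and an epimorphism is a left cancellable morphism. Semigroups. A semigroup $S$ is regular if for every $a\in S$ there is $x\in S$ with $axa=a$. It is left reductive if the map $a\mapsto\rho_a$, where $\rho_a\colon S\to S$, $x\mapsto xa$, is injective. $\mathbf{LRS}$ is the category of left reductive regular semigroups with all semigroup homomorphisms as morphisms. Normal categories. A strict preorder is a category with at most one morphism between any two (possibly equal) objects in which the only isomorphisms are identities. A category with subobjects is a small category $\mathcal C$ with a subcategory $\mathcal P$ such that: $\mathcal P$ is a strict preorder with $v\mathcal P=v\mathcal C$; every $f\in\mathcal P$ is a monomorphism in $\mathcal C$; if $f,g\in\mathcal P$ and $f=hg$ with $h\in\mathcal C$, then $h\in\mathcal P$. Morphisms of $\mathcal P$ are called inclusions; $c\preceq c'$ means $\mathcal P(c,c')\neq\emptyset$, and $j(c,c')$ is then the unique inclusion. An inclusion $j\colon c\to c'$ splits if there is $q\colon c'\to c$ in $\mathcal C$ with $jq=1_c$; such a $q$ is called a retraction. A normal factorisation of a morphism $f$ is $f=quj$ with $q$ a retraction, $u$ an isomorphism, $j$ an inclusion. A cone with vertex $z\in v\mathcal C$ is a map $\gamma$ assigning to each $c\in v\mathcal C$ a morphism $\gamma(c)\in\mathcal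 C(c,z)$ such that $j(a,b)\gamma(b)=\gamma(a)$ whenever $a\preceq b$, and $\gamma(c)$ is an isomorphism for at least one $c$; the vertex is denoted $z_\gamma$. $\mathcal C$ is a normal category if it is a category with subobjects in which every inclusion splits, every morphism has a normal factorisation, and for each $c\in v\mathcal C$ there is a cone $\mu$ with vertex $c$ and $\mu(c)=1_c$. In a normal category, for a normal factorisation $f=quj$ the epimorphism $f^\circ:=qu$ does not depend on the factorisation. Semigroup of cones. For a cone $\gamma$ and an epimorphism $f$ with domain $z_\gamma$, $\gamma\ast f$ is the cone $c\mapsto\gamma(c)f$. The set $\widehat{\mathcal C}$ of all cones in a normal category $\mathcal C$ is a regular semigroup under $\gamma\cdot\delta=\gamma\ast(\delta(z_\gamma))^\circ$. Let $\mathscr R$ be Green's relation on $\widehat{\mathcal C}$, $R_\gamma$ the $\mathscr R$-class of $\gamma$; $\widehat{\mathcal C}/\mathscr R$ is partially ordered by $R_\gamma\sqsubseteq R_\delta$ iff the principal right ideal generated by $\gamma$ is contained in that generated by $\delta$. Connected categories. Let $\mathcal C$ be a normal category and $\mathfrak D$ a down-set of $(\widehat{\mathcal C}/\mathscr R,\sqsubseteq)$. An object $c$ is connected by (or to) $\mathfrak d\in\mathfrak D$ if $\mathfrak d$ contains an idempotent cone with vertex $c$; this idempotent cone is then unique and is denoted $\epsilon(c,\mathfrak d)$. $\mathcal C$ is connected by $\mathfrak D$ if every $c\in v\mathcal C$ is connected by some $\mathfrak d\in\mathfrak D$; then the pair is denoted $\mathcal C_{\mathfrak D}$ and called a connected category.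 A CC-morphism from $\mathcal C_{\mathfrak D}$ to $\mathcal C'_{\mathfrak D'}$ is a pair $(F,G)$ where $F\colon\mathcal C\to\mathcal C'$ is an inclusion preserving functor and $G\colon\mathfrak D\to\mathfrak D'$ is an order preserving map such that whenever $c$ is connected to $\mathfrak d$, $F(c)$ is connected to $G(\mathfrak d)$ and $F(\epsilon(c,\mathfrak d)(c'))=\epsilon(F(c),G(\mathfrak d))(F(c'))$ for every $c'\in v\mathcal C$. $\mathbf{CC}$ is the category of connected categories with CC-morphisms. *)

theory Defs
  imports "HOL-Library.FuncSet" "HOL-Library.Equipollence"
begin

section \<open>Categories, functors, equivalence of categories\<close>

text \<open>
  Composition is written in diagrammatic order: \<open>f \<cdot>\<^bsub>C\<^esub> g\<close> means first \<open>f\<close>, then \<open>g\<close>, and is only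
  meaningful when \<open>Cod C f = Dom C g\<close>.
\<close>

record ('o, 'm) cat =
  Obj :: "'o set"
  Arr :: "'m set"
  Dom :: "'m \<Rightarrow> 'o"
  Cod :: "'m \<Rightarrow> 'o"
  Ide :: "'o \<Rightarrow> 'm"
  Comp :: "'m \<Rightarrow> 'm \<Rightarrow> 'm"  (infixl "\<cdot>\<index>" 70)

definition Hom :: "('o, 'm, 'z) cat_scheme \<Rightarrow> 'o \<Rightarrow> 'o \<Rightarrow> 'm set" where
  "Hom C a b = {f \<in> Arr C. Dom C f = a \<and> Cod C f = b}"

definition category :: "('o, 'm, 'z) cat_scheme \<Rightarrow> bool" where
  "category C \<longleftrightarrow>
     (\<forall>f\<in>Arr C. Dom C f \<in> Obj C \<and> Cod C f \<in> Obj C) \<and>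
     (\<forall>a\<in>Obj C. Ide C a \<in> Hom C a a) \<and>
     (\<forall>f\<in>Arr C. \<forall>g\<in>Arr C. Cod C f = Dom C g \<longrightarrow> f \<cdot>\<^bsub>C\<^esub> g \<in> Hom C (Dom C f) (Cod C g)) \<and>
     (\<forall>f\<in>Arr C. Ide C (Dom C f) \<cdot>\<^bsub>C\<^esub> f = f \<and> f \<cdot>\<^bsub>C\<^esub> Ide C (Cod C f) = f) \<and>
     (\<forall>f\<in>Arr C. \<forall>g\<in>Arr C. \<forall>h\<in>Arr C. Cod C f = Dom C g \<longrightarrow> Cod C g = Dom C h \<longrightarrow>
        (f \<cdot>\<^bsub>C\<^esub> g) \<cdot>\<^bsub>C\<^esub> h = f \<cdot>\<^bsub>C\<^esub> (g \<cdot>\<^bsub>C\<^esub> h))"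

definition iso :: "('o, 'm, 'z) cat_scheme \<Rightarrow> 'm \<Rightarrow> bool" where
  "iso C f \<longleftrightarrow> f \<in> Arr C \<and>
     (\<exists>g \<in> Hom C (Cod C f) (Dom C f).
        f \<cdot>\<^bsub>C\<^esub> g = Ide C (Dom C f) \<and> g \<cdot>\<^bsub>C\<^esub> f = Ide C (Cod C f))"

definition monic :: "('o, 'm, 'z) cat_scheme \<Rightarrow> 'm \<Rightarrow> bool" where
  "monic C f \<longleftrightarrow> f \<in> Arr C \<and>
     (\<forall>g\<in>Arr C. \<forall>h\<in>Arr C. Cod C g = Dom C f \<longrightarrow> Cod C h = Dom C f \<longrightarrow>
        g \<cdot>\<^bsub>C\<^esub> f = h \<cdot>\<^bsub>C\<^esub> f \<longrightarrow> g = h)"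

record ('o, 'm, 'p, 'n) functor_map =
  on_Obj :: "'o \<Rightarrow> 'p"
  on_Arr :: "'m \<Rightarrow> 'n"

definition is_functor ::
  "('o, 'm, 'y) cat_scheme \<Rightarrow> ('p, 'n, 'z) cat_scheme \<Rightarrow> ('o, 'm, 'p, 'n) functor_map \<Rightarrow> bool" where
  "is_functor C D F \<longleftrightarrow> category C \<and> category D \<and>
     (\<forall>a\<in>Obj C. on_Obj F a \<in> Obj D) \<and>
     (\<forall>f\<in>Arr C. on_Arr F f \<in> Hom D (on_Obj F (Dom C f)) (on_Obj F (Cod C f))) \<and>
     (\<forall>a\<in>Obj C. on_Arr F (Ide C a) = Ide D (on_Obj F a)) \<and>
     (\<forall>f\<in>Arr C. \<forall>g\<in>Arr C. Cod C f = Dom C g \<longrightarrow>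
        on_Arr F (f \<cdot>\<^bsub>C\<^esub> g) = on_Arr F f \<cdot>\<^bsub>D\<^esub> on_Arr F g)"

definition naturally_isomorphic ::
  "('o, 'm, 'y) cat_scheme \<Rightarrow> ('p, 'n, 'z) cat_scheme
     \<Rightarrow> ('o, 'm, 'p, 'n) functor_map \<Rightarrow> ('o, 'm, 'p, 'n) functor_map \<Rightarrow> bool" where
  "naturally_isomorphic C D F G \<longleftrightarrow> (\<exists>\<eta>.
     (\<forall>a\<in>Obj C. \<eta> a \<in> Hom D (on_Obj F a) (on_Obj G a) \<and> iso D (\<eta> a)) \<and>
     (\<forall>f\<in>Arr C. on_Arr F f \<cdot>\<^bsub>D\<^esub> \<eta> (Cod C f) = \<eta> (Dom C f) \<cdot>\<^bsub>D\<^esub> on_Arr G f))"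

definition id_map :: "('o, 'm, 'o, 'm) functor_map" where
  "id_map = \<lparr>on_Obj = (\<lambda>a. a), on_Arr = (\<lambda>f. f)\<rparr>"

definition then_map ::
  "('o, 'm, 'p, 'n) functor_map \<Rightarrow> ('p, 'n, 'q, 'k) functor_map \<Rightarrow> ('o, 'm, 'q, 'k) functor_map" where
  "then_map F G = \<lparr>on_Obj = (\<lambda>a. on_Obj G (on_Obj F a)), on_Arr = (\<lambda>f. on_Arr G (on_Arr F f))\<rparr>"

definition equivalent_categories ::
  "('o, 'm, 'y) cat_scheme \<Rightarrow> ('p, 'n, 'z) cat_scheme \<Rightarrow> bool" where
  "equivalent_categories A B \<longleftrightarrow> (\<exists>F G.
     is_functor A B F \<and> is_functor B A G \<and>
     naturally_isomorphic A A id_map (then_map F G) \<and>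
     naturally_isomorphic B B id_map (then_map G F))"


section \<open>Left reductive regular semigroups\<close>

record 'a semigrp =
  carrier :: "'a set"
  mult :: "'a \<Rightarrow> 'a \<Rightarrow> 'a"  (infixl "\<otimes>\<index>" 70)

text \<open>The empty semigroup is admitted; it corresponds to the empty connected category.\<close>

definition semigrp :: "('a, 'z) semigrp_scheme \<Rightarrow> bool" where
  "semigrp S \<longleftrightarrow>
     (\<forall>x\<in>carrier S. \<forall>y\<in>carrier S. x \<otimes>\<^bsub>S\<^esub> y \<in> carrier S) \<and>
     (\<forall>x\<in>carrier S. \<forall>y\<in>carrier S. \<forall>z\<in>carrier S.
        (x \<otimes>\<^bsub>S\<^esub> y) \<otimes>\<^bsub>S\<^esub> z = x \<otimes>\<^bsub>S\<^esub> (y \<otimes>\<^bsub>S\<^esub> z))"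

definition regular :: "('a, 'z) semigrp_scheme \<Rightarrow> bool" where
  "regular S \<longleftrightarrow> (\<forall>a\<in>carrier S. \<exists>x\<in>carrier S. (a \<otimes>\<^bsub>S\<^esub> x) \<otimes>\<^bsub>S\<^esub> a = a)"

definition left_reductive :: "('a, 'z) semigrp_scheme \<Rightarrow> bool" where
  "left_reductive S \<longleftrightarrow> inj_on (\<lambda>a. \<lambda>x\<in>carrier S. x \<otimes>\<^bsub>S\<^esub> a) (carrier S)"

text \<open>Homomorphisms are extensional, so that each one is represented exactly once.\<close>

definition semigrp_hom ::
  "('a, 'y) semigrp_scheme \<Rightarrow> ('b, 'z) semigrp_scheme \<Rightarrow> ('a \<Rightarrow> 'b) set" where
  "semigrp_hom S T = {\<phi> \<in> carrier S \<rightarrow>\<^sub>E carrier T.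
     \<forall>x\<in>carrier S. \<forall>y\<in>carrier S. \<phi> (x \<otimes>\<^bsub>S\<^esub> y) = \<phi> x \<otimes>\<^bsub>T\<^esub> \<phi> y}"

text \<open>The principal right ideal \<open>a S\<^sup>1\<close>, Green's relation \<open>\<R>\<close> and the order on \<open>\<R>\<close>-classes.\<close>

definition right_ideal :: "('a, 'z) semigrp_scheme \<Rightarrow> 'a \<Rightarrow> 'a set" where
  "right_ideal S a = insert a {a \<otimes>\<^bsub>S\<^esub> x | x. x \<in> carrier S}"

definition green_R :: "('a, 'z) semigrp_scheme \<Rightarrow> ('a \<times> 'a) set" where
  "green_R S = {(a, b). a \<in> carrier S \<and> b \<in> carrier S \<and> right_ideal S a = right_ideal S b}"

definition R_le :: "('a, 'z) semigrp_scheme \<Rightarrow> 'a set \<Rightarrow> 'a set \<Rightarrow> bool" where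
  "R_le S X Y \<longleftrightarrow> (\<exists>a\<in>X. \<exists>b\<in>Y. right_ideal S a \<subseteq> right_ideal S b)"


section \<open>Normal categories\<close>

record ('o, 'm) scat = "('o, 'm) cat" +
  Incl :: "'m set"

definition incl_cat :: "('o, 'm, 'z) scat_scheme \<Rightarrow> ('o, 'm) cat" where
  "incl_cat C = \<lparr>Obj = Obj C, Arr = Incl C, Dom = Dom C, Cod = Cod C, Ide = Ide C, Comp = Comp C\<rparr>"

definition strict_preorder :: "('o, 'm, 'z) cat_scheme \<Rightarrow> bool" where
  "strict_preorder P \<longleftrightarrow> category P \<and>
     (\<forall>f\<in>Arr P. \<forall>g\<in>Arr P. Dom P f = Dom P g \<longrightarrow> Cod P f = Cod P g \<longrightarrow> f = g) \<and>
     (\<forall>f. iso P f \<longrightarrow> f = Ide P (Dom P f))"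

definition category_with_subobjects :: "('o, 'm, 'z) scat_scheme \<Rightarrow> bool" where
  "category_with_subobjects C \<longleftrightarrow> category C \<and>
     Incl C \<subseteq> Arr C \<and> strict_preorder (incl_cat C) \<and>
     (\<forall>f\<in>Incl C. monic C f) \<and>
     (\<forall>f\<in>Incl C. \<forall>g\<in>Incl C. \<forall>h\<in>Arr C. Cod C h = Dom C g \<longrightarrow> f = h \<cdot>\<^bsub>C\<^esub> g \<longrightarrow> h \<in> Incl C)"

definition retraction_of :: "('o, 'm, 'z) scat_scheme \<Rightarrow> 'm \<Rightarrow> 'm \<Rightarrow> bool" where
  "retraction_of C j q \<longleftrightarrow> j \<in> Incl C \<and> q \<in> Hom C (Cod C j) (Dom C j) \<and> j \<cdot>\<^bsub>C\<^esub> q = Ide C (Dom C j)"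

definition retraction :: "('o, 'm, 'z) scat_scheme \<Rightarrow> 'm \<Rightarrow> bool" where
  "retraction C q \<longleftrightarrow> (\<exists>j. retraction_of C j q)"

definition normal_factorisation ::
  "('o, 'm, 'z) scat_scheme \<Rightarrow> 'm \<Rightarrow> 'm \<Rightarrow> 'm \<Rightarrow> 'm \<Rightarrow> bool" where
  "normal_factorisation C f q u j \<longleftrightarrow>
     retraction C q \<and> iso C u \<and> j \<in> Incl C \<and> Cod C q = Dom C u \<and> Cod C u = Dom C j \<and>
     f = (q \<cdot>\<^bsub>C\<^esub> u) \<cdot>\<^bsub>C\<^esub> j"

definition cone_at :: "('o, 'm, 'z) scat_scheme \<Rightarrow> 'o \<Rightarrow> ('o \<Rightarrow> 'm) \<Rightarrow> bool" where
  "cone_at C z \<gamma> \<longleftrightarrow> z \<in> Obj C \<and> \<gamma> \<in> (\<Pi>\<^sub>E c\<in>Obj C. Hom C c z) \<and>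
     (\<forall>j\<in>Incl C. j \<cdot>\<^bsub>C\<^esub> \<gamma> (Cod C j) = \<gamma> (Dom C j)) \<and>
     (\<exists>c\<in>Obj C. iso C (\<gamma> c))"

definition normal_category :: "('o, 'm, 'z) scat_scheme \<Rightarrow> bool" where
  "normal_category C \<longleftrightarrow> category_with_subobjects C \<and>
     (\<forall>j\<in>Incl C. \<exists>q. retraction_of C j q) \<and>
     (\<forall>f\<in>Arr C. \<exists>q u j. normal_factorisation C f q u j) \<and>
     (\<forall>c\<in>Obj C. \<exists>\<mu>. cone_at C c \<mu> \<and> \<mu> c = Ide C c)"

text \<open>
  In a normal category, \<open>q \<cdot> u\<close> is the same for all normal factorisations \<open>f = q \<cdot> u \<cdot> j\<close>; this is the
  epimorphism \<open>f\<degree>\<close>.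
\<close>

definition epi_part :: "('o, 'm, 'z) scat_scheme \<Rightarrow> 'm \<Rightarrow> 'm" where
  "epi_part C f = (THE e. \<exists>q u j. normal_factorisation C f q u j \<and> e = q \<cdot>\<^bsub>C\<^esub> u)"


section \<open>The semigroup of cones\<close>

text \<open>The vertex is determined by the cone, as a cone has at least one component.\<close>

definition vertex :: "('o, 'm, 'z) scat_scheme \<Rightarrow> ('o \<Rightarrow> 'm) \<Rightarrow> 'o" where
  "vertex C \<gamma> = (THE z. cone_at C z \<gamma>)"

definition cone_star :: "('o, 'm, 'z) scat_scheme \<Rightarrow> ('o \<Rightarrow> 'm) \<Rightarrow> 'm \<Rightarrow> ('o \<Rightarrow> 'm)" where
  "cone_star C \<gamma> f = (\<lambda>c\<in>Obj C. \<gamma> c \<cdot>\<^bsub>C\<^esub> f)"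

definition cones :: "('o, 'm, 'z) scat_scheme \<Rightarrow> ('o \<Rightarrow> 'm) semigrp" where
  "cones C = \<lparr>carrier = {\<gamma>. \<exists>z. cone_at C z \<gamma>},
              mult = (\<lambda>\<gamma> \<delta>. cone_star C \<gamma> (epi_part C (\<delta> (vertex C \<gamma>))))\<rparr>"


section \<open>Connected categories\<close>

definition R_down_set :: "('o, 'm, 'z) scat_scheme \<Rightarrow> ('o \<Rightarrow> 'm) set set \<Rightarrow> bool" where
  "R_down_set C D \<longleftrightarrow> D \<subseteq> carrier (cones C) // green_R (cones C) \<and>
     (\<forall>d\<in>D. \<forall>d'\<in>carrier (cones C) // green_R (cones C). R_le (cones C) d' d \<longrightarrow> d' \<in> D)"

definition idempotent_cone ::
  "('o, 'm, 'z) scat_scheme \<Rightarrow> 'o \<Rightarrow> ('o \<Rightarrow> 'm) set \<Rightarrow> ('o \<Rightarrow> 'm) \<Rightarrow> bool" where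
  "idempotent_cone C c d \<gamma> \<longleftrightarrow> \<gamma> \<in> d \<and> \<gamma> \<otimes>\<^bsub>cones C\<^esub> \<gamma> = \<gamma> \<and> vertex C \<gamma> = c"

definition connected_to :: "('o, 'm, 'z) scat_scheme \<Rightarrow> 'o \<Rightarrow> ('o \<Rightarrow> 'm) set \<Rightarrow> bool" where
  "connected_to C c d \<longleftrightarrow> (\<exists>\<gamma>. idempotent_cone C c d \<gamma>)"

definition eps :: "('o, 'm, 'z) scat_scheme \<Rightarrow> 'o \<Rightarrow> ('o \<Rightarrow> 'm) set \<Rightarrow> ('o \<Rightarrow> 'm)" where
  "eps C c d = (THE \<gamma>. idempotent_cone C c d \<gamma>)"

type_synonym ('o, 'm) ccat = "('o, 'm) scat \<times> ('o \<Rightarrow> 'm) set set"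

definition connected_category :: "('o, 'm) ccat \<Rightarrow> bool" where
  "connected_category = (\<lambda>(C, D). normal_category C \<and> R_down_set C D \<and>
     (\<forall>c\<in>Obj C. \<exists>d\<in>D. connected_to C c d))"

text \<open>As for homomorphisms, all maps in a CC-morphism are extensional.\<close>

type_synonym ('o, 'm, 'p, 'n) cc_map =
  "('o, 'm, 'p, 'n) functor_map \<times> (('o \<Rightarrow> 'm) set \<Rightarrow> ('p \<Rightarrow> 'n) set)"

definition cc_morphism ::
  "('o, 'm) ccat \<Rightarrow> ('p, 'n) ccat \<Rightarrow> ('o, 'm, 'p, 'n) cc_map \<Rightarrow> bool" where
  "cc_morphism = (\<lambda>(C, D) (C', D') (F, G).
     is_functor C C' F \<and> on_Obj F \<in> extensional (Obj C) \<and> on_Arr F \<in> extensional (Arr C) \<and>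
     (\<forall>j\<in>Incl C. on_Arr F j \<in> Incl C') \<and>
     G \<in> D \<rightarrow>\<^sub>E D' \<and>
     (\<forall>d\<in>D. \<forall>d'\<in>D. R_le (cones C) d d' \<longrightarrow> R_le (cones C') (G d) (G d')) \<and>
     (\<forall>c\<in>Obj C. \<forall>d\<in>D. connected_to C c d \<longrightarrow>
        connected_to C' (on_Obj F c) (G d) \<and>
        (\<forall>c'\<in>Obj C. on_Arr F (eps C c d c') = eps C' (on_Obj F c) (G d) (on_Obj F c'))))"

definition cc_id :: "('o, 'm) ccat \<Rightarrow> ('o, 'm, 'o, 'm) cc_map" where
  "cc_id = (\<lambda>(C, D).
     (\<lparr>on_Obj = (\<lambda>c\<in>Obj C. c), on_Arr = (\<lambda>f\<in>Arr C. f)\<rparr>, \<lambda>d\<in>D. d))"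

definition cc_comp ::
  "('o, 'm) ccat \<Rightarrow> ('o, 'm, 'p, 'n) cc_map \<Rightarrow> ('p, 'n, 'q, 'k) cc_map \<Rightarrow> ('o, 'm, 'q, 'k) cc_map" where
  "cc_comp = (\<lambda>(C, D) (F, G) (F', G').
     (\<lparr>on_Obj = compose (Obj C) (on_Obj F') (on_Obj F),
       on_Arr = compose (Arr C) (on_Arr F') (on_Arr F)\<rparr>, compose D G' G))"


section \<open>The categories LRS and CC\<close>

text \<open>
  The underlying sets of semigroups and categories are taken from a family \<open>U\<close> of ``small'' subsets of
  a type, closed under passage to subsets, images and (up to bijection) products. Examples are all
  subsets of an infinite type (see below), all finite sets, all sets of cardinality below a fixed
  infinite cardinal, and the sets of a Grothendieck universe.
\<close>

definition universe :: "'u set set \<Rightarrow> bool" where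
  "universe U \<longleftrightarrow> (\<forall>X\<in>U. \<forall>Y. Y \<lesssim> X \<longrightarrow> Y \<in> U) \<and> (\<forall>X\<in>U. \<forall>Y\<in>U. \<exists>Z\<in>U. X \<times> Y \<lesssim> Z)"

text \<open>
  Arrows are triples (domain, map, codomain). Records that differ only in the values of their operations
  outside the carrier are distinct but isomorphic objects.
\<close>

definition LRS :: "'u set set \<Rightarrow> ('u semigrp, 'u semigrp \<times> ('u \<Rightarrow> 'u) \<times> 'u semigrp) cat" where
  "LRS U = (let Ob = {S. semigrp S \<and> regular S \<and> left_reductive S \<and> carrier S \<in> U} in
     \<lparr>Obj = Ob,
      Arr = {(S, \<phi>, T). S \<in> Ob \<and> T \<in> Ob \<and> \<phi> \<in> semigrp_hom S T},
      Dom = (\<lambda>(S, \<phi>, T). S),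
      Cod = (\<lambda>(S, \<phi>, T). T),
      Ide = (\<lambda>S. (S, (\<lambda>x\<in>carrier S. x), S)),
      Comp = (\<lambda>(S, \<phi>, T) (T', \<psi>, V). (S, compose (carrier S) \<psi> \<phi>, V))\<rparr>)"

text \<open>
  The down-set is required to be small as well. This is automatic when \<open>U\<close> is closed under function
  spaces (lemma \<open>down_set_small\<close>).
\<close>

definition CC :: "'u set set \<Rightarrow>
    (('u, 'u) ccat, ('u, 'u) ccat \<times> ('u, 'u, 'u, 'u) cc_map \<times> ('u, 'u) ccat) cat" where
  "CC U = (let Ob = {(C, D). connected_category (C, D) \<and>
                        Obj C \<in> U \<and> Arr C \<in> U \<and> (\<exists>Z\<in>U. D \<lesssim> Z)} in
     \<lparr>Obj = Ob,
      Arr = {(X, H, Y). X \<in> Ob \<and> Y \<in> Ob \<and> cc_morphism X Y H},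
      Dom = (\<lambda>(X, H, Y). X),
      Cod = (\<lambda>(X, H, Y). Y),
      Ide = (\<lambda>X. (X, cc_id X, X)),
      Comp = (\<lambda>(X, H, Y) (Y', K, Z). (X, cc_comp X H K, Z))\<rparr>)"

lemma universe_Pow_UNIV:
  assumes "infinite (UNIV :: 'u set)"
  shows "universe (Pow (UNIV :: 'u set))"
proof -
  have "(UNIV :: 'u set) \<times> (UNIV :: 'u set) \<lesssim> (UNIV :: 'u set)"
    unfolding lepoll_def card_of_ordLeq
    using card_of_Times_same_infinite[OF assms] by (rule ordIso_imp_ordLeq)
  then have "X \<times> Y \<lesssim> (UNIV :: 'u set)" for X Y :: "'u set"
    by (meson Sigma_mono lepoll_trans subset_UNIV subset_imp_lepoll)
  then show ?thesis
    by (auto simp: universe_def)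
qed

lemma down_set_small:
  assumes "\<And>X Y. X \<in> U \<Longrightarrow> Y \<in> U \<Longrightarrow> \<exists>Z\<in>U. (X \<rightarrow>\<^sub>E Y) \<lesssim> Z"
    and "Obj C \<in> U" "Arr C \<in> U" "R_down_set C D"
  shows "\<exists>Z\<in>U. D \<lesssim> Z"
proof -
  have "D \<subseteq> (\<lambda>\<gamma>. green_R (cones C) `` {\<gamma>}) ` carrier (cones C)"
    using assms(4) by (auto simp: R_down_set_def quotient_def)
  then have "D \<lesssim> carrier (cones C)"
    by (meson image_lepoll lepoll_trans subset_imp_lepoll)
  moreover have "carrier (cones C) \<subseteq> Obj C \<rightarrow>\<^sub>E Arr C"
    by (auto simp: cones_def cone_at_def Hom_def PiE_def Pi_def)
  ultimately have "D \<lesssim> (Obj C \<rightarrow>\<^sub>E Arr C)"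
    by (meson lepoll_trans subset_imp_lepoll)
  then show ?thesis
    using assms(1)[OF assms(2,3)] by (meson lepoll_trans)
qed

end

theory Submission
  imports Defs
begin

text \<open>
  For a connected category \<open>(C, D)\<close> the cones whose \<open>\<R>\<close>-class lies in \<open>D\<close> form a right ideal
  \<open>T = \<Union>D\<close> of the semigroup of cones. It contains an idempotent cone for every vertex, and therefore it is
  regular and left reductive. A CC-morphism \<open>(F, G)\<close> induces the homomorphism that sends \<open>\<gamma>\<close> to the only
  cone \<open>\<delta>\<close> in the class \<open>G R\<^sub>\<gamma>\<close> with \<open>\<delta> (F c) = F (\<gamma> c)\<close> for all \<open>c\<close>. Conversely, \<open>F\<close> and \<open>G\<close> can be read
  off this homomorphism \<open>\<phi>\<close>: \<open>F c\<close> is the vertex of \<open>\<phi> \<epsilon>\<close> for an idempotent cone \<open>\<epsilon>\<close> with vertex \<open>c\<close>, \<open>F f\<close>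
  is the component of \<open>\<phi> (\<epsilon> * f\<degree>)\<close> at \<open>F c\<close> followed by an inclusion, and \<open>G\<close> maps the class of \<open>\<gamma>\<close> to that
  of \<open>\<phi> \<gamma>\<close>. Every homomorphism arises in this way, so the functor \<open>(C, D) \<mapsto> T\<close> is fully faithful.

  It is essentially surjective: for a left reductive regular semigroup \<open>S\<close>, let \<open>L\<close> be the category of left
  ideals \<open>S e\<close> generated by idempotents, with right translations as morphisms. Each \<open>a\<close> in \<open>S\<close> gives the
  principal cone with components \<open>x \<mapsto> x a\<close>. The principal cones form a right ideal of the semigroup of all
  cones in \<open>L\<close>, and this right ideal is isomorphic to \<open>S\<close> because \<open>S\<close> is left reductive.
\<close>

section \<open>Fully faithful and essentially surjective functors\<close>

text \<open>\<open>F\<close> need not be surjective on objects, so the morphisms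
  \<open>F (\<gamma> c)\<close> fill only some components of the image cone. The class
  \<open>G R\<^sub>\<gamma>\<close> supplies the rest: it contains an idempotent cone whose vertex
  lies in the image of \<open>F\<close>, and every cone of the class is this idempotent followed by
  its own component at that vertex. The same principle, that a class and one component determine a
  cone, bounds the size of \<open>T\<close>. In the other direction the obstacle is that elements of
  \<open>T\<close> know the image of an arrow but not its codomain. A homomorphism must therefore be
  shown to respect vertices; it does so because cones in \<open>T\<close> with the same vertex
  generate the same left ideal. The functor starts from connected categories because the category of
  left ideals depends on chosen idempotent generators, which homomorphisms do not respect. With
  \<open>T\<close> as the functor, each semigroup only needs some representation, found for it
  separately.\<close>

lemma Hom_D: "f \<in> Hom C a b \<Longrightarrow> f \<in> Arr C" "f \<in> Hom C a b \<Longrightarrow> Dom C f = a" "f \<in> Hom C a b \<Longrightarrow> Cod C f = b"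
  by (auto simp: Hom_def)

lemma Arr_Hom: "f \<in> Arr C \<Longrightarrow> f \<in> Hom C (Dom C f) (Cod C f)"
  by (auto simp: Hom_def)

section \<open>Composition, isomorphisms and functors in terms of hom-sets\<close>

locale category_locale =
  fixes C :: "('o, 'm, 'z) cat_scheme" (structure)
  assumes cat: "category C"
begin

lemma Hom_Obj: "f \<in> Hom C a b \<Longrightarrow> a \<in> Obj C" "f \<in> Hom C a b \<Longrightarrow> b \<in> Obj C"
  using cat by (auto simp: Hom_def category_def)

lemma Ide_Hom [simp]: "a \<in> Obj C \<Longrightarrow> Ide C a \<in> Hom C a a"
  using cat by (auto simp: category_def)

lemma comp_Hom: "f \<in> Hom C a b \<Longrightarrow> g \<in> Hom C b c \<Longrightarrow> f \<cdot> g \<in> Hom C a c"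
  using cat by (auto simp: Hom_def category_def)

lemma comp_assoc:
  "f \<in> Hom C a b \<Longrightarrow> g \<in> Hom C b c \<Longrightarrow> h \<in> Hom C c d \<Longrightarrow> (f \<cdot> g) \<cdot> h = f \<cdot> (g \<cdot> h)"
  using cat by (auto simp: Hom_def category_def)

lemma Ide_comp: "f \<in> Hom C a b \<Longrightarrow> Ide C a \<cdot> f = f"
  using cat by (auto simp: Hom_def category_def)

lemma comp_Ide: "f \<in> Hom C a b \<Longrightarrow> f \<cdot> Ide C b = f"
  using cat by (auto simp: Hom_def category_def)

lemma comp_Arr:
  assumes "f \<in> Arr C" "g \<in> Arr C" "Cod C f = Dom C g"
  shows "f \<cdot> g \<in> Arr C" "Dom C (f \<cdot> g) = Dom C f" "Cod C (f \<cdot> g) = Cod C g"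
  using cat assms by (auto simp: Hom_def category_def)

lemma comp_assoc_Arr:
  "f \<in> Arr C \<Longrightarrow> g \<in> Arr C \<Longrightarrow> h \<in> Arr C \<Longrightarrow> Cod C f = Dom C g \<Longrightarrow> Cod C g = Dom C h \<Longrightarrow>
    (f \<cdot> g) \<cdot> h = f \<cdot> (g \<cdot> h)"
  using cat by (auto simp: category_def)

lemmas comp_simps = comp_Arr comp_assoc_Arr

lemma isoI:
  "f \<in> Hom C a b \<Longrightarrow> g \<in> Hom C b a \<Longrightarrow> f \<cdot> g = Ide C a \<Longrightarrow> g \<cdot> f = Ide C b \<Longrightarrow> iso C f"
  by (auto simp: iso_def Hom_def)

lemma isoE:
  assumes "iso C f" "f \<in> Hom C a b"
  obtains g where "g \<in> Hom C b a" "f \<cdot> g = Ide C a" "g \<cdot> f = Ide C b"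
  using assms by (auto simp: iso_def Hom_def)

end

lemma functor_Hom:
  "is_functor C D F \<Longrightarrow> f \<in> Hom C a b \<Longrightarrow> on_Arr F f \<in> Hom D (on_Obj F a) (on_Obj F b)"
  by (auto simp: is_functor_def Hom_def)

lemma functor_Ide: "is_functor C D F \<Longrightarrow> a \<in> Obj C \<Longrightarrow> on_Arr F (Ide C a) = Ide D (on_Obj F a)"
  by (auto simp: is_functor_def)

lemma functor_Obj: "is_functor C D F \<Longrightarrow> a \<in> Obj C \<Longrightarrow> on_Obj F a \<in> Obj D"
  by (auto simp: is_functor_def)

lemma functor_comp:
  "is_functor C D F \<Longrightarrow> f \<in> Hom C a b \<Longrightarrow> g \<in> Hom C b c \<Longrightarrow>
    on_Arr F (f \<cdot>\<^bsub>C\<^esub> g) = on_Arr F f \<cdot>\<^bsub>D\<^esub> on_Arr F g"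
  by (auto simp: is_functor_def Hom_def)

lemma is_functorI:
  assumes "category C" "category D"
    and "\<And>a. a \<in> Obj C \<Longrightarrow> on_Obj F a \<in> Obj D"
    and "\<And>f a b. f \<in> Hom C a b \<Longrightarrow> on_Arr F f \<in> Hom D (on_Obj F a) (on_Obj F b)"
    and "\<And>a. a \<in> Obj C \<Longrightarrow> on_Arr F (Ide C a) = Ide D (on_Obj F a)"
    and "\<And>f g a b c. f \<in> Hom C a b \<Longrightarrow> g \<in> Hom C b c \<Longrightarrow>
           on_Arr F (f \<cdot>\<^bsub>C\<^esub> g) = on_Arr F f \<cdot>\<^bsub>D\<^esub> on_Arr F g"
  shows "is_functor C D F"
  using assms unfolding is_functor_def Hom_def by auto

text \<open>The quasi-inverse sends \<open>g\<close> to the preimage under \<open>\<Psi>\<close> of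
  its conjugate by the chosen isomorphisms \<open>h\<close>. Faithfulness moves each equation in
  \<open>A\<close> to \<open>B\<close>, where \<open>h\<close> and its inverse \<open>k\<close>
  cancel; the natural isomorphism on \<open>A\<close> is the preimage of \<open>h\<close>.\<close>

theorem equivalent_categories_if_fully_faithful:
  fixes A :: "('o, 'm, 'y) cat_scheme" and B :: "('p, 'n, 'z) cat_scheme"
  assumes \<Psi>: "is_functor A B \<Psi>"
    and full: "\<And>a a' g. a \<in> Obj A \<Longrightarrow> a' \<in> Obj A \<Longrightarrow> g \<in> Hom B (on_Obj \<Psi> a) (on_Obj \<Psi> a') \<Longrightarrow>
      \<exists>f\<in>Hom A a a'. on_Arr \<Psi> f = g"
    and faithful: "\<And>a a' f f'. f \<in> Hom A a a' \<Longrightarrow> f' \<in> Hom A a a' \<Longrightarrow>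
      on_Arr \<Psi> f = on_Arr \<Psi> f' \<Longrightarrow> f = f'"
    and ess: "\<And>b. b \<in> Obj B \<Longrightarrow> \<exists>a\<in>Obj A. \<exists>h\<in>Hom B b (on_Obj \<Psi> a). iso B h"
  shows "equivalent_categories B A"
proof -
  interpret A: category_locale A using \<Psi> by unfold_locales (simp add: is_functor_def)
  interpret B: category_locale B using \<Psi> by unfold_locales (simp add: is_functor_def)
  let ?O = "on_Obj \<Psi>" and ?M = "on_Arr \<Psi>"
  obtain F0 h where F0: "\<And>b. b \<in> Obj B \<Longrightarrow> F0 b \<in> Obj A"
    and h: "\<And>b. b \<in> Obj B \<Longrightarrow> h b \<in> Hom B b (?O (F0 b))" "\<And>b. b \<in> Obj B \<Longrightarrow> iso B (h b)"
    using ess by metis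
  have "\<exists>k. k \<in> Hom B (?O (F0 b)) b \<and> h b \<cdot>\<^bsub>B\<^esub> k = Ide B b \<and> k \<cdot>\<^bsub>B\<^esub> h b = Ide B (?O (F0 b))"
    if "b \<in> Obj B" for b
    using B.isoE[OF h(2) h(1)] that by metis
  then obtain k where k: "\<And>b. b \<in> Obj B \<Longrightarrow> k b \<in> Hom B (?O (F0 b)) b"
    and hk: "\<And>b. b \<in> Obj B \<Longrightarrow> h b \<cdot>\<^bsub>B\<^esub> k b = Ide B b"
    and kh: "\<And>b. b \<in> Obj B \<Longrightarrow> k b \<cdot>\<^bsub>B\<^esub> h b = Ide B (?O (F0 b))"
    by metis
  have lift: "\<exists>f. f \<in> Hom A a a' \<and> ?M f = g"
    if "a \<in> Obj A" "a' \<in> Obj A" "g \<in> Hom B (?O a) (?O a')" for a a' g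
    using full[OF that] by auto
  define L where "L a a' g = (SOME f. f \<in> Hom A a a' \<and> ?M f = g)" for a a' g
  have L: "L a a' g \<in> Hom A a a'" "?M (L a a' g) = g"
    if "a \<in> Obj A" "a' \<in> Obj A" "g \<in> Hom B (?O a) (?O a')" for a a' g
    using someI_ex[OF lift[OF that]] by (simp_all add: L_def)
  define t where "t g = k (Dom B g) \<cdot>\<^bsub>B\<^esub> g \<cdot>\<^bsub>B\<^esub> h (Cod B g)" for g
  have t: "t g \<in> Hom B (?O (F0 b)) (?O (F0 b'))" if "g \<in> Hom B b b'" for g b b'
    using that k h by (auto simp: t_def Hom_D intro!: B.comp_Hom dest: B.Hom_Obj)
  define F where "F = \<lparr>on_Obj = F0, on_Arr = \<lambda>g. L (F0 (Dom B g)) (F0 (Cod B g)) (t g)\<rparr>"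
  have FH: "on_Arr F g \<in> Hom A (F0 b) (F0 b')" "?M (on_Arr F g) = t g" if "g \<in> Hom B b b'" for g b b'
    using L[OF F0 F0 t[OF that]] B.Hom_Obj[OF that] by (simp_all add: F_def Hom_D[OF that])
  have F: "is_functor B A F"
  proof (rule is_functorI)
    show "category B" "category A" by (fact B.cat A.cat)+
    show "on_Obj F b \<in> Obj A" if "b \<in> Obj B" for b using F0 that by (simp add: F_def)
    show "on_Arr F g \<in> Hom A (on_Obj F b) (on_Obj F b')" if "g \<in> Hom B b b'" for g b b'
      using FH[OF that] by (simp add: F_def)
    show "on_Arr F (Ide B b) = Ide A (on_Obj F b)" if b: "b \<in> Obj B" for b
    proof (rule faithful)
      show "on_Arr F (Ide B b) \<in> Hom A (F0 b) (F0 b)" using FH[of "Ide B b"] b by simp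
      show "Ide A (on_Obj F b) \<in> Hom A (F0 b) (F0 b)" using F0[OF b] by (simp add: F_def)
      have "t (Ide B b) = Ide B (?O (F0 b))"
        using b k[OF b] kh[OF b] by (simp add: t_def Hom_D[OF B.Ide_Hom] B.comp_Ide)
      then show "?M (on_Arr F (Ide B b)) = ?M (Ide A (on_Obj F b))"
        using FH(2)[OF B.Ide_Hom[OF b]] functor_Ide[OF \<Psi> F0[OF b]] by (simp add: F_def)
    qed
    show "on_Arr F (f \<cdot>\<^bsub>B\<^esub> g) = on_Arr F f \<cdot>\<^bsub>A\<^esub> on_Arr F g"
      if fg: "f \<in> Hom B a b" "g \<in> Hom B b c" for f g a b c
    proof (rule faithful)
      have fgH: "f \<cdot>\<^bsub>B\<^esub> g \<in> Hom B a c" using fg by (rule B.comp_Hom)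
      show "on_Arr F (f \<cdot>\<^bsub>B\<^esub> g) \<in> Hom A (F0 a) (F0 c)" using FH fgH by blast
      show "on_Arr F f \<cdot>\<^bsub>A\<^esub> on_Arr F g \<in> Hom A (F0 a) (F0 c)"
        using FH fg by (blast intro: A.comp_Hom)
      note O = B.Hom_Obj[OF fg(1)] B.Hom_Obj[OF fg(2)]
      note ks = k[OF O(1)] k[OF O(2)] h(1)[OF O(2)] h(1)[OF O(4)] fg
      have "t f \<cdot>\<^bsub>B\<^esub> t g = k a \<cdot>\<^bsub>B\<^esub> (f \<cdot>\<^bsub>B\<^esub> ((h b \<cdot>\<^bsub>B\<^esub> k b) \<cdot>\<^bsub>B\<^esub> (g \<cdot>\<^bsub>B\<^esub> h c)))"
        using ks by (simp add: t_def Hom_def B.comp_simps)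
      also have "\<dots> = t (f \<cdot>\<^bsub>B\<^esub> g)"
        using ks unfolding hk[OF O(2)] B.Ide_comp[OF B.comp_Hom[OF fg(2) h(1)[OF O(4)]]]
        by (simp add: t_def Hom_def B.comp_simps)
      finally show "?M (on_Arr F (f \<cdot>\<^bsub>B\<^esub> g)) = ?M (on_Arr F f \<cdot>\<^bsub>A\<^esub> on_Arr F g)"
        using FH(2)[OF fgH] FH(2)[OF fg(1)] FH(2)[OF fg(2)]
          functor_comp[OF \<Psi> FH(1)[OF fg(1)] FH(1)[OF fg(2)]] by simp
    qed
  qed
  have hnat: "g \<cdot>\<^bsub>B\<^esub> h b' = h b \<cdot>\<^bsub>B\<^esub> t g" if g: "g \<in> Hom B b b'" for g b b'
  proof -
    note O = B.Hom_Obj[OF g]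
    have "h b \<cdot>\<^bsub>B\<^esub> t g = (h b \<cdot>\<^bsub>B\<^esub> k b) \<cdot>\<^bsub>B\<^esub> (g \<cdot>\<^bsub>B\<^esub> h b')"
      unfolding t_def Hom_D[OF g]
      using h(1)[OF O(1)] k[OF O(1)] g h(1)[OF O(2)] by (simp add: Hom_def B.comp_simps)
    then show ?thesis
      using hk[OF O(1)] B.Ide_comp[OF B.comp_Hom[OF g h(1)[OF O(2)]]] by simp
  qed
  have n1: "naturally_isomorphic B B id_map (then_map F \<Psi>)"
    unfolding naturally_isomorphic_def
  proof (intro exI[of _ h] conjI ballI)
    fix b assume "b \<in> Obj B"
    then show "h b \<in> Hom B (on_Obj id_map b) (on_Obj (then_map F \<Psi>) b)" "iso B (h b)"
      using h by (simp_all add: id_map_def then_map_def F_def)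
  next
    fix f assume "f \<in> Arr B"
    from Arr_Hom[OF this] show "on_Arr id_map f \<cdot>\<^bsub>B\<^esub> h (Cod B f) = h (Dom B f) \<cdot>\<^bsub>B\<^esub> on_Arr (then_map F \<Psi>) f"
      using hnat FH(2) by (simp add: id_map_def then_map_def)
  qed
  define e where "e a = L a (F0 (?O a)) (h (?O a))" for a
  have e: "e a \<in> Hom A a (F0 (?O a))" "?M (e a) = h (?O a)" if "a \<in> Obj A" for a
    using L[of a "F0 (?O a)" "h (?O a)"] that functor_Obj[OF \<Psi> that] F0 h by (simp_all add: e_def)
  have n2: "naturally_isomorphic A A id_map (then_map \<Psi> F)"
    unfolding naturally_isomorphic_def
  proof (intro exI[of _ e] conjI ballI)
    fix a assume a: "a \<in> Obj A"
    note b = functor_Obj[OF \<Psi> a]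
    show "e a \<in> Hom A (on_Obj id_map a) (on_Obj (then_map \<Psi> F) a)"
      using e a by (simp add: id_map_def then_map_def F_def)
    obtain g where g: "g \<in> Hom A (F0 (?O a)) a" "?M g = k (?O a)"
      using full[OF F0[OF b] a k[OF b]] by auto
    show "iso A (e a)"
    proof (rule A.isoI[OF e(1)[OF a] g(1)])
      show "e a \<cdot>\<^bsub>A\<^esub> g = Ide A a"
        using functor_comp[OF \<Psi> e(1)[OF a] g(1)] g e[OF a] hk[OF b] functor_Ide[OF \<Psi> a]
        by (intro faithful[OF A.comp_Hom[OF e(1)[OF a] g(1)] A.Ide_Hom[OF a]]) simp
      show "g \<cdot>\<^bsub>A\<^esub> e a = Ide A (F0 (?O a))"
        using functor_comp[OF \<Psi> g(1) e(1)[OF a]] g e[OF a] kh[OF b] functor_Ide[OF \<Psi> F0[OF b]]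
        by (intro faithful[OF A.comp_Hom[OF g(1) e(1)[OF a]] A.Ide_Hom[OF F0[OF b]]]) simp
    qed
  next
    fix f assume f': "f \<in> Arr A"
    define a a' where "a = Dom A f" and "a' = Cod A f"
    have f: "f \<in> Hom A a a'" using Arr_Hom[OF f'] by (simp add: a_def a'_def)
    note O = A.Hom_Obj[OF f]
    note Mf = functor_Hom[OF \<Psi> f]
    have "f \<cdot>\<^bsub>A\<^esub> e a' = e a \<cdot>\<^bsub>A\<^esub> on_Arr F (?M f)"
    proof (rule faithful)
      show "f \<cdot>\<^bsub>A\<^esub> e a' \<in> Hom A a (F0 (?O a'))" using f e O by (blast intro: A.comp_Hom)
      show "e a \<cdot>\<^bsub>A\<^esub> on_Arr F (?M f) \<in> Hom A a (F0 (?O a'))"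
        using FH[OF Mf] e O by (blast intro: A.comp_Hom)
      show "?M (f \<cdot>\<^bsub>A\<^esub> e a') = ?M (e a \<cdot>\<^bsub>A\<^esub> on_Arr F (?M f))"
        using functor_comp[OF \<Psi> f e(1)[OF O(2)]] functor_comp[OF \<Psi> e(1)[OF O(1)] FH(1)[OF Mf]]
          e(2) O FH(2)[OF Mf] hnat[OF Mf] by simp
    qed
    then show "on_Arr id_map f \<cdot>\<^bsub>A\<^esub> e (Cod A f) = e (Dom A f) \<cdot>\<^bsub>A\<^esub> on_Arr (then_map \<Psi> F) f"
      by (simp add: id_map_def then_map_def a_def a'_def)
  qed
  show ?thesis
    unfolding equivalent_categories_def using F \<Psi> n1 n2 by blast
qed

section \<open>Epimorphic parts in normal categories\<close>

locale normal_cat =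
  fixes C :: "('o, 'm) scat" (structure)
  assumes normal: "normal_category C"

sublocale normal_cat \<subseteq> category_locale C
  using normal by unfold_locales (simp add: normal_category_def category_with_subobjects_def)

context normal_cat
begin

definition Inc :: "'o \<Rightarrow> 'o \<Rightarrow> 'm set" where
  "Inc a b = {j \<in> Incl C. Dom C j = a \<and> Cod C j = b}"

text \<open>
  In a normal factorisation \<open>f = q u j\<close> the morphism \<open>q u\<close> is a split epimorphism, and a factorisation of
  \<open>f\<close> into a split epimorphism and an inclusion is unique. So \<open>f\<degree>\<close> can be handled without mentioning
  \<open>q\<close> and \<open>u\<close>, and it is preserved by all inclusion preserving functors.
\<close>

definition split_epi :: "'m \<Rightarrow> bool" where
  "split_epi e \<longleftrightarrow> e \<in> Arr C \<and> (\<exists>s\<in>Hom C (Cod C e) (Dom C e). s \<cdot> e = Ide C (Cod C e))"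

section \<open>The partial order of inclusions\<close>

lemma strict: "strict_preorder (incl_cat C)"
  using normal by (simp add: normal_category_def category_with_subobjects_def)

lemma incl_category: "category (incl_cat C)"
  using strict by (simp add: strict_preorder_def)

lemma Hom_incl_cat: "Hom (incl_cat C) a b = Inc a b"
  by (simp add: Hom_def Inc_def incl_cat_def)

lemma Inc_Hom: "j \<in> Inc a b \<Longrightarrow> j \<in> Hom C a b"
  using normal by (auto simp: Inc_def Hom_def normal_category_def category_with_subobjects_def)

lemma Incl_Inc: "j \<in> Incl C \<Longrightarrow> j \<in> Inc (Dom C j) (Cod C j)"
  by (simp add: Inc_def)

lemma Inc_unique: "j \<in> Inc a b \<Longrightarrow> k \<in> Inc a b \<Longrightarrow> j = k"
  using strict by (auto simp: strict_preorder_def incl_cat_def Inc_def)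

lemma Inc_comp: "j \<in> Inc a b \<Longrightarrow> k \<in> Inc b c \<Longrightarrow> j \<cdot> k \<in> Inc a c"
  using category_locale.comp_Hom[OF category_locale.intro[OF incl_category]]
  unfolding Hom_incl_cat by (simp add: incl_cat_def)

lemma Inc_Ide: "a \<in> Obj C \<Longrightarrow> Ide C a \<in> Inc a a"
  using category_locale.Ide_Hom[OF category_locale.intro[OF incl_category]]
  unfolding Hom_incl_cat by (simp add: incl_cat_def)

text \<open>Both composites are inclusions of an object into itself, hence identities by uniqueness.
  So \<open>j\<close> is invertible among the inclusions, and strictness makes it an
  identity.\<close>

lemma Inc_antisym:
  assumes "j \<in> Inc a b" "k \<in> Inc b a"
  shows "a = b"
proof -
  have a: "a \<in> Obj C" and b: "b \<in> Obj C" using Hom_Obj[OF Inc_Hom[OF assms(1)]] .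
  have "j \<cdot> k = Ide C a" "k \<cdot> j = Ide C b"
    using Inc_unique[OF Inc_comp[OF assms] Inc_Ide[OF a]]
      Inc_unique[OF Inc_comp[OF assms(2,1)] Inc_Ide[OF b]] by auto
  then have "iso (incl_cat C) j"
    using assms by (auto simp: iso_def incl_cat_def Inc_def Hom_def)
  then have "j = Ide C a"
    using strict assms(1) unfolding strict_preorder_def by (auto simp: incl_cat_def Inc_def)
  then show ?thesis using Inc_Ide[OF a] assms(1) by (simp add: Inc_def)
qed

lemma Inc_cancel:
  assumes "g \<in> Hom C c a" "h \<in> Hom C c a" "j \<in> Inc a b" "g \<cdot> j = h \<cdot> j"
  shows "g = h"
proof -
  have "monic C j"
    using normal assms(3) by (simp add: normal_category_def category_with_subobjects_def Inc_def)
  then show ?thesis using assms by (simp add: monic_def Inc_def Hom_def)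
qed

lemma Inc_factor:
  assumes "h \<in> Hom C a b" "g \<in> Inc b c" "h \<cdot> g \<in> Inc a c"
  shows "h \<in> Inc a b"
proof -
  have "\<forall>f\<in>Incl C. \<forall>g\<in>Incl C. \<forall>h\<in>Arr C. Cod C h = Dom C g \<longrightarrow> f = h \<cdot> g \<longrightarrow> h \<in> Incl C"
    using normal unfolding normal_category_def category_with_subobjects_def by blast
  moreover have "h \<cdot> g \<in> Incl C" "g \<in> Incl C" "h \<in> Arr C" "Cod C h = Dom C g" "Dom C h = a" "Cod C h = b"
    using assms by (auto simp: Inc_def Hom_def)
  ultimately show ?thesis unfolding Inc_def by blast
qed

section \<open>Split epimorphisms and epimorphic parts\<close>

lemma split_epiE:
  assumes "split_epi e" "e \<in> Hom C a b"
  obtains s where "s \<in> Hom C b a" "s \<cdot> e = Ide C b"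
  using assms by (auto simp: split_epi_def Hom_def)

lemma split_epiI:
  "e \<in> Hom C a b \<Longrightarrow> s \<in> Hom C b a \<Longrightarrow> s \<cdot> e = Ide C b \<Longrightarrow> split_epi e"
  by (auto simp: split_epi_def Hom_def)

lemma split_epi_Ide: "a \<in> Obj C \<Longrightarrow> split_epi (Ide C a)"
  by (rule split_epiI[of _ a a "Ide C a"]) (auto simp: Ide_comp[OF Ide_Hom])

lemma iso_split_epi: "iso C u \<Longrightarrow> split_epi u"
  by (auto simp: split_epi_def iso_def)

lemma split_epi_cancel:
  assumes "split_epi e" "e \<in> Hom C a b" "f \<in> Hom C b c" "g \<in> Hom C b d" "e \<cdot> f = e \<cdot> g"
  shows "f = g"
proof -
  obtain s where s: "s \<in> Hom C b a" "s \<cdot> e = Ide C b" using assms by (elim split_epiE)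
  have "f = s \<cdot> (e \<cdot> f)" "g = s \<cdot> (e \<cdot> g)"
    using s assms comp_assoc[OF s(1) assms(2,3)] comp_assoc[OF s(1) assms(2,4)]
    by (simp_all add: Ide_comp)
  then show ?thesis using assms by simp
qed

lemma split_epi_comp:
  assumes "split_epi e" "e \<in> Hom C a b" "split_epi f" "f \<in> Hom C b c"
  shows "split_epi (e \<cdot> f)"
proof -
  obtain s where s: "s \<in> Hom C b a" "s \<cdot> e = Ide C b" using assms by (elim split_epiE)
  obtain t where t: "t \<in> Hom C c b" "t \<cdot> f = Ide C c" using assms by (elim split_epiE)
  have "(t \<cdot> s) \<cdot> (e \<cdot> f) = t \<cdot> ((s \<cdot> e) \<cdot> f)"
    using s(1) t(1) assms(2,4) by (simp add: Hom_def comp_simps)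
  then have "(t \<cdot> s) \<cdot> (e \<cdot> f) = Ide C c" using s t assms by (simp add: Ide_comp)
  then show ?thesis
    using s(1) t(1) assms(2,4) by (intro split_epiI[of _ a c "t \<cdot> s"]) (auto intro: comp_Hom)
qed

text \<open>If \<open>s\<close> splits \<open>e\<close>, then
  \<open>(s \<cdot> e') \<cdot> j' = j\<close>, so \<open>s \<cdot> e'\<close> is an inclusion of
  \<open>w\<close> into \<open>w'\<close>. By symmetry and antisymmetry the images agree; then the
  inclusions agree, and \<open>j\<close> can be cancelled.\<close>

lemma epi_factorisation_unique:
  assumes e: "split_epi e" "e \<in> Hom C a w" "j \<in> Inc w b"
    and e': "split_epi e'" "e' \<in> Hom C a w'" "j' \<in> Inc w' b" and eq: "e \<cdot> j = e' \<cdot> j'"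
  shows "w = w' \<and> e = e' \<and> j = j'"
proof -
  have sub: "\<exists>k. k \<in> Inc w w'" if hyp: "split_epi e" "e \<in> Hom C a w" "j \<in> Inc w b"
    "e' \<in> Hom C a w'" "j' \<in> Inc w' b" "e \<cdot> j = e' \<cdot> j'" for e w j e' w' j'
  proof -
    obtain s where s: "s \<in> Hom C w a" "s \<cdot> e = Ide C w" using split_epiE[OF hyp(1,2)] .
    have "(s \<cdot> e') \<cdot> j' = j"
      using hyp s comp_assoc[OF s(1) hyp(4) Inc_Hom[OF hyp(5)]]
        comp_assoc[OF s(1) hyp(2) Inc_Hom[OF hyp(3)]] by (simp add: Ide_comp[OF Inc_Hom])
    then show ?thesis using hyp s by (metis Inc_factor comp_Hom)
  qed
  obtain k l where "k \<in> Inc w w'" "l \<in> Inc w' w"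
    using sub[OF e e'(2,3) eq] sub[OF e' e(2,3) eq[symmetric]] by auto
  then have w: "w = w'" by (rule Inc_antisym)
  then have "j = j'" using e e' Inc_unique by auto
  then show ?thesis using w e e' eq Inc_cancel by blast
qed

lemma normal_factorisationD:
  assumes "normal_factorisation C f q u j" "f \<in> Hom C a b"
  shows "split_epi (q \<cdot> u)" "q \<cdot> u \<in> Hom C a (Dom C j)" "j \<in> Inc (Dom C j) b" "f = (q \<cdot> u) \<cdot> j"
proof -
  have nf: "retraction C q" "iso C u" "j \<in> Incl C" "Cod C q = Dom C u" "Cod C u = Dom C j"
    and f: "f = (q \<cdot> u) \<cdot> j" using assms by (auto simp: normal_factorisation_def)
  obtain i where i: "i \<in> Inc (Cod C q) (Dom C q)" "q \<in> Hom C (Dom C q) (Cod C q)" "i \<cdot> q = Ide C (Cod C q)"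
    using nf(1) by (auto simp: retraction_def retraction_of_def Inc_def Hom_def)
  have q: "split_epi q" using i(1) by (intro split_epiI[OF i(2) _ i(3)] Inc_Hom)
  have u: "u \<in> Hom C (Cod C q) (Dom C j)" using nf by (auto simp: iso_def Hom_def)
  have qu: "q \<cdot> u \<in> Hom C (Dom C q) (Dom C j)" using i u by (blast intro: comp_Hom)
  have "f \<in> Hom C (Dom C q) (Cod C j)"
    unfolding f using qu Inc_Hom[OF Incl_Inc[OF nf(3)]] by (rule comp_Hom)
  then have "a = Dom C q" "b = Cod C j" using assms(2) by (auto simp: Hom_def)
  then show "q \<cdot> u \<in> Hom C a (Dom C j)" "j \<in> Inc (Dom C j) b" using qu nf by (auto simp: Inc_def)
  show "f = (q \<cdot> u) \<cdot> j" by (fact f)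
  show "split_epi (q \<cdot> u)" using q i(2) iso_split_epi[OF nf(2)] u by (rule split_epi_comp)
qed

text \<open>Normality provides some normal factorisation, and uniqueness identifies its
  \<open>q \<cdot> u\<close> with \<open>e\<close>. So \<open>e\<close> itself never has to be split
  into a retraction and an isomorphism.\<close>

lemma epi_part_eqI:
  assumes "split_epi e" "e \<in> Hom C a w" "j \<in> Inc w b"
  shows "epi_part C (e \<cdot> j) = e"
proof -
  let ?f = "e \<cdot> j"
  have f: "?f \<in> Hom C a b" using assms Inc_Hom comp_Hom by blast
  obtain q u k where nf: "normal_factorisation C ?f q u k"
    using normal Hom_D[OF f] unfolding normal_category_def by blast
  have un: "e = q \<cdot> u" if "normal_factorisation C ?f q u k" for q u k
    using epi_factorisation_unique[OF assms normal_factorisationD(1-3)[OF that f]]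
      normal_factorisationD(4)[OF that f] by auto
  show ?thesis unfolding epi_part_def
  proof (rule the_equality)
    show "\<exists>q u k. normal_factorisation C ?f q u k \<and> e = q \<cdot> u" using nf un by blast
  qed (use un in auto)
qed

lemma epi_partE:
  assumes "f \<in> Hom C a b"
  obtains w j where "epi_part C f \<in> Hom C a w" "split_epi (epi_part C f)" "j \<in> Inc w b"
    "f = epi_part C f \<cdot> j"
proof -
  obtain q u j where nf: "normal_factorisation C f q u j"
    using normal Hom_D[OF assms] unfolding normal_category_def by blast
  note n = normal_factorisationD[OF nf assms]
  have "epi_part C f = q \<cdot> u" using epi_part_eqI[OF n(1-3)] n(4) by simp
  then show ?thesis using n that by metis
qed

lemma epi_part_split: "split_epi e \<Longrightarrow> e \<in> Hom C a b \<Longrightarrow> epi_part C e = e"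
  using epi_part_eqI[of e a b "Ide C b" b] Inc_Ide Hom_Obj comp_Ide by metis

lemma epi_part_Inc: "j \<in> Inc a b \<Longrightarrow> epi_part C j = Ide C a"
  using epi_part_eqI[OF split_epi_Ide Ide_Hom] Ide_comp[OF Inc_Hom] Hom_Obj(1)[OF Inc_Hom] by metis

lemma epi_part_comp_Inc:
  assumes "f \<in> Hom C a b" "j \<in> Inc b c"
  shows "epi_part C (f \<cdot> j) = epi_part C f"
proof -
  obtain w k where e: "epi_part C f \<in> Hom C a w" "split_epi (epi_part C f)" "k \<in> Inc w b"
    "f = epi_part C f \<cdot> k" using epi_partE[OF assms(1)] .
  have "f \<cdot> j = epi_part C f \<cdot> (k \<cdot> j)"
    using e(4) comp_assoc[OF e(1) Inc_Hom[OF e(3)] Inc_Hom[OF assms(2)]] by simp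
  then show ?thesis using epi_part_eqI[OF e(2,1) Inc_comp[OF e(3) assms(2)]] by simp
qed

lemma epi_part_comp_left:
  assumes "split_epi e" "e \<in> Hom C a b" "g \<in> Hom C b c"
  shows "epi_part C (e \<cdot> g) = e \<cdot> epi_part C g"
proof -
  obtain w k where g: "epi_part C g \<in> Hom C b w" "split_epi (epi_part C g)" "k \<in> Inc w c"
    "g = epi_part C g \<cdot> k" using epi_partE[OF assms(3)] .
  have "e \<cdot> g = (e \<cdot> epi_part C g) \<cdot> k"
    using g(4) comp_assoc[OF assms(2) g(1) Inc_Hom[OF g(3)]] by simp
  then show ?thesis
    using epi_part_eqI[OF split_epi_comp[OF assms(1,2) g(2,1)] comp_Hom[OF assms(2) g(1)] g(3)] by simp
qed

text \<open>Passing from \<open>g\<close> to \<open>epi_part C g\<close> removes an inclusion on the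
  right, which epimorphic parts do not see.\<close>

lemma epi_part_comp_epi_part:
  assumes "f \<in> Hom C a b" "g \<in> Hom C b c"
  shows "epi_part C (f \<cdot> epi_part C g) = epi_part C (f \<cdot> g)"
proof -
  obtain w k where g: "epi_part C g \<in> Hom C b w" "split_epi (epi_part C g)" "k \<in> Inc w c"
    "g = epi_part C g \<cdot> k" using epi_partE[OF assms(2)] .
  have "f \<cdot> g = (f \<cdot> epi_part C g) \<cdot> k"
    using g(4) comp_assoc[OF assms(1) g(1) Inc_Hom[OF g(3)]] by simp
  then show ?thesis using epi_part_comp_Inc[OF comp_Hom[OF assms(1) g(1)] g(3)] by simp
qed

end

section \<open>The semigroup of cones\<close>

context normal_cat
begin

abbreviation cone_mult (infixl "\<star>" 70) where
  "\<gamma> \<star> \<delta> \<equiv> \<gamma> \<otimes>\<^bsub>cones C\<^esub> \<delta>"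

abbreviation cone_le (infix "\<sqsubseteq>" 50) where
  "\<gamma> \<sqsubseteq> \<delta> \<equiv> right_ideal (cones C) \<gamma> \<subseteq> right_ideal (cones C) \<delta>"

lemma cone_ObjD: "cone_at C z \<gamma> \<Longrightarrow> z \<in> Obj C"
  by (simp add: cone_at_def)

lemma cone_Hom: "cone_at C z \<gamma> \<Longrightarrow> c \<in> Obj C \<Longrightarrow> \<gamma> c \<in> Hom C c z"
  by (auto simp: cone_at_def)

lemma cone_Inc: "cone_at C z \<gamma> \<Longrightarrow> j \<in> Inc a b \<Longrightarrow> j \<cdot> \<gamma> b = \<gamma> a"
  by (auto simp: cone_at_def Inc_def)

lemma cone_eqI:
  "cone_at C z \<gamma> \<Longrightarrow> cone_at C w \<delta> \<Longrightarrow> (\<And>c. c \<in> Obj C \<Longrightarrow> \<gamma> c = \<delta> c) \<Longrightarrow> \<gamma> = \<delta>"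
  by (rule extensionalityI[of _ "Obj C"]) (auto simp: cone_at_def PiE_def)

lemma cone_isoE:
  assumes "cone_at C z \<gamma>"
  obtains c v where "c \<in> Obj C" "v \<in> Hom C z c" "\<gamma> c \<cdot> v = Ide C c" "v \<cdot> \<gamma> c = Ide C z"
proof -
  obtain c where c: "c \<in> Obj C" "iso C (\<gamma> c)" using assms by (auto simp: cone_at_def)
  show ?thesis using isoE[OF c(2) cone_Hom[OF assms c(1)]] that[OF c(1)] by blast
qed

lemma cone_unique:
  assumes "cone_at C z \<gamma>" "cone_at C w \<gamma>"
  shows "z = w"
  using Hom_D(3)[OF cone_Hom[OF assms(1) cone_ObjD[OF assms(1)]]]
    Hom_D(3)[OF cone_Hom[OF assms(2) cone_ObjD[OF assms(1)]]] by simp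

lemma vertex_eq: "cone_at C z \<gamma> \<Longrightarrow> vertex C \<gamma> = z"
  unfolding vertex_def by (rule the_equality) (auto dest: cone_unique)

lemma in_cones_iff: "\<gamma> \<in> carrier (cones C) \<longleftrightarrow> (\<exists>z. cone_at C z \<gamma>)"
  by (simp add: cones_def)

lemma in_conesI: "cone_at C z \<gamma> \<Longrightarrow> \<gamma> \<in> carrier (cones C)"
  by (auto simp: cones_def)

lemma normal_coneE:
  assumes "c \<in> Obj C"
  obtains \<mu> where "cone_at C c \<mu>" "\<mu> c = Ide C c"
  using normal assms unfolding normal_category_def by blast

lemma cone_star_apply: "c \<in> Obj C \<Longrightarrow> cone_star C \<gamma> f c = \<gamma> c \<cdot> f"
  by (simp add: cone_star_def)

text \<open>
  For an isomorphism \<open>\<gamma> c\<close> and \<open>s e = 1\<close>, the component of \<open>\<gamma> * e\<close> at the image of \<open>s (\<gamma> c)\<^sup>-\<^sup>1\<close>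
  is an isomorphism again.
\<close>

lemma cone_star_cone:
  assumes \<gamma>: "cone_at C z \<gamma>" and e: "split_epi e" "e \<in> Hom C z w"
  shows "cone_at C w (cone_star C \<gamma> e)"
proof -
  obtain s where s: "s \<in> Hom C w z" "s \<cdot> e = Ide C w" using split_epiE[OF e] .
  obtain c v where c: "c \<in> Obj C" and v: "v \<in> Hom C z c" "v \<cdot> \<gamma> c = Ide C z"
    using cone_isoE[OF \<gamma>] .
  have gc: "\<gamma> c \<in> Hom C c z" using cone_Hom[OF \<gamma> c] .
  obtain w' j where t: "epi_part C (s \<cdot> v) \<in> Hom C w w'" "split_epi (epi_part C (s \<cdot> v))"
    "j \<in> Inc w' c" and sv: "s \<cdot> v = epi_part C (s \<cdot> v) \<cdot> j"
    using epi_partE[OF comp_Hom[OF s(1) v(1)]] .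
  define t where "t = epi_part C (s \<cdot> v)"
  note t = t[folded t_def] and sv = sv[folded t_def]
  obtain p where p: "p \<in> Hom C w' w" "p \<cdot> t = Ide C w'" using split_epiE[OF t(2,1)] .
  note jH = Inc_Hom[OF t(3)]
  have w': "w' \<in> Obj C" using Hom_Obj p by blast
  define r where "r = \<gamma> w' \<cdot> e"
  have gw': "\<gamma> w' \<in> Hom C w' z" using cone_Hom[OF \<gamma> w'] .
  have r: "r \<in> Hom C w' w" using gw' e unfolding r_def by (blast intro: comp_Hom)
  have "t \<cdot> r = (t \<cdot> j) \<cdot> (\<gamma> c \<cdot> e)"
    using t(1) jH gc e(2) unfolding r_def cone_Inc[OF \<gamma> t(3), symmetric]
    by (simp add: Hom_def comp_simps)
  also have "\<dots> = s \<cdot> ((v \<cdot> \<gamma> c) \<cdot> e)"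
    using s(1) v(1) gc e(2) unfolding sv[symmetric] by (simp add: Hom_def comp_simps)
  finally have tr: "t \<cdot> r = Ide C w" using s v Ide_comp[OF e(2)] by simp
  \<comment> \<open>\<open>p\<close> and \<open>r\<close> are inverses of \<open>t\<close> on
    opposite sides, so they coincide.\<close>
  have "r = p"
    using comp_assoc[OF p(1) t(1) r] Ide_comp[OF r] comp_Ide[OF p(1)] p(2) tr by simp
  then have "iso C r" using isoI[OF r t(1)] p(2) tr by simp
  moreover have "j \<cdot> (\<gamma> (Cod C j) \<cdot> e) = \<gamma> (Dom C j) \<cdot> e" if "j \<in> Incl C" for j
    using comp_assoc[OF Inc_Hom[OF Incl_Inc[OF that]] cone_Hom[OF \<gamma> Hom_Obj(2)[OF Inc_Hom[OF Incl_Inc[OF that]]]] e(2)]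
      cone_Inc[OF \<gamma> Incl_Inc[OF that]] by simp
  ultimately show ?thesis
    using w' Hom_Obj(2)[OF e(2)] comp_Hom[OF cone_Hom[OF \<gamma>] e(2)]
      Hom_Obj[OF Inc_Hom[OF Incl_Inc]]
    unfolding cone_at_def r_def cone_star_def by auto
qed

lemma cone_star_comp:
  assumes "cone_at C z \<gamma>" "e \<in> Hom C z w" "f \<in> Hom C w v"
  shows "cone_star C (cone_star C \<gamma> e) f = cone_star C \<gamma> (e \<cdot> f)"
  using comp_assoc[OF cone_Hom[OF assms(1)] assms(2,3)]
  by (auto simp: cone_star_def intro: restrict_ext)

lemma cone_star_Ide: "cone_at C z \<gamma> \<Longrightarrow> cone_star C \<gamma> (Ide C z) = \<gamma>"
  using cone_eqI[OF cone_star_cone[OF _ split_epi_Ide Ide_Hom]] cone_ObjD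
  by (metis cone_star_apply comp_Ide cone_Hom)

section \<open>Multiplication of cones\<close>

lemma mult_eq: "cone_at C z \<gamma> \<Longrightarrow> \<gamma> \<star> \<delta> = cone_star C \<gamma> (epi_part C (\<delta> z))"
  by (simp add: cones_def vertex_eq)

lemma multE:
  assumes "cone_at C z \<gamma>" "cone_at C w \<delta>"
  obtains v j where "epi_part C (\<delta> z) \<in> Hom C z v" "split_epi (epi_part C (\<delta> z))" "j \<in> Inc v w"
    "\<delta> z = epi_part C (\<delta> z) \<cdot> j" "cone_at C v (\<gamma> \<star> \<delta>)"
  using epi_partE[OF cone_Hom[OF assms(2) cone_ObjD[OF assms(1)]]] cone_star_cone[OF assms(1)]
  by (metis mult_eq[OF assms(1)])

lemma mult_in_cones:
  "\<gamma> \<in> carrier (cones C) \<Longrightarrow> \<delta> \<in> carrier (cones C) \<Longrightarrow> \<gamma> \<star> \<delta> \<in> carrier (cones C)"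
  unfolding in_cones_iff by (metis multE)

text \<open>Both products are \<open>\<gamma>\<close> followed by an epimorphism. With
  \<open>\<delta> z = epi_part C (\<delta> z) \<cdot> j\<close>, the cone condition turns
  \<open>j \<cdot> \<eta> w\<close> into \<open>\<eta> v\<close>, where \<open>v\<close> is the
  vertex of \<open>\<gamma> \<star> \<delta>\<close>; hence the two epimorphisms agree.\<close>

lemma mult_assoc:
  assumes "\<gamma> \<in> carrier (cones C)" "\<delta> \<in> carrier (cones C)" "\<eta> \<in> carrier (cones C)"
  shows "(\<gamma> \<star> \<delta>) \<star> \<eta> = \<gamma> \<star> (\<delta> \<star> \<eta>)"
proof -
  obtain z w y where \<gamma>: "cone_at C z \<gamma>" and \<delta>: "cone_at C w \<delta>" and \<eta>: "cone_at C y \<eta>"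
    using assms unfolding in_cones_iff by blast
  obtain v j where d: "epi_part C (\<delta> z) \<in> Hom C z v" "split_epi (epi_part C (\<delta> z))" "j \<in> Inc v w"
    "\<delta> z = epi_part C (\<delta> z) \<cdot> j" and gd: "cone_at C v (\<gamma> \<star> \<delta>)" using multE[OF \<gamma> \<delta>] .
  have z: "z \<in> Obj C" and w: "w \<in> Obj C" and v: "v \<in> Obj C"
    using cone_ObjD \<gamma> \<delta> gd by auto
  have hv: "\<eta> v \<in> Hom C v y" and hw: "\<eta> w \<in> Hom C w y" using cone_Hom[OF \<eta>] v w by auto
  obtain u k where h: "epi_part C (\<eta> v) \<in> Hom C v u" using epi_partE[OF hv] .
  have "(\<gamma> \<star> \<delta>) \<star> \<eta> = cone_star C \<gamma> (epi_part C (\<delta> z) \<cdot> epi_part C (\<eta> v))"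
    using mult_eq[OF gd] mult_eq[OF \<gamma>] cone_star_comp[OF \<gamma> d(1) h] by simp
  also have "epi_part C (\<delta> z) \<cdot> epi_part C (\<eta> v) = epi_part C (epi_part C (\<delta> z) \<cdot> (j \<cdot> \<eta> w))"
    using epi_part_comp_left[OF d(2,1) hv] cone_Inc[OF \<eta> d(3)] by simp
  also have "\<dots> = epi_part C (\<delta> z \<cdot> epi_part C (\<eta> w))"
    using comp_assoc[OF d(1) Inc_Hom[OF d(3)] hw] d(4) epi_part_comp_epi_part[OF cone_Hom[OF \<delta> z] hw] by simp
  finally show ?thesis
    using mult_eq[OF \<gamma>] mult_eq[OF \<delta>] z by (simp add: cone_star_apply)
qed

text \<open>The right factor has component \<open>e\<close> at \<open>z\<close>, which is its own
  epimorphic part. This links composition with split epimorphisms to right ideals.\<close>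

lemma cone_star_eq_mult:
  assumes "cone_at C z \<gamma>" "split_epi e" "e \<in> Hom C z w" "cone_at C z \<mu>" "\<mu> z = Ide C z"
  shows "\<gamma> \<star> cone_star C \<mu> e = cone_star C \<gamma> e"
  using assms cone_ObjD[OF assms(1)] by (simp add: mult_eq cone_star_apply Ide_comp epi_part_split)

text \<open>The component of \<open>\<mu>\<close> at \<open>z\<close> is the inclusion
  \<open>j\<close>, whose epimorphic part is an identity. An idempotent cone is thus a right
  identity for all cones whose vertex is a subobject of its own.\<close>

lemma mult_Inc:
  assumes "cone_at C z \<gamma>" "cone_at C w \<mu>" "\<mu> w = Ide C w" "j \<in> Inc z w"
  shows "\<gamma> \<star> \<mu> = \<gamma>"
proof -
  have "\<mu> z = j" using cone_Inc[OF assms(2,4)] assms(3) comp_Ide[OF Inc_Hom[OF assms(4)]] by simp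
  then show ?thesis
    using assms(1) cone_star_Ide by (simp add: mult_eq[OF assms(1)] epi_part_Inc[OF assms(4)])
qed

lemma mult_Ide:
  assumes "cone_at C z \<gamma>" "cone_at C z \<mu>" "\<mu> z = Ide C z"
  shows "\<gamma> \<star> \<mu> = \<gamma>"
  using mult_Inc[OF assms Inc_Ide[OF cone_ObjD[OF assms(1)]]] .

section \<open>Principal right ideals and idempotent cones\<close>

lemma cone_le_mult:
  assumes "\<delta> \<in> carrier (cones C)" "x \<in> carrier (cones C)"
  shows "\<delta> \<star> x \<sqsubseteq> \<delta>"
  using assms mult_assoc mult_in_cones by (fastforce simp: right_ideal_def)

text \<open>A product \<open>\<delta> \<star> x\<close> is \<open>\<delta>\<close> followed by the
  epimorphic part of \<open>x w\<close>; conversely a cone with an identity at \<open>w\<close>,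
  supplied by normality, turns composition with \<open>e\<close> into a product. All later
  comparisons of cones go through this criterion.\<close>

lemma cone_le_iff:
  assumes "cone_at C z \<gamma>" "cone_at C w \<delta>"
  shows "\<gamma> \<sqsubseteq> \<delta> \<longleftrightarrow> (\<exists>e. e \<in> Hom C w z \<and> split_epi e \<and> \<gamma> = cone_star C \<delta> e)"
proof
  assume "\<gamma> \<sqsubseteq> \<delta>"
  then have "\<gamma> = \<delta> \<or> (\<exists>x\<in>carrier (cones C). \<gamma> = \<delta> \<star> x)" by (auto simp: right_ideal_def)
  then show "\<exists>e. e \<in> Hom C w z \<and> split_epi e \<and> \<gamma> = cone_star C \<delta> e"
  proof (elim disjE bexE)
    assume "\<gamma> = \<delta>"
    then show ?thesis
      using cone_unique[OF assms(1)] assms(2) cone_star_Ide split_epi_Ide Ide_Hom cone_ObjD by metis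
  next
    fix x assume "x \<in> carrier (cones C)" and \<gamma>: "\<gamma> = \<delta> \<star> x"
    then obtain y where x: "cone_at C y x" by (auto simp: in_cones_iff)
    obtain v j where "epi_part C (x w) \<in> Hom C w v" "split_epi (epi_part C (x w))" "cone_at C v (\<delta> \<star> x)"
      using multE[OF assms(2) x] .
    then show ?thesis using cone_unique[OF assms(1)] \<gamma> mult_eq[OF assms(2)] by metis
  qed
next
  assume "\<exists>e. e \<in> Hom C w z \<and> split_epi e \<and> \<gamma> = cone_star C \<delta> e"
  then obtain e where e: "e \<in> Hom C w z" "split_epi e" "\<gamma> = cone_star C \<delta> e" by blast
  obtain \<mu> where \<mu>: "cone_at C w \<mu>" "\<mu> w = Ide C w" using normal_coneE[OF cone_ObjD[OF assms(2)]] .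
  show "\<gamma> \<sqsubseteq> \<delta>"
    using cone_le_mult[OF in_conesI[OF assms(2)] in_conesI[OF cone_star_cone[OF \<mu>(1) e(2,1)]]]
      cone_star_eq_mult[OF assms(2) e(2,1) \<mu>] e(3) by simp
qed

text \<open>As \<open>\<epsilon> c\<close> is an identity, the split epimorphism leading from
  \<open>\<epsilon>\<close> to \<open>\<gamma>\<close> is the component of \<open>\<gamma>\<close>
  at \<open>c\<close>. A cone below an idempotent is therefore determined by a single
  component.\<close>

lemma cone_le_idempotent:
  assumes "cone_at C c \<epsilon>" "\<epsilon> c = Ide C c" "cone_at C z \<gamma>" "\<gamma> \<sqsubseteq> \<epsilon>"
  shows "\<gamma> = cone_star C \<epsilon> (\<gamma> c)" "split_epi (\<gamma> c)" "\<epsilon> \<star> \<gamma> = \<gamma>"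
proof -
  obtain e where e: "e \<in> Hom C c z" "split_epi e" "\<gamma> = cone_star C \<epsilon> e"
    using cone_le_iff[OF assms(3,1)] assms(4) by blast
  have "\<gamma> c = e" using e assms cone_ObjD[OF assms(1)] by (simp add: cone_star_apply Ide_comp)
  then show g: "\<gamma> = cone_star C \<epsilon> (\<gamma> c)" "split_epi (\<gamma> c)" using e by simp_all
  show "\<epsilon> \<star> \<gamma> = \<gamma>"
    using g epi_part_split[OF g(2) cone_Hom[OF assms(3) cone_ObjD[OF assms(1)]]] mult_eq[OF assms(1)] by simp
qed

text \<open>If \<open>\<epsilon>\<close> is idempotent, comparing vertices shows that the image of
  \<open>\<epsilon> c\<close> is \<open>c\<close>, so the inclusion part is an identity; cancelling
  an invertible component \<open>\<epsilon> a\<close> shows that the epimorphic part is one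
  too.\<close>

lemma idempotent_iff:
  assumes "cone_at C c \<epsilon>"
  shows "\<epsilon> \<star> \<epsilon> = \<epsilon> \<longleftrightarrow> \<epsilon> c = Ide C c"
proof
  assume id: "\<epsilon> \<star> \<epsilon> = \<epsilon>"
  obtain v j where e: "epi_part C (\<epsilon> c) \<in> Hom C c v" "j \<in> Inc v c" "\<epsilon> c = epi_part C (\<epsilon> c) \<cdot> j"
    "cone_at C v (\<epsilon> \<star> \<epsilon>)" using multE[OF assms assms] .
  have v: "v = c" using e id cone_unique[OF assms] by simp
  obtain a w where a: "a \<in> Obj C" "w \<in> Hom C c a" "\<epsilon> a \<cdot> w = Ide C a" "w \<cdot> \<epsilon> a = Ide C c"
    using cone_isoE[OF assms] .
  note ea = cone_Hom[OF assms a(1)]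
  have "\<epsilon> a \<cdot> epi_part C (\<epsilon> c) = \<epsilon> a \<cdot> Ide C c"
    using fun_cong[OF id, of a] a(1) by (simp add: mult_eq[OF assms] cone_star_apply comp_Ide[OF ea])
  then have "epi_part C (\<epsilon> c) = Ide C c"
    using split_epi_cancel[OF split_epiI[OF ea a(2,4)] ea e(1) Ide_Hom[OF cone_ObjD[OF assms]]] by blast
  moreover have "j = Ide C c" using Inc_unique e(2) Inc_Ide[OF cone_ObjD[OF assms]] v by blast
  ultimately show "\<epsilon> c = Ide C c" using e(3) Ide_comp[OF Ide_Hom[OF cone_ObjD[OF assms]]] by simp
next
  assume "\<epsilon> c = Ide C c"
  then show "\<epsilon> \<star> \<epsilon> = \<epsilon>" using mult_Ide[OF assms assms] by simp
qed

text \<open>Compose \<open>\<gamma>\<close> with the inverse of an invertible component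
  \<open>\<gamma> c\<close>: the new component at \<open>c\<close> is an identity, and
  \<open>\<gamma> c\<close> leads back. So every class contains an idempotent.\<close>

lemma idempotent_below_aboveE:
  assumes "cone_at C z \<gamma>"
  obtains c \<epsilon> where "cone_at C c \<epsilon>" "\<epsilon> c = Ide C c" "\<gamma> \<sqsubseteq> \<epsilon>" "\<epsilon> \<sqsubseteq> \<gamma>"
proof -
  obtain c v where c: "c \<in> Obj C" "v \<in> Hom C z c" "\<gamma> c \<cdot> v = Ide C c" "v \<cdot> \<gamma> c = Ide C z"
    using cone_isoE[OF assms] .
  note gc = cone_Hom[OF assms c(1)]
  have v: "split_epi v" using split_epiI[OF c(2) gc c(3)] .
  have g: "split_epi (\<gamma> c)" using split_epiI[OF gc c(2,4)] .
  let ?e = "cone_star C \<gamma> v"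
  have e: "cone_at C c ?e" using cone_star_cone[OF assms v c(2)] .
  have "\<gamma> = cone_star C ?e (\<gamma> c)"
    using cone_star_comp[OF assms c(2) gc] cone_star_Ide[OF assms] c(4) by simp
  then have "\<gamma> \<sqsubseteq> ?e" using cone_le_iff[OF assms e] gc g by blast
  moreover have "?e \<sqsubseteq> \<gamma>" using cone_le_iff[OF e assms] c v by blast
  ultimately show ?thesis using that[OF e] c by (simp add: cone_star_apply)
qed

section \<open>Classes of Green's relation\<close>

abbreviation cone_class :: "('o \<Rightarrow> 'm) \<Rightarrow> ('o \<Rightarrow> 'm) set" where
  "cone_class \<gamma> \<equiv> green_R (cones C) `` {\<gamma>}"

abbreviation cone_classes :: "('o \<Rightarrow> 'm) set set" where
  "cone_classes \<equiv> carrier (cones C) // green_R (cones C)"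

lemma equiv_R: "equiv (carrier (cones C)) (green_R (cones C))"
  by (intro equivI) (auto simp: green_R_def refl_on_def sym_def trans_def)

lemma cone_class_iff:
  "\<gamma> \<in> carrier (cones C) \<Longrightarrow> \<delta> \<in> cone_class \<gamma> \<longleftrightarrow> \<delta> \<in> carrier (cones C) \<and> \<delta> \<sqsubseteq> \<gamma> \<and> \<gamma> \<sqsubseteq> \<delta>"
  by (auto simp: green_R_def)

lemma in_cone_classes:
  assumes "d \<in> cone_classes" "\<gamma> \<in> d"
  shows "\<gamma> \<in> carrier (cones C)" "d = cone_class \<gamma>"
proof -
  show "\<gamma> \<in> carrier (cones C)" using assms in_quotient_imp_subset[OF equiv_R] by blast
  obtain \<delta> where "d = cone_class \<delta>" using assms(1) by (rule quotientE)
  then show "d = cone_class \<gamma>" using assms(2) equiv_class_eq[OF equiv_R] by blast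
qed

lemma cone_classes_nonempty: "d \<in> cone_classes \<Longrightarrow> \<exists>\<gamma>. \<gamma> \<in> d"
  using in_quotient_imp_non_empty[OF equiv_R] by blast

lemma cone_class_in: "\<gamma> \<in> carrier (cones C) \<Longrightarrow> cone_class \<gamma> \<in> cone_classes"
  by (rule quotientI)

lemma self_in_cone_class: "\<gamma> \<in> carrier (cones C) \<Longrightarrow> \<gamma> \<in> cone_class \<gamma>"
  by (simp add: green_R_def)

text \<open>Members of one class generate the same right ideal, so the representatives are
  immaterial.\<close>

lemma R_le_iff:
  assumes "d \<in> cone_classes" "d' \<in> cone_classes" "\<gamma> \<in> d" "\<delta> \<in> d'"
  shows "R_le (cones C) d d' \<longleftrightarrow> \<gamma> \<sqsubseteq> \<delta>"
proof -
  note c = in_cone_classes[OF assms(1,3)] in_cone_classes[OF assms(2,4)]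
  show ?thesis
    unfolding R_le_def
  proof
    assume "\<exists>a\<in>d. \<exists>b\<in>d'. a \<sqsubseteq> b"
    then obtain a b where "a \<in> cone_class \<gamma>" "b \<in> cone_class \<delta>" "a \<sqsubseteq> b" using c by blast
    then show "\<gamma> \<sqsubseteq> \<delta>" using c cone_class_iff by blast
  qed (use assms in blast)
qed

lemma idempotent_cone_iff:
  assumes "d \<in> cone_classes"
  shows "idempotent_cone C c d \<epsilon> \<longleftrightarrow> \<epsilon> \<in> d \<and> cone_at C c \<epsilon> \<and> \<epsilon> c = Ide C c"
  using in_cone_classes(1)[OF assms] idempotent_iff vertex_eq
  unfolding idempotent_cone_def in_cones_iff by metis

lemma idempotent_cone_unique:
  assumes "d \<in> cone_classes" "idempotent_cone C c d \<epsilon>" "idempotent_cone C c d \<epsilon>'"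
  shows "\<epsilon> = \<epsilon>'"
proof -
  have e: "\<epsilon> \<in> d" "cone_at C c \<epsilon>" "\<epsilon> c = Ide C c" "\<epsilon>' \<in> d" "cone_at C c \<epsilon>'" "\<epsilon>' c = Ide C c"
    using assms idempotent_cone_iff by auto
  have "\<epsilon>' \<in> cone_class \<epsilon>" using in_cone_classes(2)[OF assms(1) e(1)] e(4) by simp
  then have "\<epsilon>' \<sqsubseteq> \<epsilon>" using cone_class_iff in_conesI[OF e(2)] by blast
  then show ?thesis using cone_le_idempotent(1)[OF e(2,3,5)] e(6) cone_star_Ide[OF e(2)] by simp
qed

lemma eps_eq: "d \<in> cone_classes \<Longrightarrow> idempotent_cone C c d \<epsilon> \<Longrightarrow> eps C c d = \<epsilon>"
  unfolding eps_def by (rule the_equality) (auto intro: idempotent_cone_unique)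

end

section \<open>The semigroup of a connected category\<close>

context normal_cat
begin

definition incl :: "'o \<Rightarrow> 'o \<Rightarrow> 'm" where
  "incl a b = (THE j. j \<in> Inc a b)"

lemma incl_eq: "j \<in> Inc a b \<Longrightarrow> incl a b = j"
  unfolding incl_def by (rule the_equality) (auto intro: Inc_unique)

text \<open>The vertex of a product is the image of \<open>\<delta> z\<close>, a subobject of
  \<open>w\<close>. Equations between products thus yield comparisons of vertices, by which a
  homomorphism will be seen to respect vertices.\<close>

lemma mult_vertex_Inc:
  assumes "cone_at C z \<gamma>" "cone_at C w \<delta>" "cone_at C y (\<gamma> \<star> \<delta>)"
  shows "incl y w \<in> Inc y w"
proof -
  obtain v j where "j \<in> Inc v w" "cone_at C v (\<gamma> \<star> \<delta>)" using multE[OF assms(1,2)] .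
  then show ?thesis using cone_unique[OF assms(3)] incl_eq by metis
qed

end

definition down_set_semigrp :: "('o, 'm) ccat \<Rightarrow> ('o \<Rightarrow> 'm) semigrp" where
  "down_set_semigrp = (\<lambda>(C, D). \<lparr>carrier = \<Union>D, mult = mult (cones C)\<rparr>)"

lemma down_set_semigrp_simps [simp]:
  "carrier (down_set_semigrp (C, D)) = \<Union>D"
  "mult (down_set_semigrp (C, D)) = mult (cones C)"
  by (simp_all add: down_set_semigrp_def)

locale conn_cat = normal_cat C for C :: "('o, 'm) scat" (structure) and D :: "('o \<Rightarrow> 'm) set set" +
  assumes connected: "connected_category (C, D)"
begin

lemma down_set: "R_down_set C D"
  using connected by (simp add: connected_category_def)

lemma D_classes: "d \<in> D \<Longrightarrow> d \<in> cone_classes"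
  using down_set by (auto simp: R_down_set_def)

lemma D_in: "d \<in> D \<Longrightarrow> \<gamma> \<in> d \<Longrightarrow> d = cone_class \<gamma>"
  using in_cone_classes D_classes by blast

lemma T_in_cones: "\<gamma> \<in> \<Union>D \<Longrightarrow> \<gamma> \<in> carrier (cones C)"
  using in_cone_classes D_classes by blast

lemma T_coneE:
  assumes "\<gamma> \<in> \<Union>D"
  obtains z where "cone_at C z \<gamma>"
  using T_in_cones[OF assms] in_cones_iff by blast

lemma cone_class_D: "\<gamma> \<in> \<Union>D \<Longrightarrow> cone_class \<gamma> \<in> D"
  using D_in by fastforce

lemma T_down:
  assumes "\<gamma> \<in> \<Union>D" "\<delta> \<in> carrier (cones C)" "\<delta> \<sqsubseteq> \<gamma>"
  shows "\<delta> \<in> \<Union>D"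
proof -
  have "R_le (cones C) (cone_class \<delta>) (cone_class \<gamma>)"
    using R_le_iff cone_class_in self_in_cone_class assms T_in_cones by blast
  then have "cone_class \<delta> \<in> D"
    using down_set cone_class_D[OF assms(1)] cone_class_in[OF assms(2)] unfolding R_down_set_def by blast
  then show ?thesis using self_in_cone_class[OF assms(2)] by blast
qed

text \<open>A product lies below its left factor, so the right factor may be any cone.\<close>

lemma T_mult: "\<gamma> \<in> \<Union>D \<Longrightarrow> \<delta> \<in> carrier (cones C) \<Longrightarrow> \<gamma> \<star> \<delta> \<in> \<Union>D"
  using T_down[OF _ mult_in_cones cone_le_mult] T_in_cones by blast

lemma ex_idempotent:
  assumes "c \<in> Obj C"
  shows "\<exists>\<epsilon>. \<epsilon> \<in> \<Union>D \<and> cone_at C c \<epsilon> \<and> \<epsilon> c = Ide C c"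
proof -
  obtain d \<epsilon> where "d \<in> D" "idempotent_cone C c d \<epsilon>"
    using connected assms by (auto simp: connected_category_def connected_to_def)
  then show ?thesis using idempotent_cone_iff[OF D_classes] by blast
qed

text \<open>A vertex may be connected to several members of \<open>D\<close>; one idempotent is
  fixed for each vertex.\<close>

definition idem :: "'o \<Rightarrow> 'o \<Rightarrow> 'm" where
  "idem c = (SOME \<epsilon>. \<epsilon> \<in> \<Union>D \<and> cone_at C c \<epsilon> \<and> \<epsilon> c = Ide C c)"

lemma idem:
  assumes "c \<in> Obj C"
  shows "idem c \<in> \<Union>D" "cone_at C c (idem c)" "idem c c = Ide C c"
  using someI_ex[OF ex_idempotent[OF assms]] unfolding idem_def by auto

text \<open>Composition keeps the cone below \<open>idem c\<close>, so every split epimorphism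
  occurs as a component of a cone in \<open>\<Union>D\<close>.\<close>

lemma idem_star:
  assumes "split_epi e" "e \<in> Hom C c w"
  shows "cone_at C w (cone_star C (idem c) e)" "cone_star C (idem c) e \<in> \<Union>D"
    "cone_star C (idem c) e c = e"
proof -
  have c: "c \<in> Obj C" using Hom_Obj assms by blast
  show "cone_at C w (cone_star C (idem c) e)" by (rule cone_star_cone[OF idem(2)[OF c] assms])
  then have "cone_star C (idem c) e \<sqsubseteq> idem c" using cone_le_iff[OF _ idem(2)[OF c]] assms by blast
  then show "cone_star C (idem c) e \<in> \<Union>D"
    using T_down[OF idem(1)[OF c] in_conesI[OF \<open>cone_at C w _\<close>]] by blast
  show "cone_star C (idem c) e c = e" using idem(3)[OF c] c Ide_comp[OF assms(2)] by (simp add: cone_star_apply)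
qed

text \<open>The order allows multipliers from all cones, but a homomorphism acts on
  \<open>\<Union>D\<close> alone. The multiplier can be taken to be \<open>idem w\<close> followed
  by \<open>e\<close>, which lies in \<open>\<Union>D\<close>.\<close>

lemma T_le_multE:
  assumes "\<gamma> \<in> \<Union>D" "\<delta> \<in> \<Union>D" "\<gamma> \<sqsubseteq> \<delta>"
  obtains x where "x \<in> \<Union>D" "\<gamma> = \<delta> \<star> x"
proof -
  obtain z w where \<gamma>: "cone_at C z \<gamma>" and \<delta>: "cone_at C w \<delta>" using assms T_coneE by metis
  obtain e where e: "e \<in> Hom C w z" "split_epi e" "\<gamma> = cone_star C \<delta> e"
    using cone_le_iff[OF \<gamma> \<delta>] assms(3) by blast
  have w: "w \<in> Obj C" using cone_ObjD[OF \<delta>] .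
  show ?thesis
    using that[OF idem_star(2)[OF e(2,1)]] cone_star_eq_mult[OF \<delta> e(2,1) idem(2,3)[OF w]] e(3) by simp
qed

text \<open>The witness is \<open>idem z\<close> followed by the inverse of an invertible component
  of \<open>\<gamma>\<close>. It yields regularity, and it shows that \<open>\<gamma>\<close> and
  \<open>idem z\<close> generate the same left ideal, so cones in \<open>\<Union>D\<close> with
  equal vertices are related by Green's \<open>\<L>\<close>.\<close>

lemma idem_leftE:
  assumes "\<gamma> \<in> \<Union>D" "cone_at C z \<gamma>"
  obtains x where "x \<in> \<Union>D" "x \<star> \<gamma> = idem z" "\<gamma> \<star> (x \<star> \<gamma>) = \<gamma>"
proof -
  have z: "z \<in> Obj C" using cone_ObjD[OF assms(2)] .
  obtain c v where c: "c \<in> Obj C" "v \<in> Hom C z c" "\<gamma> c \<cdot> v = Ide C c" "v \<cdot> \<gamma> c = Ide C z"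
    using cone_isoE[OF assms(2)] .
  note gc = cone_Hom[OF assms(2) c(1)]
  have v: "split_epi v" using split_epiI[OF c(2) gc c(3)] .
  have g: "epi_part C (\<gamma> c) = \<gamma> c" using epi_part_split[OF split_epiI[OF gc c(2,4)] gc] .
  let ?x = "cone_star C (idem z) v"
  note x = idem_star[OF v c(2)]
  have "?x \<star> \<gamma> = idem z"
    using mult_eq[OF x(1)] g cone_star_comp[OF idem(2)[OF z] c(2) gc] c(4) cone_star_Ide[OF idem(2)[OF z]]
    by simp
  moreover have "\<gamma> \<star> idem z = \<gamma>" using mult_Ide[OF assms(2) idem(2,3)[OF z]] .
  ultimately show ?thesis using that[OF x(2)] by simp
qed

lemma T_semigrp: "semigrp (down_set_semigrp (C, D))"
  using T_mult T_in_cones mult_assoc by (auto simp: semigrp_def)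

lemma T_regular: "regular (down_set_semigrp (C, D))"
  unfolding regular_def
proof
  fix \<gamma> assume "\<gamma> \<in> carrier (down_set_semigrp (C, D))"
  then have \<gamma>: "\<gamma> \<in> \<Union>D" by simp
  then obtain z where z: "cone_at C z \<gamma>" by (rule T_coneE)
  obtain x where x: "x \<in> \<Union>D" "\<gamma> \<star> (x \<star> \<gamma>) = \<gamma>" using idem_leftE[OF \<gamma> z] .
  then have "(\<gamma> \<star> x) \<star> \<gamma> = \<gamma>" using mult_assoc[OF T_in_cones T_in_cones T_in_cones] \<gamma> by simp
  then show "\<exists>x\<in>carrier (down_set_semigrp (C, D)).
      (\<gamma> \<otimes>\<^bsub>down_set_semigrp (C, D)\<^esub> x) \<otimes>\<^bsub>down_set_semigrp (C, D)\<^esub> \<gamma> = \<gamma>"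
    using x(1) by auto
qed

lemma idem_mult_apply:
  assumes "c \<in> Obj C" "\<gamma> \<in> \<Union>D"
  shows "(idem c \<star> \<gamma>) c = epi_part C (\<gamma> c)"
proof -
  obtain z where z: "cone_at C z \<gamma>" using assms(2) by (rule T_coneE)
  obtain w j where "epi_part C (\<gamma> c) \<in> Hom C c w" using epi_partE[OF cone_Hom[OF z assms(1)]] .
  then show ?thesis
    using assms(1) idem[OF assms(1)] by (simp add: mult_eq cone_star_apply Ide_comp)
qed

text \<open>Left multiplication by \<open>idem c\<close> reveals the epimorphic part of
  \<open>\<gamma> c\<close>. Where \<open>\<gamma> c\<close> is invertible, this part has codomain
  \<open>z\<close>, so \<open>z\<close> is a subobject of \<open>w\<close>, and conversely; once the
  vertices are equal, the inclusion parts agree as well.\<close>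

lemma T_left_reductive: "left_reductive (down_set_semigrp (C, D))"
  unfolding left_reductive_def
proof (rule inj_onI, unfold down_set_semigrp_simps)
  fix \<gamma> \<delta> assume g: "\<gamma> \<in> \<Union>D" "\<delta> \<in> \<Union>D" and eq: "(\<lambda>x\<in>\<Union>D. x \<star> \<gamma>) = (\<lambda>x\<in>\<Union>D. x \<star> \<delta>)"
  have ep: "epi_part C (\<gamma> c) = epi_part C (\<delta> c)" if c: "c \<in> Obj C" for c
    using fun_cong[OF eq, of "idem c"] idem(1)[OF c] idem_mult_apply[OF c g(1)] idem_mult_apply[OF c g(2)]
    by simp
  have sub: "\<exists>j. j \<in> Inc z w" if \<gamma>: "cone_at C z \<gamma>" and \<delta>: "cone_at C w \<delta>"
    and ep: "\<And>c. c \<in> Obj C \<Longrightarrow> epi_part C (\<gamma> c) = epi_part C (\<delta> c)" for z w \<gamma> \<delta>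
  proof -
    obtain c v where c: "c \<in> Obj C" "v \<in> Hom C z c" "v \<cdot> \<gamma> c = Ide C z" using cone_isoE[OF \<gamma>] .
    note gc = cone_Hom[OF \<gamma> c(1)]
    obtain y j where y: "epi_part C (\<delta> c) \<in> Hom C c y" "j \<in> Inc y w"
      using epi_partE[OF cone_Hom[OF \<delta> c(1)]] .
    have "epi_part C (\<delta> c) = \<gamma> c" using ep[OF c(1)] epi_part_split[OF split_epiI[OF gc c(2,3)] gc] by simp
    then have "y = z" using y(1) gc by (simp add: Hom_def)
    then show ?thesis using y by blast
  qed
  obtain z w where \<gamma>: "cone_at C z \<gamma>" and \<delta>: "cone_at C w \<delta>" using g T_coneE by metis
  obtain j k where "j \<in> Inc z w" "k \<in> Inc w z" using sub[OF \<gamma> \<delta> ep] sub[OF \<delta> \<gamma> ep[symmetric]] by blast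
  then have zw: "z = w" by (rule Inc_antisym)
  show "\<gamma> = \<delta>"
  proof (rule cone_eqI[OF \<gamma> \<delta>])
    fix c assume c: "c \<in> Obj C"
    obtain u j where u: "epi_part C (\<gamma> c) \<in> Hom C c u" "j \<in> Inc u z" "\<gamma> c = epi_part C (\<gamma> c) \<cdot> j"
      using epi_partE[OF cone_Hom[OF \<gamma> c]] .
    obtain u' j' where u': "epi_part C (\<delta> c) \<in> Hom C c u'" "j' \<in> Inc u' w" "\<delta> c = epi_part C (\<delta> c) \<cdot> j'"
      using epi_partE[OF cone_Hom[OF \<delta> c]] .
    have "u' = u" using u u' ep[OF c] by (simp add: Hom_def)
    then have "j' = j" using u u' zw Inc_unique by blast
    then show "\<gamma> c = \<delta> c" using u(3) u'(3) ep[OF c] by simp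
  qed
qed

text \<open>
  Together with the inclusions \<open>im f \<rightarrow> b\<close>, this identifies \<open>Hom C a b\<close> with \<open>idem a T idem b\<close>, where \<open>T\<close>
  is the semigroup \<open>\<Union>D\<close>; composition becomes multiplication.
\<close>

definition arrow_cone :: "'m \<Rightarrow> 'o \<Rightarrow> 'm" where
  "arrow_cone f = cone_star C (idem (Dom C f)) (epi_part C f)"

lemma arrow_coneE:
  assumes "f \<in> Hom C a b"
  obtains w j where "epi_part C f \<in> Hom C a w" "split_epi (epi_part C f)" "j \<in> Inc w b"
    "f = epi_part C f \<cdot> j" "cone_at C w (arrow_cone f)" "arrow_cone f \<in> \<Union>D" 
    "arrow_cone f a = epi_part C f" "arrow_cone f \<star> idem b = arrow_cone f"
    "arrow_cone f \<sqsubseteq> idem a"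
proof -
  have ab: "a \<in> Obj C" "b \<in> Obj C" using Hom_Obj[OF assms] .
  obtain w j where e: "epi_part C f \<in> Hom C a w" "split_epi (epi_part C f)" "j \<in> Inc w b"
    "f = epi_part C f \<cdot> j" using epi_partE[OF assms] .
  have f: "arrow_cone f = cone_star C (idem a) (epi_part C f)"
    using assms by (simp add: arrow_cone_def Hom_def)
  note s = idem_star[OF e(2,1), folded f]
  have "arrow_cone f \<star> idem b = arrow_cone f" using mult_Inc[OF s(1) idem(2,3)[OF ab(2)] e(3)] .
  moreover have "arrow_cone f \<sqsubseteq> idem a"
    using cone_le_iff[OF s(1) idem(2)[OF ab(1)]] e(1,2) f by blast
  ultimately show ?thesis using that e s by blast
qed

text \<open>With \<open>f = epi_part C f \<cdot> j\<close>, the component of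
  \<open>arrow_cone g\<close> at the image of \<open>f\<close> is
  \<open>j \<cdot> epi_part C g\<close>. So the product is \<open>idem a\<close> followed by the
  epimorphic part of \<open>f \<cdot> g\<close>.\<close>

lemma arrow_cone_comp:
  assumes "f \<in> Hom C a b" "g \<in> Hom C b c"
  shows "arrow_cone f \<star> arrow_cone g = arrow_cone (f \<cdot> g)"
proof -
  obtain w j where f: "epi_part C f \<in> Hom C a w" "split_epi (epi_part C f)" "j \<in> Inc w b"
    "f = epi_part C f \<cdot> j" "cone_at C w (arrow_cone f)" using arrow_coneE[OF assms(1)] .
  obtain v k where g: "epi_part C g \<in> Hom C b v" "cone_at C v (arrow_cone g)"
     "arrow_cone g b = epi_part C g" using arrow_coneE[OF assms(2)] .
  have w: "w \<in> Obj C" and a: "a \<in> Obj C" using Hom_Obj f(1) by auto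
  have gw: "arrow_cone g w \<in> Hom C w v" using cone_Hom[OF g(2) w] .
  obtain u where gu: "epi_part C (arrow_cone g w) \<in> Hom C w u" using epi_partE[OF gw] .
  have "epi_part C f \<cdot> epi_part C (arrow_cone g w) = epi_part C (epi_part C f \<cdot> (j \<cdot> epi_part C g))"
    using epi_part_comp_left[OF f(2,1) gw] cone_Inc[OF g(2) f(3)] g(3) by simp
  also have "\<dots> = epi_part C (f \<cdot> g)"
    using comp_assoc[OF f(1) Inc_Hom[OF f(3)] g(1)] f(4) epi_part_comp_epi_part[OF assms] by simp
  finally show ?thesis
    using mult_eq[OF f(5)] cone_star_comp[OF idem(2)[OF a] f(1) gu] Hom_D(2)[OF comp_Hom[OF assms]]
      Hom_D(2)[OF assms(1)]
    by (simp add: arrow_cone_def)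
qed

text \<open>The epimorphic part of an inclusion is an identity, so the codomain leaves no trace in
  the cone; it has to be restored when arrows are read back.\<close>

lemma arrow_cone_Inc:
  assumes "j \<in> Inc a b"
  shows "arrow_cone j = idem a"
  using assms idem(2) cone_star_Ide Hom_Obj[OF Inc_Hom[OF assms]]
  by (simp add: arrow_cone_def epi_part_Inc Hom_D(2)[OF Inc_Hom[OF assms]])

lemma arrow_cone_component:
  assumes "\<gamma> \<in> \<Union>D" "c \<in> Obj C"
  shows "arrow_cone (\<gamma> c) = idem c \<star> \<gamma>"
proof -
  obtain z where z: "cone_at C z \<gamma>" using assms(1) by (rule T_coneE)
  show ?thesis using mult_eq[OF idem(2)[OF assms(2)]] Hom_D(2)[OF cone_Hom[OF z assms(2)]]
    by (simp add: arrow_cone_def)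
qed

end

section \<open>CC-morphisms and homomorphisms\<close>

locale conn_cat_pair = A: conn_cat C D + B: conn_cat C' D'
  for C :: "('o, 'm) scat" and D and C' :: "('p, 'n) scat" and D'
begin

definition hom_obj :: "(('o \<Rightarrow> 'm) \<Rightarrow> ('p \<Rightarrow> 'n)) \<Rightarrow> 'o \<Rightarrow> 'p" where
  "hom_obj \<phi> c = vertex C' (\<phi> (A.idem c))"

definition hom_arr :: "(('o \<Rightarrow> 'm) \<Rightarrow> ('p \<Rightarrow> 'n)) \<Rightarrow> 'm \<Rightarrow> 'n" where
  "hom_arr \<phi> f = \<phi> (A.arrow_cone f) (hom_obj \<phi> (Dom C f)) \<cdot>\<^bsub>C'\<^esub>
     B.incl (vertex C' (\<phi> (A.arrow_cone f))) (hom_obj \<phi> (Cod C f))"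

text \<open>The image of \<open>d\<close> need not fill a class, so it is saturated; no
  representative of \<open>d\<close> has to be chosen.\<close>

definition hom_class :: "(('o \<Rightarrow> 'm) \<Rightarrow> ('p \<Rightarrow> 'n)) \<Rightarrow> ('o \<Rightarrow> 'm) set \<Rightarrow> ('p \<Rightarrow> 'n) set" where
  "hom_class \<phi> d = green_R (cones C') `` (\<phi> ` d)"

definition cc_of_hom :: "(('o \<Rightarrow> 'm) \<Rightarrow> ('p \<Rightarrow> 'n)) \<Rightarrow> ('o, 'm, 'p, 'n) cc_map" where
  "cc_of_hom \<phi> = (\<lparr>on_Obj = restrict (hom_obj \<phi>) (Obj C), on_Arr = restrict (hom_arr \<phi>) (Arr C)\<rparr>,
     restrict (hom_class \<phi>) D)"

end

definition hom_of_cc ::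
  "('o, 'm) ccat \<Rightarrow> ('o, 'm, 'p, 'n) cc_map \<Rightarrow> ('o \<Rightarrow> 'm) \<Rightarrow> ('p \<Rightarrow> 'n)" where
  "hom_of_cc = (\<lambda>(C, D) (F, G). \<lambda>\<gamma>\<in>\<Union>D. (THE \<delta>. \<delta> \<in> G (green_R (cones C) `` {\<gamma>}) \<and>
     (\<forall>c\<in>Obj C. \<delta> (on_Obj F c) = on_Arr F (\<gamma> c))))"

section \<open>The homomorphism of a CC-morphism\<close>

locale cc_mor = conn_cat_pair C D C' D'
  for C :: "('o, 'm) scat" and D and C' :: "('p, 'n) scat" and D' +
  fixes F :: "('o, 'm, 'p, 'n) functor_map" and G
  assumes mor: "cc_morphism (C, D) (C', D') (F, G)"
begin

abbreviation "Fo \<equiv> on_Obj F"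
abbreviation "Fm \<equiv> on_Arr F"

lemma F_functor: "is_functor C C' F"
  using mor by (simp add: cc_morphism_def)

lemmas F_Hom = functor_Hom[OF F_functor]
lemmas F_Obj = functor_Obj[OF F_functor]
lemmas F_Ide = functor_Ide[OF F_functor]
lemmas F_comp = functor_comp[OF F_functor]

lemma F_Inc: "j \<in> A.Inc a b \<Longrightarrow> Fm j \<in> B.Inc (Fo a) (Fo b)"
  using mor F_Hom[OF A.Inc_Hom] by (auto simp: cc_morphism_def A.Inc_def B.Inc_def Hom_def)

lemma F_split_epi:
  assumes "A.split_epi e" "e \<in> Hom C a b"
  shows "B.split_epi (Fm e)"
proof -
  obtain s where s: "s \<in> Hom C b a" "s \<cdot>\<^bsub>C\<^esub> e = Ide C b" using A.split_epiE[OF assms] .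
  then show ?thesis
    using B.split_epiI[OF F_Hom[OF assms(2)] F_Hom[OF s(1)]] F_comp[OF s(1) assms(2)]
      F_Ide[OF A.Hom_Obj(2)[OF assms(2)]] by simp
qed

lemma F_epi_part:
  assumes "f \<in> Hom C a b"
  shows "Fm (epi_part C f) = epi_part C' (Fm f)"
proof -
  obtain w j where e: "epi_part C f \<in> Hom C a w" "A.split_epi (epi_part C f)" "j \<in> A.Inc w b"
    "f = epi_part C f \<cdot>\<^bsub>C\<^esub> j" using A.epi_partE[OF assms] .
  have "Fm f = Fm (epi_part C f) \<cdot>\<^bsub>C'\<^esub> Fm j" using F_comp[OF e(1) A.Inc_Hom[OF e(3)]] e(4) by simp
  then show ?thesis using B.epi_part_eqI[OF F_split_epi[OF e(2,1)] F_Hom[OF e(1)] F_Inc[OF e(3)]] by simp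
qed

lemma G_in: "d \<in> D \<Longrightarrow> G d \<in> D'"
  using mor by (auto simp: cc_morphism_def)

lemma G_class: "\<gamma> \<in> \<Union>D \<Longrightarrow> G (A.cone_class \<gamma>) \<in> D'"
  using G_in A.cone_class_D by blast

lemma G_mono:
  assumes "\<gamma> \<in> \<Union>D" "\<delta> \<in> \<Union>D" "A.cone_le \<gamma> \<delta>"
    "\<gamma>' \<in> G (A.cone_class \<gamma>)" "\<delta>' \<in> G (A.cone_class \<delta>)"
  shows "B.cone_le \<gamma>' \<delta>'"
proof -
  note c = A.cone_class_D[OF assms(1)] A.cone_class_D[OF assms(2)]
  have "R_le (cones C) (A.cone_class \<gamma>) (A.cone_class \<delta>)"
    using A.R_le_iff A.cone_class_in A.self_in_cone_class A.T_in_cones assms by blast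
  then have "R_le (cones C') (G (A.cone_class \<gamma>)) (G (A.cone_class \<delta>))"
    using mor c by (auto simp: cc_morphism_def)
  then show ?thesis using B.R_le_iff B.D_classes[OF G_in] c assms by blast
qed

lemma G_eps:
  assumes "d \<in> D" "\<epsilon> \<in> d" "cone_at C c \<epsilon>" "\<epsilon> c = Ide C c"
  obtains \<epsilon>' where "\<epsilon>' \<in> G d" "cone_at C' (Fo c) \<epsilon>'" "\<epsilon>' (Fo c) = Ide C' (Fo c)"
    "\<And>a. a \<in> Obj C \<Longrightarrow> \<epsilon>' (Fo a) = Fm (\<epsilon> a)"
proof -
  note d = A.D_classes[OF assms(1)] and d' = B.D_classes[OF G_in[OF assms(1)]]
  have \<epsilon>: "idempotent_cone C c d \<epsilon>" using A.idempotent_cone_iff[OF d] assms by blast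
  then have c: "connected_to C c d" "eps C c d = \<epsilon>" using A.eps_eq[OF d] by (auto simp: connected_to_def)
  then have *: "connected_to C' (Fo c) (G d)"
    "\<And>a. a \<in> Obj C \<Longrightarrow> Fm (\<epsilon> a) = eps C' (Fo c) (G d) (Fo a)"
    using mor A.cone_ObjD[OF assms(3)] assms(1) by (auto simp: cc_morphism_def)
  then obtain \<epsilon>' where \<epsilon>': "idempotent_cone C' (Fo c) (G d) \<epsilon>'" by (auto simp: connected_to_def)
  then show ?thesis using that B.idempotent_cone_iff[OF d'] *(2) B.eps_eq[OF d' \<epsilon>'] by metis
qed

text \<open>The arrow \<open>v\<close> leads from \<open>\<gamma>\<close> back to the idempotent
  \<open>\<epsilon>\<close> of its class. It is recorded because it shows later that the image cone
  lies in the class of \<open>\<epsilon>'\<close> and not merely below it.\<close>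

lemma idempotentE:
  assumes "\<gamma> \<in> \<Union>D" "cone_at C z \<gamma>"
  obtains c \<epsilon> \<epsilon>' v where "\<gamma> = cone_star C \<epsilon> (\<gamma> c)" "A.split_epi (\<gamma> c)" "cone_at C c \<epsilon>"
    "\<epsilon>' \<in> G (A.cone_class \<gamma>)" "cone_at C' (Fo c) \<epsilon>'" "\<epsilon>' (Fo c) = Ide C' (Fo c)"
    "\<And>a. a \<in> Obj C \<Longrightarrow> \<epsilon>' (Fo a) = Fm (\<epsilon> a)"
    "v \<in> Hom C z c" "A.split_epi v" "\<gamma> c \<cdot>\<^bsub>C\<^esub> v = Ide C c"
proof -
  obtain c \<epsilon> where \<epsilon>: "cone_at C c \<epsilon>" "\<epsilon> c = Ide C c" "A.cone_le \<gamma> \<epsilon>" "A.cone_le \<epsilon> \<gamma>"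
    using A.idempotent_below_aboveE[OF assms(2)] .
  have "\<epsilon> \<in> A.cone_class \<gamma>" using A.cone_class_iff[OF A.in_conesI[OF assms(2)]] \<epsilon> A.in_conesI by blast
  from G_eps[OF A.cone_class_D[OF assms(1)] this \<epsilon>(1,2)] obtain \<epsilon>' where
    "\<epsilon>' \<in> G (A.cone_class \<gamma>)" "cone_at C' (Fo c) \<epsilon>'" "\<epsilon>' (Fo c) = Ide C' (Fo c)"
    "\<And>a. a \<in> Obj C \<Longrightarrow> \<epsilon>' (Fo a) = Fm (\<epsilon> a)" by blast
  moreover obtain v where v: "v \<in> Hom C z c" "A.split_epi v" "\<epsilon> = cone_star C \<gamma> v"
    using A.cone_le_iff[OF \<epsilon>(1) assms(2)] \<epsilon>(4) by blast
  moreover have "\<gamma> c \<cdot>\<^bsub>C\<^esub> v = Ide C c"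
    using \<epsilon>(2) v(3) A.cone_star_apply[OF A.cone_ObjD[OF \<epsilon>(1)]] by metis
  ultimately show ?thesis using that A.cone_le_idempotent[OF \<epsilon>(1,2) assms(2) \<epsilon>(3)] \<epsilon>(1) by blast
qed

text \<open>All cones in the class are below \<open>\<epsilon>'\<close>, whose vertex
  \<open>Fo c\<close> belongs to the image of \<open>F\<close>; so the component at
  \<open>Fo c\<close>, where both cones agree, determines them.\<close>

lemma image_unique:
  assumes "\<gamma> \<in> \<Union>D" "\<delta> \<in> G (A.cone_class \<gamma>)" "\<delta>' \<in> G (A.cone_class \<gamma>)"
    "\<And>c. c \<in> Obj C \<Longrightarrow> \<delta> (Fo c) = \<delta>' (Fo c)"
  shows "\<delta> = \<delta>'"
proof -
  obtain z where z: "cone_at C z \<gamma>" using A.T_coneE[OF assms(1)] .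
  obtain c \<epsilon> \<epsilon>' where e: "cone_at C c \<epsilon>" "\<epsilon>' \<in> G (A.cone_class \<gamma>)" "cone_at C' (Fo c) \<epsilon>'"
    "\<epsilon>' (Fo c) = Ide C' (Fo c)" using idempotentE[OF assms(1) z] by metis
  have c: "c \<in> Obj C" using A.cone_ObjD[OF e(1)] .
  have "\<eta> = cone_star C' \<epsilon>' (\<eta> (Fo c))" if \<eta>: "\<eta> \<in> G (A.cone_class \<gamma>)" for \<eta>
  proof -
    obtain y where y: "cone_at C' y \<eta>" using B.T_coneE G_class[OF assms(1)] \<eta> by blast
    have "B.cone_le \<eta> \<epsilon>'" using G_mono[OF assms(1,1) _ \<eta> e(2)] by blast
    then show ?thesis using B.cone_le_idempotent(1)[OF e(3,4) y] by blast
  qed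
  from this[OF assms(2)] this[OF assms(3)] show ?thesis using assms(4)[OF c] by simp
qed

text \<open>The cone \<open>\<gamma>\<close> is \<open>\<epsilon>\<close> followed by
  \<open>\<gamma> c\<close>; the witness is \<open>\<epsilon>'\<close> followed by the image of
  \<open>\<gamma> c\<close> under \<open>F\<close>.\<close>

lemma image_exists:
  assumes "\<gamma> \<in> \<Union>D" "cone_at C z \<gamma>"
  shows "\<exists>\<delta>. \<delta> \<in> G (A.cone_class \<gamma>) \<and> cone_at C' (Fo z) \<delta> \<and> (\<forall>c\<in>Obj C. \<delta> (Fo c) = Fm (\<gamma> c))"
proof -
  obtain c \<epsilon> \<epsilon>' v where e: "\<gamma> = cone_star C \<epsilon> (\<gamma> c)" "A.split_epi (\<gamma> c)" "cone_at C c \<epsilon>"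
    "\<epsilon>' \<in> G (A.cone_class \<gamma>)" "cone_at C' (Fo c) \<epsilon>'" "\<epsilon>' (Fo c) = Ide C' (Fo c)"
    and e': "\<And>a. a \<in> Obj C \<Longrightarrow> \<epsilon>' (Fo a) = Fm (\<epsilon> a)"
    and v: "v \<in> Hom C z c" "A.split_epi v" "\<gamma> c \<cdot>\<^bsub>C\<^esub> v = Ide C c"
    by (rule idempotentE[OF assms]) (rule that)
  have c: "c \<in> Obj C" using A.cone_ObjD[OF e(3)] .
  note g = A.cone_Hom[OF assms(2) c]
  let ?d = "cone_star C' \<epsilon>' (Fm (\<gamma> c))"
  have d: "cone_at C' (Fo z) ?d"
    using B.cone_star_cone[OF e(5) F_split_epi[OF e(2) g] F_Hom[OF g]] .
  have "?d (Fo a) = Fm (\<gamma> a)" if a: "a \<in> Obj C" for a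
  proof -
    have "Fm (\<gamma> a) = Fm (\<epsilon> a \<cdot>\<^bsub>C\<^esub> \<gamma> c)"
      using arg_cong[OF e(1), of "\<lambda>x. x a"] A.cone_star_apply[OF a] by simp
    then show ?thesis
      using F_comp[OF A.cone_Hom[OF e(3) a] g] e'[OF a] B.cone_star_apply[OF F_Obj[OF a]] by simp
  qed
  moreover have "?d \<in> G (A.cone_class \<gamma>)"
  proof -
    have "B.cone_le ?d \<epsilon>'" using B.cone_le_iff[OF d e(5)] F_split_epi[OF e(2) g] F_Hom[OF g] by blast
    \<comment> \<open>\<open>Fm v\<close> undoes \<open>Fm (\<gamma> c)\<close>, so the cone leads
      back to \<open>\<epsilon>'\<close>.\<close>
    moreover have "cone_star C' ?d (Fm v) = \<epsilon>'"
      using B.cone_star_comp[OF e(5) F_Hom[OF g] F_Hom[OF v(1)]] F_comp[OF g v(1)] v(3) F_Ide[OF c]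
        B.cone_star_Ide[OF e(5)] by simp
    then have "B.cone_le \<epsilon>' ?d"
      using B.cone_le_iff[OF e(5) d] F_split_epi[OF v(2,1)] F_Hom[OF v(1)] by metis
    ultimately have "?d \<in> B.cone_class \<epsilon>'" using B.cone_class_iff B.in_conesI d e(5) by blast
    then show ?thesis using B.D_in[OF G_class[OF assms(1)] e(4)] by simp
  qed
  ultimately show ?thesis using d by blast
qed

definition \<phi> :: "('o \<Rightarrow> 'm) \<Rightarrow> ('p \<Rightarrow> 'n)" where
  "\<phi> = hom_of_cc (C, D) (F, G)"

lemma \<phi>_eqI:
  assumes "\<gamma> \<in> \<Union>D" "\<delta> \<in> G (A.cone_class \<gamma>)" "\<And>c. c \<in> Obj C \<Longrightarrow> \<delta> (Fo c) = Fm (\<gamma> c)"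
  shows "\<phi> \<gamma> = \<delta>"
proof -
  have "(THE \<delta>. \<delta> \<in> G (A.cone_class \<gamma>) \<and> (\<forall>c\<in>Obj C. \<delta> (Fo c) = Fm (\<gamma> c))) = \<delta>"
    by (rule the_equality) (use assms image_unique[OF assms(1)] in auto)
  then show ?thesis using assms(1) by (simp add: \<phi>_def hom_of_cc_def)
qed

lemma \<phi>:
  assumes "\<gamma> \<in> \<Union>D" "cone_at C z \<gamma>"
  shows "\<phi> \<gamma> \<in> G (A.cone_class \<gamma>)" "cone_at C' (Fo z) (\<phi> \<gamma>)" "c \<in> Obj C \<Longrightarrow> \<phi> \<gamma> (Fo c) = Fm (\<gamma> c)"
proof -
  obtain \<delta> where \<delta>: "\<delta> \<in> G (A.cone_class \<gamma>)" "cone_at C' (Fo z) \<delta>" "\<forall>c\<in>Obj C. \<delta> (Fo c) = Fm (\<gamma> c)"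
    using image_exists[OF assms] by blast
  moreover have "\<phi> \<gamma> = \<delta>" using \<phi>_eqI[OF assms(1) \<delta>(1)] \<delta>(3) by blast
  ultimately show "\<phi> \<gamma> \<in> G (A.cone_class \<gamma>)" "cone_at C' (Fo z) (\<phi> \<gamma>)"
    "c \<in> Obj C \<Longrightarrow> \<phi> \<gamma> (Fo c) = Fm (\<gamma> c)" by auto
qed

lemma \<phi>_in:
  assumes "\<gamma> \<in> \<Union>D"
  shows "\<phi> \<gamma> \<in> \<Union>D'"
proof -
  obtain z where "cone_at C z \<gamma>" using A.T_coneE[OF assms] .
  from \<phi>(1)[OF assms this] G_class[OF assms] show ?thesis by blast
qed

text \<open>It is not clear beforehand that the right-hand side lies in the class belonging to the
  product. But \<open>G\<close> is monotone, so the left-hand side is \<open>\<phi> \<gamma>\<close>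
  followed by some \<open>g\<close>; cancelling the image of an invertible component of
  \<open>\<gamma>\<close> gives \<open>g = Fm (epi_part C (\<delta> z))\<close>.\<close>

lemma \<phi>_mult:
  assumes "\<gamma> \<in> \<Union>D" "\<delta> \<in> \<Union>D"
  shows "\<phi> (\<gamma> \<otimes>\<^bsub>cones C\<^esub> \<delta>) = \<phi> \<gamma> \<otimes>\<^bsub>cones C'\<^esub> \<phi> \<delta>"
proof -
  obtain z w where \<gamma>: "cone_at C z \<gamma>" and \<delta>: "cone_at C w \<delta>" using A.T_coneE assms by metis
  obtain v j where e: "epi_part C (\<delta> z) \<in> Hom C z v" "A.split_epi (epi_part C (\<delta> z))"
    "cone_at C v (\<gamma> \<otimes>\<^bsub>cones C\<^esub> \<delta>)" using A.multE[OF \<gamma> \<delta>] .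
  have z: "z \<in> Obj C" using A.cone_ObjD[OF \<gamma>] .
  have gd: "\<gamma> \<otimes>\<^bsub>cones C\<^esub> \<delta> \<in> \<Union>D" using A.T_mult A.T_in_cones assms by blast
  have le: "A.cone_le (\<gamma> \<otimes>\<^bsub>cones C\<^esub> \<delta>) \<gamma>" using A.cone_le_mult A.T_in_cones assms by blast
  note p = \<phi>[OF assms(1) \<gamma>] and pd = \<phi>[OF assms(2) \<delta>] and pgd = \<phi>[OF gd e(3)]
  have "B.cone_le (\<phi> (\<gamma> \<otimes>\<^bsub>cones C\<^esub> \<delta>)) (\<phi> \<gamma>)" using G_mono[OF gd assms(1) le pgd(1) p(1)] .
  then obtain g where g: "g \<in> Hom C' (Fo z) (Fo v)" "\<phi> (\<gamma> \<otimes>\<^bsub>cones C\<^esub> \<delta>) = cone_star C' (\<phi> \<gamma>) g"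
    using B.cone_le_iff[OF pgd(2) p(2)] by blast
  obtain c u where c: "c \<in> Obj C" "u \<in> Hom C z c" "u \<cdot>\<^bsub>C\<^esub> \<gamma> c = Ide C z" using A.cone_isoE[OF \<gamma>] .
  note gc = A.cone_Hom[OF \<gamma> c(1)]
  have "Fm (\<gamma> c) \<cdot>\<^bsub>C'\<^esub> g = \<phi> (\<gamma> \<otimes>\<^bsub>cones C\<^esub> \<delta>) (Fo c)"
    using g(2) p(3)[OF c(1)] B.cone_star_apply[OF F_Obj[OF c(1)]] by simp
  also have "\<dots> = Fm (\<gamma> c \<cdot>\<^bsub>C\<^esub> epi_part C (\<delta> z))"
    using pgd(3)[OF c(1)] A.mult_eq[OF \<gamma>] A.cone_star_apply[OF c(1)] by simp
  also have "\<dots> = Fm (\<gamma> c) \<cdot>\<^bsub>C'\<^esub> Fm (epi_part C (\<delta> z))" using F_comp[OF gc e(1)] .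
  finally have "g = Fm (epi_part C (\<delta> z))"
    using B.split_epi_cancel[OF F_split_epi[OF A.split_epiI[OF gc c(2,3)] gc] F_Hom[OF gc] g(1) F_Hom[OF e(1)]]
    by blast
  also have "\<dots> = epi_part C' (\<phi> \<delta> (Fo z))"
    using F_epi_part[OF A.cone_Hom[OF \<delta> z]] pd(3)[OF z] by simp
  finally show ?thesis using g(2) B.mult_eq[OF p(2)] by simp
qed

lemma \<phi>_extensional: "\<phi> \<in> extensional (\<Union>D)"
  by (simp add: \<phi>_def hom_of_cc_def)

lemma \<phi>_hom: "\<phi> \<in> semigrp_hom (down_set_semigrp (C, D)) (down_set_semigrp (C', D'))"
  using \<phi>_in \<phi>_mult \<phi>_extensional unfolding semigrp_hom_def PiE_def Pi_def down_set_semigrp_simps by blast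

section \<open>Recovery of a CC-morphism from its homomorphism\<close>

lemma hom_obj_\<phi>:
  assumes "c \<in> Obj C"
  shows "hom_obj \<phi> c = Fo c"
  using B.vertex_eq[OF \<phi>(2)[OF A.idem(1,2)[OF assms]]] by (simp add: hom_obj_def)

lemma hom_arr_\<phi>:
  assumes "f \<in> Hom C a b"
  shows "hom_arr \<phi> f = Fm f"
proof -
  obtain w j where e: "epi_part C f \<in> Hom C a w" "j \<in> A.Inc w b"
    "f = epi_part C f \<cdot>\<^bsub>C\<^esub> j" "cone_at C w (A.arrow_cone f)" "A.arrow_cone f \<in> \<Union>D" 
    "A.arrow_cone f a = epi_part C f" using A.arrow_coneE[OF assms] .
  note ab = A.Hom_Obj[OF assms]
  note p = \<phi>[OF e(5,4)]
  have "hom_arr \<phi> f = Fm (epi_part C f) \<cdot>\<^bsub>C'\<^esub> Fm j"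
    using p(3)[OF ab(1)] e(6) B.vertex_eq[OF p(2)] hom_obj_\<phi> ab B.incl_eq[OF F_Inc[OF e(2)]]
    by (simp add: hom_arr_def Hom_D[OF assms])
  then show ?thesis using F_comp[OF e(1) A.Inc_Hom[OF e(2)]] e(3) by simp
qed

lemma hom_class_\<phi>:
  assumes "d \<in> D"
  shows "hom_class \<phi> d = G d"
proof -
  have "\<phi> \<gamma> \<in> G d" if \<gamma>: "\<gamma> \<in> d" for \<gamma>
  proof -
    have "\<gamma> \<in> \<Union>D" using \<gamma> assms by blast
    moreover from this obtain z where "cone_at C z \<gamma>" by (rule A.T_coneE)
    ultimately show ?thesis using \<phi>(1) A.D_in[OF assms \<gamma>] by simp
  qed
  then have "B.cone_class (\<phi> \<gamma>) = G d" if "\<gamma> \<in> d" for \<gamma>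
    using B.D_in[OF G_in[OF assms]] that by simp
  then show ?thesis
    using A.cone_classes_nonempty[OF A.D_classes[OF assms]] unfolding hom_class_def by fastforce
qed

lemma cc_of_hom_of_cc: "cc_of_hom (hom_of_cc (C, D) (F, G)) = (F, G)"
proof -
  have ext: "Fo \<in> extensional (Obj C)" "Fm \<in> extensional (Arr C)" "G \<in> extensional D"
    using mor by (auto simp: cc_morphism_def PiE_def)
  have "restrict (hom_obj \<phi>) (Obj C) = Fo" "restrict (hom_class \<phi>) D = G"
    using hom_obj_\<phi> hom_class_\<phi>
    by (auto intro: extensionalityI[OF restrict_extensional ext(1)] extensionalityI[OF restrict_extensional ext(3)])
  moreover have "restrict (hom_arr \<phi>) (Arr C) = Fm"
    by (rule extensionalityI[OF restrict_extensional ext(2)]) (auto intro: hom_arr_\<phi>[OF Arr_Hom])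
  ultimately show ?thesis unfolding cc_of_hom_def \<phi>_def[symmetric] by simp
qed

end

text \<open>Used to evaluate extensional arrow maps at the components of idempotent cones.\<close>

lemma (in conn_cat) eps_Hom:
  assumes "d \<in> D" "connected_to C c d" "a \<in> Obj C"
  shows "eps C c d a \<in> Hom C a c"
proof -
  obtain \<epsilon> where \<epsilon>: "idempotent_cone C c d \<epsilon>" using assms(2) unfolding connected_to_def by blast
  then have "cone_at C c \<epsilon>" using idempotent_cone_iff[OF D_classes[OF assms(1)]] by auto
  then show ?thesis using eps_eq[OF D_classes[OF assms(1)] \<epsilon>] cone_Hom assms(3) by simp
qed

section \<open>The CC-morphism of a homomorphism\<close>

locale hom_mor = conn_cat_pair C D C' D'
  for C :: "('o, 'm) scat" and D and C' :: "('p, 'n) scat" and D' +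
  fixes \<phi> :: "('o \<Rightarrow> 'm) \<Rightarrow> ('p \<Rightarrow> 'n)"
  assumes hom: "\<phi> \<in> semigrp_hom (down_set_semigrp (C, D)) (down_set_semigrp (C', D'))"
begin

abbreviation "\<phi>o \<equiv> hom_obj \<phi>"
abbreviation "\<phi>a \<equiv> hom_arr \<phi>"

lemma \<phi>_in: "\<gamma> \<in> \<Union>D \<Longrightarrow> \<phi> \<gamma> \<in> \<Union>D'"
  using hom unfolding semigrp_hom_def PiE_def Pi_def down_set_semigrp_simps by blast

lemma \<phi>_mult:
  "\<gamma> \<in> \<Union>D \<Longrightarrow> \<delta> \<in> \<Union>D \<Longrightarrow> \<phi> (\<gamma> \<otimes>\<^bsub>cones C\<^esub> \<delta>) = \<phi> \<gamma> \<otimes>\<^bsub>cones C'\<^esub> \<phi> \<delta>"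
  using hom unfolding semigrp_hom_def down_set_semigrp_simps by blast

lemma \<phi>_mono:
  assumes "\<gamma> \<in> \<Union>D" "\<delta> \<in> \<Union>D" "A.cone_le \<gamma> \<delta>"
  shows "B.cone_le (\<phi> \<gamma>) (\<phi> \<delta>)"
proof -
  obtain x where "x \<in> \<Union>D" "\<gamma> = \<delta> \<otimes>\<^bsub>cones C\<^esub> x" using A.T_le_multE[OF assms] .
  then show ?thesis using \<phi>_mult[OF assms(2)] B.cone_le_mult B.T_in_cones \<phi>_in assms(2) by simp
qed

lemma \<phi>_idem:
  assumes "c \<in> Obj C"
  shows "\<phi> (A.idem c) \<in> \<Union>D'" "cone_at C' (\<phi>o c) (\<phi> (A.idem c))" "\<phi> (A.idem c) (\<phi>o c) = Ide C' (\<phi>o c)"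
proof -
  show in': "\<phi> (A.idem c) \<in> \<Union>D'" using \<phi>_in[OF A.idem(1)[OF assms]] .
  then obtain w where "cone_at C' w (\<phi> (A.idem c))" by (rule B.T_coneE)
  then show cone: "cone_at C' (\<phi>o c) (\<phi> (A.idem c))" by (simp add: hom_obj_def B.vertex_eq)
  have "A.idem c \<otimes>\<^bsub>cones C\<^esub> A.idem c = A.idem c"
    using A.mult_Ide[OF A.idem(2)[OF assms] A.idem(2,3)[OF assms]] .
  then have "\<phi> (A.idem c) \<otimes>\<^bsub>cones C'\<^esub> \<phi> (A.idem c) = \<phi> (A.idem c)"
    using \<phi>_mult[OF A.idem(1)[OF assms] A.idem(1)[OF assms]] by simp
  then show "\<phi> (A.idem c) (\<phi>o c) = Ide C' (\<phi>o c)" using B.idempotent_iff[OF cone] by simp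
qed

lemma \<phi>o_Obj: "c \<in> Obj C \<Longrightarrow> \<phi>o c \<in> Obj C'"
  using B.cone_ObjD \<phi>_idem(2) by blast

text \<open>The equations saying that \<open>\<gamma>\<close> and \<open>A.idem z\<close> are left
  multiples of each other survive under \<open>\<phi>\<close>; they make the vertices of the two
  images subobjects of each other.\<close>

lemma \<phi>_cone:
  assumes "\<gamma> \<in> \<Union>D" "cone_at C z \<gamma>"
  shows "cone_at C' (\<phi>o z) (\<phi> \<gamma>)"
proof -
  have z: "z \<in> Obj C" using A.cone_ObjD[OF assms(2)] .
  obtain w where w: "cone_at C' w (\<phi> \<gamma>)" using B.T_coneE[OF \<phi>_in[OF assms(1)]] .
  have "\<phi> \<gamma> \<otimes>\<^bsub>cones C'\<^esub> \<phi> (A.idem z) = \<phi> \<gamma>"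
    using A.mult_Ide[OF assms(2) A.idem(2,3)[OF z]] \<phi>_mult[OF assms(1) A.idem(1)[OF z]] by simp
  then have 1: "B.incl w (\<phi>o z) \<in> B.Inc w (\<phi>o z)"
    using B.mult_vertex_Inc[OF w \<phi>_idem(2)[OF z]] w by simp
  obtain x where x: "x \<in> \<Union>D" "x \<otimes>\<^bsub>cones C\<^esub> \<gamma> = A.idem z" using A.idem_leftE[OF assms] .
  obtain y where y: "cone_at C' y (\<phi> x)" using B.T_coneE[OF \<phi>_in[OF x(1)]] .
  have "\<phi> x \<otimes>\<^bsub>cones C'\<^esub> \<phi> \<gamma> = \<phi> (A.idem z)" using x \<phi>_mult[OF x(1) assms(1)] by simp
  then have "B.incl (\<phi>o z) w \<in> B.Inc (\<phi>o z) w" using B.mult_vertex_Inc[OF y w] \<phi>_idem(2)[OF z] by simp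
  with 1 have "w = \<phi>o z" by (rule B.Inc_antisym)
  then show ?thesis using w by simp
qed

lemma \<phi>a_eq:
  assumes "f \<in> Hom C a b"
  obtains w k where "\<phi>a f = \<phi> (A.arrow_cone f) (\<phi>o a) \<cdot>\<^bsub>C'\<^esub> k" "k \<in> B.Inc w (\<phi>o b)"
    "cone_at C' w (\<phi> (A.arrow_cone f))" "\<phi> (A.arrow_cone f) (\<phi>o a) \<in> Hom C' (\<phi>o a) w"
proof -
  obtain v j where e: "j \<in> A.Inc v b" "cone_at C v (A.arrow_cone f)" "A.arrow_cone f \<in> \<Union>D" 
    "A.arrow_cone f \<otimes>\<^bsub>cones C\<^esub> A.idem b = A.arrow_cone f" using A.arrow_coneE[OF assms] .
  note ab = A.Hom_Obj[OF assms]
  note p = \<phi>_cone[OF e(3,2)]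
  have "\<phi> (A.arrow_cone f) \<otimes>\<^bsub>cones C'\<^esub> \<phi> (A.idem b) = \<phi> (A.arrow_cone f)"
    using \<phi>_mult[OF e(3) A.idem(1)[OF ab(2)]] e(4) by simp
  then have "B.incl (\<phi>o v) (\<phi>o b) \<in> B.Inc (\<phi>o v) (\<phi>o b)"
    using B.mult_vertex_Inc[OF p \<phi>_idem(2)[OF ab(2)]] p by simp
  then show ?thesis
    using that[OF _ _ p B.cone_Hom[OF p \<phi>o_Obj[OF ab(1)]]] B.vertex_eq[OF p]
    by (simp add: hom_arr_def Hom_D[OF assms])
qed

lemma \<phi>a_Hom:
  assumes "f \<in> Hom C a b"
  shows "\<phi>a f \<in> Hom C' (\<phi>o a) (\<phi>o b)"
  by (rule \<phi>a_eq[OF assms]) (auto intro: B.comp_Hom B.Inc_Hom)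

text \<open>The cone of \<open>j\<close> is \<open>A.idem a\<close>, whose image has an identity at
  \<open>\<phi>o a\<close>; only the appended inclusion is left.\<close>

lemma \<phi>a_Inc:
  assumes "j \<in> A.Inc a b"
  shows "\<phi>a j \<in> B.Inc (\<phi>o a) (\<phi>o b)"
proof -
  note ab = A.Hom_Obj[OF A.Inc_Hom[OF assms]]
  obtain w k where k: "\<phi>a j = \<phi> (A.arrow_cone j) (\<phi>o a) \<cdot>\<^bsub>C'\<^esub> k" "k \<in> B.Inc w (\<phi>o b)"
    "cone_at C' w (\<phi> (A.arrow_cone j))" using \<phi>a_eq[OF A.Inc_Hom[OF assms]] .
  have "w = \<phi>o a" using B.cone_unique[OF k(3)] \<phi>_idem(2)[OF ab(1)] A.arrow_cone_Inc[OF assms] by simp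
  then show ?thesis
    using k(1,2) A.arrow_cone_Inc[OF assms] \<phi>_idem(3)[OF ab(1)] B.Ide_comp[OF B.Inc_Hom[OF k(2)]] by simp
qed

lemma \<phi>a_Ide:
  assumes "a \<in> Obj C"
  shows "\<phi>a (Ide C a) = Ide C' (\<phi>o a)"
  using \<phi>a_Inc[OF A.Inc_Ide[OF assms]] B.Inc_Ide[OF \<phi>o_Obj[OF assms]] by (rule B.Inc_unique)

text \<open>The cone of the arrow \<open>\<gamma> c\<close> is the product of
  \<open>A.idem c\<close> and \<open>\<gamma>\<close>. The image of this product has as component at
  \<open>\<phi>o c\<close> the epimorphic part of \<open>\<phi> \<gamma> (\<phi>o c)\<close>, and
  the appended inclusion completes it. The condition on \<open>eps\<close> and the recovery of
  \<open>\<phi>\<close> both rest on this.\<close>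

lemma \<phi>a_component:
  assumes "\<gamma> \<in> \<Union>D" "c \<in> Obj C"
  shows "\<phi>a (\<gamma> c) = \<phi> \<gamma> (\<phi>o c)"
proof -
  obtain z where z: "cone_at C z \<gamma>" using A.T_coneE[OF assms(1)] .
  note g = A.cone_Hom[OF z assms(2)]
  obtain w k where k: "\<phi>a (\<gamma> c) = \<phi> (A.arrow_cone (\<gamma> c)) (\<phi>o c) \<cdot>\<^bsub>C'\<^esub> k" "k \<in> B.Inc w (\<phi>o z)"
    "cone_at C' w (\<phi> (A.arrow_cone (\<gamma> c)))"
    "\<phi> (A.arrow_cone (\<gamma> c)) (\<phi>o c) \<in> Hom C' (\<phi>o c) w" using \<phi>a_eq[OF g] .
  note i = \<phi>_idem[OF assms(2)]
  note pc = B.cone_Hom[OF \<phi>_cone[OF assms(1) z] \<phi>o_Obj[OF assms(2)]]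
  obtain v j where v: "epi_part C' (\<phi> \<gamma> (\<phi>o c)) \<in> Hom C' (\<phi>o c) v" "j \<in> B.Inc v (\<phi>o z)"
    "\<phi> \<gamma> (\<phi>o c) = epi_part C' (\<phi> \<gamma> (\<phi>o c)) \<cdot>\<^bsub>C'\<^esub> j" using B.epi_partE[OF pc] .
  have "\<phi> (A.arrow_cone (\<gamma> c)) (\<phi>o c) = (\<phi> (A.idem c) \<otimes>\<^bsub>cones C'\<^esub> \<phi> \<gamma>) (\<phi>o c)"
    using A.arrow_cone_component[OF assms] \<phi>_mult[OF A.idem(1)[OF assms(2)] assms(1)] by simp
  also have "\<dots> = epi_part C' (\<phi> \<gamma> (\<phi>o c))"
    using B.mult_eq[OF i(2)] B.cone_star_apply[OF \<phi>o_Obj[OF assms(2)]] i(3) B.Ide_comp[OF v(1)] by simp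
  finally have e: "\<phi> (A.arrow_cone (\<gamma> c)) (\<phi>o c) = epi_part C' (\<phi> \<gamma> (\<phi>o c))" .
  then have "w = v" using k(4) v(1) by (simp add: Hom_def)
  then have "k = j" using k(2) v(2) B.Inc_unique by blast
  then show ?thesis using k(1) e v(3) by simp
qed

lemma \<phi>a_comp:
  assumes "f \<in> Hom C a b" "g \<in> Hom C b c"
  shows "\<phi>a (f \<cdot>\<^bsub>C\<^esub> g) = \<phi>a f \<cdot>\<^bsub>C'\<^esub> \<phi>a g"
proof -
  let ?\<alpha> = "\<phi> (A.arrow_cone f)" and ?\<beta> = "\<phi> (A.arrow_cone g)"
  have a: "a \<in> Obj C" "b \<in> Obj C" using A.Hom_Obj[OF assms(1)] .
  obtain w j where f: "\<phi>a f = ?\<alpha> (\<phi>o a) \<cdot>\<^bsub>C'\<^esub> j" "j \<in> B.Inc w (\<phi>o b)"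
    "cone_at C' w ?\<alpha>" "?\<alpha> (\<phi>o a) \<in> Hom C' (\<phi>o a) w" using \<phi>a_eq[OF assms(1)] .
  obtain v k where g: "\<phi>a g = ?\<beta> (\<phi>o b) \<cdot>\<^bsub>C'\<^esub> k" "k \<in> B.Inc v (\<phi>o c)"
    "cone_at C' v ?\<beta>" using \<phi>a_eq[OF assms(2)] .
  obtain y l where fg: "\<phi>a (f \<cdot>\<^bsub>C\<^esub> g) = \<phi> (A.arrow_cone (f \<cdot>\<^bsub>C\<^esub> g)) (\<phi>o a) \<cdot>\<^bsub>C'\<^esub> l" "l \<in> B.Inc y (\<phi>o c)"
    "cone_at C' y (\<phi> (A.arrow_cone (f \<cdot>\<^bsub>C\<^esub> g)))" using \<phi>a_eq[OF A.comp_Hom[OF assms]] .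
  have w: "w \<in> Obj C'" using B.cone_ObjD[OF f(3)] .
  note bH = B.cone_Hom[OF g(3) \<phi>o_Obj[OF a(2)]]
  obtain u i where e: "epi_part C' (?\<beta> w) \<in> Hom C' w u" "i \<in> B.Inc u v"
    "?\<beta> w = epi_part C' (?\<beta> w) \<cdot>\<^bsub>C'\<^esub> i" "cone_at C' u (?\<alpha> \<otimes>\<^bsub>cones C'\<^esub> ?\<beta>)"
    using B.multE[OF f(3) g(3)] .
  have T: "A.arrow_cone f \<in> \<Union>D" "A.arrow_cone g \<in> \<Union>D"
    by (rule A.arrow_coneE[OF assms(1)], assumption) (rule A.arrow_coneE[OF assms(2)], assumption)
  have \<alpha>\<beta>: "?\<alpha> \<otimes>\<^bsub>cones C'\<^esub> ?\<beta> = \<phi> (A.arrow_cone (f \<cdot>\<^bsub>C\<^esub> g))"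
    using \<phi>_mult[OF T] A.arrow_cone_comp[OF assms] by simp
  have "u = y" using B.cone_unique[OF e(4)] fg(3) \<alpha>\<beta> by simp
  then have l: "i \<cdot>\<^bsub>C'\<^esub> k = l" using B.Inc_unique[OF B.Inc_comp[OF e(2) g(2)]] fg(2) by simp
  have "\<phi>a f \<cdot>\<^bsub>C'\<^esub> \<phi>a g = ?\<alpha> (\<phi>o a) \<cdot>\<^bsub>C'\<^esub> ((j \<cdot>\<^bsub>C'\<^esub> ?\<beta> (\<phi>o b)) \<cdot>\<^bsub>C'\<^esub> k)"
    using f(4) B.Inc_Hom[OF f(2)] bH B.Inc_Hom[OF g(2)] unfolding f(1) g(1)
    by (simp add: Hom_def B.comp_simps)
  \<comment> \<open>The inclusion that ends \<open>\<phi>a f\<close> is absorbed by the cone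
    \<open>?\<beta>\<close>, whose component at \<open>w\<close> takes over.\<close>
  also have "j \<cdot>\<^bsub>C'\<^esub> ?\<beta> (\<phi>o b) = epi_part C' (?\<beta> w) \<cdot>\<^bsub>C'\<^esub> i" using B.cone_Inc[OF g(3) f(2)] e(3) by simp
  also have "?\<alpha> (\<phi>o a) \<cdot>\<^bsub>C'\<^esub> ((epi_part C' (?\<beta> w) \<cdot>\<^bsub>C'\<^esub> i) \<cdot>\<^bsub>C'\<^esub> k)
      = (?\<alpha> (\<phi>o a) \<cdot>\<^bsub>C'\<^esub> epi_part C' (?\<beta> w)) \<cdot>\<^bsub>C'\<^esub> (i \<cdot>\<^bsub>C'\<^esub> k)"
    using f(4) e(1) B.Inc_Hom[OF e(2)] B.Inc_Hom[OF g(2)] by (simp add: Hom_def B.comp_simps)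
  also have "?\<alpha> (\<phi>o a) \<cdot>\<^bsub>C'\<^esub> epi_part C' (?\<beta> w) = (?\<alpha> \<otimes>\<^bsub>cones C'\<^esub> ?\<beta>) (\<phi>o a)"
    using B.mult_eq[OF f(3)] B.cone_star_apply[OF \<phi>o_Obj[OF a(1)]] by simp
  finally show ?thesis using fg(1) \<alpha>\<beta> l by simp
qed

text \<open>Members of \<open>d\<close> are below each other and \<open>\<phi>\<close> is monotone,
  so a single representative computes the saturated image.\<close>

lemma hom_class_eq:
  assumes "d \<in> D" "\<gamma> \<in> d"
  shows "hom_class \<phi> d = B.cone_class (\<phi> \<gamma>)"
proof -
  have "B.cone_class (\<phi> \<delta>) = B.cone_class (\<phi> \<gamma>)" if \<delta>: "\<delta> \<in> d" for \<delta>
  proof -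
    have g: "\<gamma> \<in> \<Union>D" "\<delta> \<in> \<Union>D" using assms \<delta> by auto
    have "\<delta> \<in> A.cone_class \<gamma>" using A.D_in[OF assms] \<delta> by simp
    then have "A.cone_le \<gamma> \<delta>" "A.cone_le \<delta> \<gamma>" using A.cone_class_iff A.T_in_cones[OF g(1)] by blast+
    then have "\<phi> \<delta> \<in> B.cone_class (\<phi> \<gamma>)"
      using \<phi>_mono g B.cone_class_iff B.T_in_cones \<phi>_in by meson
    then show ?thesis
      using B.in_cone_classes(2)[OF B.cone_class_in[OF B.T_in_cones[OF \<phi>_in[OF g(1)]]]] by simp
  qed
  then show ?thesis using assms(2) unfolding hom_class_def by fastforce
qed

lemma hom_class_in: "d \<in> D \<Longrightarrow> hom_class \<phi> d \<in> D'"
  using A.cone_classes_nonempty[OF A.D_classes] hom_class_eq B.cone_class_D \<phi>_in by (metis UnionI)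

lemma in_hom_class: "d \<in> D \<Longrightarrow> \<gamma> \<in> d \<Longrightarrow> \<phi> \<gamma> \<in> hom_class \<phi> d"
  using hom_class_eq B.self_in_cone_class B.T_in_cones \<phi>_in by (metis UnionI)

lemma cc_morphism_cc_of_hom: "cc_morphism (C, D) (C', D') (cc_of_hom \<phi>)"
proof -
  let ?F = "\<lparr>on_Obj = restrict \<phi>o (Obj C), on_Arr = restrict \<phi>a (Arr C)\<rparr>"
  have "is_functor C C' ?F"
  proof (rule is_functorI)
    show "category C" "category C'" by (fact A.cat B.cat)+
    show "on_Obj ?F a \<in> Obj C'" if "a \<in> Obj C" for a using \<phi>o_Obj that by simp
    show "on_Arr ?F f \<in> Hom C' (on_Obj ?F a) (on_Obj ?F b)" if "f \<in> Hom C a b" for f a b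
      using \<phi>a_Hom[OF that] A.Hom_Obj[OF that] Hom_D(1)[OF that] by simp
    show "on_Arr ?F (Ide C a) = Ide C' (on_Obj ?F a)" if "a \<in> Obj C" for a
      using \<phi>a_Ide[OF that] that Hom_D(1)[OF A.Ide_Hom[OF that]] by simp
    show "on_Arr ?F (f \<cdot>\<^bsub>C\<^esub> g) = on_Arr ?F f \<cdot>\<^bsub>C'\<^esub> on_Arr ?F g"
      if "f \<in> Hom C a b" "g \<in> Hom C b c" for f g a b c
      using \<phi>a_comp[OF that] Hom_D(1)[OF A.comp_Hom[OF that]] Hom_D(1)[OF that(1)] Hom_D(1)[OF that(2)] by simp
  qed
  moreover have "on_Arr ?F j \<in> Incl C'" if "j \<in> Incl C" for j
    using \<phi>a_Inc[OF A.Incl_Inc[OF that]] Hom_D(1)[OF A.Inc_Hom[OF A.Incl_Inc[OF that]]]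
    by (simp add: B.Inc_def)
  moreover have "R_le (cones C') (hom_class \<phi> d) (hom_class \<phi> d')"
    if d: "d \<in> D" "d' \<in> D" "R_le (cones C) d d'" for d d'
  proof -
    obtain \<gamma> \<delta> where g: "\<gamma> \<in> d" "\<delta> \<in> d'" using A.cone_classes_nonempty A.D_classes d by meson
    then have "A.cone_le \<gamma> \<delta>" using A.R_le_iff A.D_classes d by blast
    then have "B.cone_le (\<phi> \<gamma>) (\<phi> \<delta>)" using \<phi>_mono g d by blast
    then show ?thesis
      using B.R_le_iff[OF B.D_classes B.D_classes] hom_class_in in_hom_class g d by blast
  qed
  moreover have "connected_to C' (\<phi>o c) (hom_class \<phi> d) \<and>
      (\<forall>a\<in>Obj C. \<phi>a (eps C c d a) = eps C' (\<phi>o c) (hom_class \<phi> d) (\<phi>o a))"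
    if c: "c \<in> Obj C" and d: "d \<in> D" and con: "connected_to C c d" for c d
  proof -
    obtain \<epsilon> where \<epsilon>: "idempotent_cone C c d \<epsilon>" using con by (auto simp: connected_to_def)
    then have e: "\<epsilon> \<in> d" "cone_at C c \<epsilon>" "\<epsilon> c = Ide C c"
      using A.idempotent_cone_iff[OF A.D_classes[OF d]] by auto
    then have T: "\<epsilon> \<in> \<Union>D" using d by blast
    \<comment> \<open>The identity \<open>\<epsilon> c\<close> is mapped to the component of
      \<open>\<phi> \<epsilon>\<close> at \<open>\<phi>o c\<close>, which is therefore an identity
      too.\<close>
    have "idempotent_cone C' (\<phi>o c) (hom_class \<phi> d) (\<phi> \<epsilon>)"
      using B.idempotent_cone_iff[OF B.D_classes[OF hom_class_in[OF d]]] in_hom_class[OF d e(1)]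
        \<phi>_cone[OF T e(2)] \<phi>a_component[OF T c] e(3) \<phi>a_Ide[OF c] by simp
    then show ?thesis
      using A.eps_eq[OF A.D_classes[OF d] \<epsilon>] B.eps_eq[OF B.D_classes[OF hom_class_in[OF d]]]
        \<phi>a_component[OF T] by (auto simp: connected_to_def)
  qed
  moreover have "eps C c d a \<in> Arr C" if "d \<in> D" "connected_to C c d" "a \<in> Obj C" for a c d
    using Hom_D(1)[OF A.eps_Hom[OF that]] .
  ultimately show ?thesis
    using hom_class_in unfolding cc_of_hom_def cc_morphism_def by simp
qed

lemma hom_of_cc_of_hom: "hom_of_cc (C, D) (cc_of_hom \<phi>) = \<phi>"
proof -
  let ?F = "\<lparr>on_Obj = restrict \<phi>o (Obj C), on_Arr = restrict \<phi>a (Arr C)\<rparr>"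
  interpret M: cc_mor C D C' D' ?F "restrict (hom_class \<phi>) D"
    by unfold_locales (use cc_morphism_cc_of_hom in \<open>simp add: cc_of_hom_def\<close>)
  have "M.\<phi> \<gamma> = \<phi> \<gamma>" if \<gamma>: "\<gamma> \<in> \<Union>D" for \<gamma>
  proof (rule M.\<phi>_eqI[OF \<gamma>])
    show "\<phi> \<gamma> \<in> restrict (hom_class \<phi>) D (A.cone_class \<gamma>)"
      using in_hom_class A.cone_class_D[OF \<gamma>] A.self_in_cone_class[OF A.T_in_cones[OF \<gamma>]] by simp
    show "\<phi> \<gamma> (on_Obj ?F c) = on_Arr ?F (\<gamma> c)" if "c \<in> Obj C" for c
    proof -
      obtain z where "cone_at C z \<gamma>" using A.T_coneE[OF \<gamma>] .
      then show ?thesis using \<phi>a_component[OF \<gamma> that] that Hom_D(1)[OF A.cone_Hom] by simp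
    qed
  qed
  moreover have "\<phi> \<in> extensional (\<Union>D)" using hom by (simp add: semigrp_hom_def PiE_def)
  ultimately have "M.\<phi> = \<phi>" using M.\<phi>_extensional by (intro extensionalityI[of _ "\<Union>D"])
  then show ?thesis by (simp add: M.\<phi>_def cc_of_hom_def)
qed

end

section \<open>The functor from connected categories to semigroups\<close>

lemma conn_catI: "connected_category (C, D) \<Longrightarrow> conn_cat C D"
  by unfold_locales (simp_all add: connected_category_def)

lemma cc_morphism_id:
  assumes "connected_category X"
  shows "cc_morphism X X (cc_id X)"
proof -
  obtain C D where X: "X = (C, D)" by (cases X)
  interpret conn_cat C D using assms X by (simp add: conn_catI)
  have "is_functor C C \<lparr>on_Obj = (\<lambda>c\<in>Obj C. c), on_Arr = (\<lambda>f\<in>Arr C. f)\<rparr>"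
    by (rule is_functorI) (use cat in \<open>auto simp: Hom_D(1)[OF Ide_Hom] Hom_D(1)[OF comp_Hom] Hom_D Hom_Obj\<close>)
  moreover have "j \<in> Arr C" if "j \<in> Incl C" for j
    using Hom_D(1)[OF Inc_Hom[OF Incl_Inc[OF that]]] .
  ultimately show ?thesis
    unfolding X cc_morphism_def cc_id_def by (simp add: Hom_D(1)[OF eps_Hom])
qed

lemma cc_morphism_comp:
  assumes "connected_category X" "cc_morphism X Y H" "cc_morphism Y Z K"
  shows "cc_morphism X Z (cc_comp X H K)"
proof -
  obtain C D where X: "X = (C, D)" by (cases X)
  obtain C' D' where Y: "Y = (C', D')" by (cases Y)
  obtain C'' D'' where Z: "Z = (C'', D'')" by (cases Z)
  obtain F G where H: "H = (F, G)" by (cases H)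
  obtain F' G' where K: "K = (F', G')" by (cases K)
  interpret conn_cat C D using assms X by (simp add: conn_catI)
  have F: "is_functor C C' F" and F': "is_functor C' C'' F'"
    using assms by (simp_all add: X Y Z H K cc_morphism_def)
  let ?F = "\<lparr>on_Obj = compose (Obj C) (on_Obj F') (on_Obj F), on_Arr = compose (Arr C) (on_Arr F') (on_Arr F)\<rparr>"
  have "is_functor C C'' ?F"
  proof (rule is_functorI)
    show "category C" "category C''" using F F' by (simp_all add: is_functor_def)
    show "on_Obj ?F a \<in> Obj C''" if "a \<in> Obj C" for a
      using that functor_Obj[OF F that] functor_Obj[OF F'] by (simp add: compose_eq)
    show "on_Arr ?F f \<in> Hom C'' (on_Obj ?F a) (on_Obj ?F b)" if "f \<in> Hom C a b" for f a b
      using functor_Hom[OF F' functor_Hom[OF F that]] Hom_Obj[OF that] Hom_D(1)[OF that] by (simp add: compose_eq)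
    show "on_Arr ?F (Ide C a) = Ide C'' (on_Obj ?F a)" if "a \<in> Obj C" for a
      using that Hom_D(1)[OF Ide_Hom[OF that]] functor_Ide[OF F that] functor_Ide[OF F' functor_Obj[OF F that]]
      by (simp add: compose_eq)
    show "on_Arr ?F (f \<cdot>\<^bsub>C\<^esub> g) = on_Arr ?F f \<cdot>\<^bsub>C''\<^esub> on_Arr ?F g"
      if fg: "f \<in> Hom C a b" "g \<in> Hom C b c" for f g a b c
      using functor_comp[OF F fg] functor_comp[OF F' functor_Hom[OF F fg(1)] functor_Hom[OF F fg(2)]]
        Hom_D(1)[OF comp_Hom[OF fg]] Hom_D(1)[OF fg(1)] Hom_D(1)[OF fg(2)] by (simp add: compose_eq)
  qed
  moreover have "compose (Arr C) (on_Arr F') (on_Arr F) j \<in> Incl C''" if "j \<in> Incl C" for j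
    using assms that Hom_D(1)[OF Inc_Hom[OF Incl_Inc[OF that]]]
    by (simp add: X Y Z H K cc_morphism_def compose_eq)
  moreover have G: "G d \<in> D'" if "d \<in> D" for d
    using assms(2) that unfolding X Y H cc_morphism_def by auto
  moreover have "G' d \<in> D''" if "d \<in> D'" for d
    using assms(3) that unfolding Z Y K cc_morphism_def by auto
  moreover have "R_le (cones C'') (G' (G d)) (G' (G d'))"
    if "d \<in> D" "d' \<in> D" "R_le (cones C) d d'" for d d'
    using assms(2,3) that G unfolding X Y Z H K cc_morphism_def by simp
  moreover have "connected_to C'' (on_Obj F' (on_Obj F c)) (G' (G d)) \<and>
      (\<forall>a\<in>Obj C. on_Arr F' (on_Arr F (eps C c d a)) = eps C'' (on_Obj F' (on_Obj F c)) (G' (G d)) (on_Obj F' (on_Obj F a)))"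
    if "c \<in> Obj C" "d \<in> D" "connected_to C c d" for c d
    using assms(2,3) that G functor_Obj[OF F] unfolding X Y Z H K cc_morphism_def by simp
  ultimately show ?thesis
    unfolding X Z H K cc_morphism_def cc_comp_def
    by (simp add: compose_eq Hom_D(1)[OF eps_Hom] Pi_def compose_extensional compose_def)
qed

lemma cc_mor_ccI:
  assumes "connected_category (C, D)" "connected_category (C', D')" "cc_morphism (C, D) (C', D') (F, G)"
  shows "cc_mor C D C' D' F G"
proof -
  interpret A: conn_cat C D using assms(1) by (rule conn_catI)
  interpret B: conn_cat C' D' using assms(2) by (rule conn_catI)
  show ?thesis by unfold_locales (fact assms(3))
qed

lemma hom_of_cc_id:
  assumes "connected_category (C, D)"
  shows "hom_of_cc (C, D) (cc_id (C, D)) = (\<lambda>\<gamma>\<in>\<Union>D. \<gamma>)"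
proof -
  let ?F = "\<lparr>on_Obj = (\<lambda>c\<in>Obj C. c), on_Arr = (\<lambda>f\<in>Arr C. f)\<rparr>" and ?G = "\<lambda>d\<in>D. d"
  have id: "cc_id (C, D) = (?F, ?G)" by (simp add: cc_id_def)
  interpret cc_mor C D C D ?F ?G
    using cc_mor_ccI[OF assms assms] cc_morphism_id[OF assms] id by simp
  have "\<phi> \<gamma> = \<gamma>" if \<gamma>: "\<gamma> \<in> \<Union>D" for \<gamma>
  proof -
    obtain z where z: "cone_at C z \<gamma>" using A.T_coneE[OF \<gamma>] .
    show ?thesis
      by (rule \<phi>_eqI[OF \<gamma>])
        (use A.cone_class_D[OF \<gamma>] A.self_in_cone_class[OF A.T_in_cones[OF \<gamma>]] Hom_D(1)[OF A.cone_Hom[OF z]] in simp_all)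
  qed
  then show ?thesis
    using \<phi>_extensional unfolding id \<phi>_def[symmetric]
    by (intro extensionalityI[of _ "\<Union>D"]) auto
qed

lemma hom_of_cc_comp:
  assumes X: "connected_category (C, D)" and Y: "connected_category (C', D')"
    and Z: "connected_category (C'', D'')"
    and H: "cc_morphism (C, D) (C', D') H" and K: "cc_morphism (C', D') (C'', D'') K"
  shows "hom_of_cc (C, D) (cc_comp (C, D) H K) = compose (\<Union>D) (hom_of_cc (C', D') K) (hom_of_cc (C, D) H)"
proof -
  obtain F G where h: "H = (F, G)" by (cases H)
  obtain F' G' where k: "K = (F', G')" by (cases K)
  let ?F = "\<lparr>on_Obj = compose (Obj C) (on_Obj F') (on_Obj F), on_Arr = compose (Arr C) (on_Arr F') (on_Arr F)\<rparr>"
  let ?G = "compose D G' G"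
  have c: "cc_comp (C, D) H K = (?F, ?G)" by (simp add: cc_comp_def h k)
  interpret P: cc_mor C D C' D' F G using cc_mor_ccI[OF X Y] H h by simp
  interpret Q: cc_mor C' D' C'' D'' F' G' using cc_mor_ccI[OF Y Z] K k by simp
  interpret R: cc_mor C D C'' D'' ?F ?G
    using cc_mor_ccI[OF X Z] cc_morphism_comp[OF X H K] c by simp
  have "R.\<phi> \<gamma> = Q.\<phi> (P.\<phi> \<gamma>)" if \<gamma>: "\<gamma> \<in> \<Union>D" for \<gamma>
  proof -
    obtain z where z: "cone_at C z \<gamma>" using P.A.T_coneE[OF \<gamma>] .
    note p = P.\<phi>[OF \<gamma> z]
    note q = Q.\<phi>[OF P.\<phi>_in[OF \<gamma>] p(2)]
    \<comment> \<open>\<open>G'\<close> is applied to the class of the image cone, which is the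
      class that defines \<open>Q.\<phi>\<close> there.\<close>
    have "G (P.A.cone_class \<gamma>) = P.B.cone_class (P.\<phi> \<gamma>)" using P.B.D_in[OF P.G_class[OF \<gamma>] p(1)] .
    then show ?thesis
      using q(1) p(3) q(3)[OF P.F_Obj] P.A.cone_class_D[OF \<gamma>] Hom_D(1)[OF P.A.cone_Hom[OF z]]
      by (intro R.\<phi>_eqI[OF \<gamma>]) (simp_all add: compose_eq)
  qed
  then show ?thesis
    using R.\<phi>_extensional unfolding c unfolding R.\<phi>_def[symmetric] h k P.\<phi>_def[symmetric] Q.\<phi>_def[symmetric]
    by (intro extensionalityI[of _ "\<Union>D"]) (auto simp: compose_def)
qed

section \<open>The two categories\<close>

lemma in_Obj_CC:
  "X \<in> Obj (CC U) \<longleftrightarrow> connected_category X \<and> Obj (fst X) \<in> U \<and> Arr (fst X) \<in> U \<and> (\<exists>Z\<in>U. snd X \<lesssim> Z)"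
  by (cases X) (simp add: CC_def Let_def)

lemma CC_simps [simp]:
  "Dom (CC U) (X, H, Y) = X" "Cod (CC U) (X, H, Y) = Y"
  "Ide (CC U) X = (X, cc_id X, X)"
  "(X, H, Y) \<cdot>\<^bsub>CC U\<^esub> (Y', K, Z) = (X, cc_comp X H K, Z)"
  by (simp_all add: CC_def Let_def)

lemma Hom_CC: "f \<in> Hom (CC U) X Y \<longleftrightarrow>
  X \<in> Obj (CC U) \<and> Y \<in> Obj (CC U) \<and> (\<exists>H. f = (X, H, Y) \<and> cc_morphism X Y H)"
  by (auto simp: Hom_def CC_def Let_def)

lemma in_Obj_LRS:
  "S \<in> Obj (LRS U) \<longleftrightarrow> semigrp S \<and> regular S \<and> left_reductive S \<and> carrier S \<in> U"
  by (simp add: LRS_def Let_def)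

lemma LRS_simps [simp]:
  "Dom (LRS U) (S, \<phi>, T) = S" "Cod (LRS U) (S, \<phi>, T) = T"
  "Ide (LRS U) S = (S, (\<lambda>x\<in>carrier S. x), S)"
  "(S, \<phi>, T) \<cdot>\<^bsub>LRS U\<^esub> (T', \<psi>, V) = (S, compose (carrier S) \<psi> \<phi>, V)"
  by (simp_all add: LRS_def Let_def)

lemma Hom_LRS: "f \<in> Hom (LRS U) S T \<longleftrightarrow>
  S \<in> Obj (LRS U) \<and> T \<in> Obj (LRS U) \<and> (\<exists>\<phi>. f = (S, \<phi>, T) \<and> \<phi> \<in> semigrp_hom S T)"
  by (auto simp: Hom_def LRS_def Let_def)

lemma categoryI:
  assumes "\<And>f. f \<in> Arr C \<Longrightarrow> Dom C f \<in> Obj C \<and> Cod C f \<in> Obj C"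
    and "\<And>a. a \<in> Obj C \<Longrightarrow> Ide C a \<in> Hom C a a"
    and "\<And>f g a b c. f \<in> Hom C a b \<Longrightarrow> g \<in> Hom C b c \<Longrightarrow> f \<cdot>\<^bsub>C\<^esub> g \<in> Hom C a c"
    and "\<And>f a b. f \<in> Hom C a b \<Longrightarrow> Ide C a \<cdot>\<^bsub>C\<^esub> f = f \<and> f \<cdot>\<^bsub>C\<^esub> Ide C b = f"
    and "\<And>f g h a b c d. f \<in> Hom C a b \<Longrightarrow> g \<in> Hom C b c \<Longrightarrow> h \<in> Hom C c d \<Longrightarrow>
      (f \<cdot>\<^bsub>C\<^esub> g) \<cdot>\<^bsub>C\<^esub> h = f \<cdot>\<^bsub>C\<^esub> (g \<cdot>\<^bsub>C\<^esub> h)"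
  shows "category C"
  unfolding category_def
  \<comment> \<open>\<open>back_subst\<close> replaces the domain of the second arrow by the
    codomain of the first.\<close>
  using assms(1,2) assms(3)[OF Arr_Hom Arr_Hom[THEN back_subst[of "\<lambda>x. _ \<in> Hom C x _"]]]
    assms(4)[OF Arr_Hom] assms(5)[OF Arr_Hom] by (auto simp: Hom_def)

lemma semigrp_hom_closed: "\<phi> \<in> semigrp_hom S T \<Longrightarrow> x \<in> carrier S \<Longrightarrow> \<phi> x \<in> carrier T"
  by (auto simp: semigrp_hom_def)

lemma semigrp_hom_compose:
  assumes "semigrp S" "\<phi> \<in> semigrp_hom S T" "\<psi> \<in> semigrp_hom T V"
  shows "compose (carrier S) \<psi> \<phi> \<in> semigrp_hom S V"
  using assms by (auto simp: semigrp_hom_def semigrp_def compose_def Pi_def PiE_def)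

lemma semigrp_hom_id: "semigrp S \<Longrightarrow> (\<lambda>x\<in>carrier S. x) \<in> semigrp_hom S S"
  by (auto simp: semigrp_hom_def semigrp_def)

lemma category_LRS: "category (LRS U)"
proof (rule categoryI)
  show "Dom (LRS U) f \<in> Obj (LRS U) \<and> Cod (LRS U) f \<in> Obj (LRS U)" if "f \<in> Arr (LRS U)" for f
    using Arr_Hom[OF that] Hom_LRS by blast
  show "Ide (LRS U) S \<in> Hom (LRS U) S S" if "S \<in> Obj (LRS U)" for S
    using that semigrp_hom_id by (auto simp: Hom_LRS in_Obj_LRS)
  show "f \<cdot>\<^bsub>LRS U\<^esub> g \<in> Hom (LRS U) S V" if "f \<in> Hom (LRS U) S T" "g \<in> Hom (LRS U) T V" for f g S T V
    using that semigrp_hom_compose by (auto simp: Hom_LRS in_Obj_LRS)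
  show "Ide (LRS U) S \<cdot>\<^bsub>LRS U\<^esub> f = f \<and> f \<cdot>\<^bsub>LRS U\<^esub> Ide (LRS U) T = f" if "f \<in> Hom (LRS U) S T" for f S T
    using that by (auto simp: Hom_LRS semigrp_hom_def PiE_def intro!: ext)
       (auto simp: compose_def extensional_def Pi_def)
  show "(f \<cdot>\<^bsub>LRS U\<^esub> g) \<cdot>\<^bsub>LRS U\<^esub> h = f \<cdot>\<^bsub>LRS U\<^esub> (g \<cdot>\<^bsub>LRS U\<^esub> h)"
    if "f \<in> Hom (LRS U) S T" "g \<in> Hom (LRS U) T V" "h \<in> Hom (LRS U) V W" for f g h S T V W
    using that by (auto simp: Hom_LRS semigrp_hom_def PiE_def intro!: ext) (auto simp: compose_def Pi_def)
qed

lemma cc_morphism_extensional: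
  assumes "cc_morphism (C, D) (C', D') (F, G)"
  shows "on_Obj F \<in> Obj C \<rightarrow>\<^sub>E Obj C'" "on_Arr F \<in> Arr C \<rightarrow>\<^sub>E Arr C'" "G \<in> D \<rightarrow>\<^sub>E D'"
  using assms unfolding cc_morphism_def is_functor_def by (auto simp: PiE_def Hom_def)

lemma compose_restrict_id:
  assumes "f \<in> A \<rightarrow>\<^sub>E B"
  shows "compose A f (\<lambda>x\<in>A. x) = f" "compose A (\<lambda>x\<in>B. x) f = f"
  using assms by (auto simp: compose_def fun_eq_iff PiE_def extensional_def)

lemma cc_comp_id:
  assumes "cc_morphism X Y H"
  shows "cc_comp X (cc_id X) H = H" "cc_comp X H (cc_id Y) = H"
  using cc_morphism_extensional[of "fst X" "snd X" "fst Y" "snd Y" "fst H" "snd H"] assms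
  by (cases X; cases Y; cases H; simp add: cc_comp_def cc_id_def compose_restrict_id)+

lemma cc_comp_assoc:
  assumes "cc_morphism X Y H" "cc_morphism Y Z K"
  shows "cc_comp X (cc_comp X H K) L = cc_comp X H (cc_comp Y K L)"
  using cc_morphism_extensional[of "fst X" "snd X" "fst Y" "snd Y" "fst H" "snd H"] assms
  by (cases X; cases Y; cases H; cases K; cases L)
    (auto simp: cc_comp_def compose_def fun_eq_iff PiE_def Pi_def)

lemma category_CC: "category (CC U)"
proof (rule categoryI)
  show "Dom (CC U) f \<in> Obj (CC U) \<and> Cod (CC U) f \<in> Obj (CC U)" if "f \<in> Arr (CC U)" for f
    using Arr_Hom[OF that] Hom_CC by blast
  show "Ide (CC U) X \<in> Hom (CC U) X X" if "X \<in> Obj (CC U)" for X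
    using that cc_morphism_id[of X] by (auto simp: Hom_CC in_Obj_CC)
  show "f \<cdot>\<^bsub>CC U\<^esub> g \<in> Hom (CC U) X Z" if "f \<in> Hom (CC U) X Y" "g \<in> Hom (CC U) Y Z" for f g X Y Z
  proof -
    have "connected_category X" using that by (simp add: Hom_CC in_Obj_CC)
    then show ?thesis using that cc_morphism_comp unfolding Hom_CC by fastforce
  qed
  show "Ide (CC U) X \<cdot>\<^bsub>CC U\<^esub> f = f \<and> f \<cdot>\<^bsub>CC U\<^esub> Ide (CC U) Y = f" if f: "f \<in> Hom (CC U) X Y" for f X Y
  proof -
    obtain H where "f = (X, H, Y)" "cc_morphism X Y H" using f unfolding Hom_CC by blast
    then show ?thesis by (simp add: cc_comp_id)
  qed
  show "(f \<cdot>\<^bsub>CC U\<^esub> g) \<cdot>\<^bsub>CC U\<^esub> h = f \<cdot>\<^bsub>CC U\<^esub> (g \<cdot>\<^bsub>CC U\<^esub> h)"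
    if fgh: "f \<in> Hom (CC U) X Y" "g \<in> Hom (CC U) Y Z" "h \<in> Hom (CC U) Z W" for f g h X Y Z W
  proof -
    obtain H K L where "f = (X, H, Y)" "cc_morphism X Y H" "g = (Y, K, Z)" "cc_morphism Y Z K" "h = (Z, L, W)"
      using fgh unfolding Hom_CC by blast
    then show ?thesis by (simp add: cc_comp_assoc)
  qed
qed

section \<open>Transport of structure along an injection\<close>

definition transport :: "('a \<Rightarrow> 'b) \<Rightarrow> 'a semigrp \<Rightarrow> 'b semigrp" where
  "transport e T = \<lparr>carrier = e ` carrier T,
     mult = (\<lambda>x y. e (inv_into (carrier T) e x \<otimes>\<^bsub>T\<^esub> inv_into (carrier T) e y))\<rparr>"

lemma transport_simps:
  assumes "inj_on e (carrier T)"
  shows "carrier (transport e T) = e ` carrier T"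
    and "x \<in> carrier T \<Longrightarrow> y \<in> carrier T \<Longrightarrow> e x \<otimes>\<^bsub>transport e T\<^esub> e y = e (x \<otimes>\<^bsub>T\<^esub> y)"
  using assms by (simp_all add: transport_def inv_into_f_f)

lemma transport_semigrp:
  assumes "inj_on e (carrier T)" "semigrp T"
  shows "semigrp (transport e T)"
  using assms(2) unfolding semigrp_def transport_simps(1)[OF assms(1)]
  by (auto simp: transport_simps(2)[OF assms(1)])

lemma transport_regular:
  assumes "inj_on e (carrier T)" "semigrp T" "regular T"
  shows "regular (transport e T)"
  unfolding regular_def transport_simps(1)[OF assms(1)]
proof
  fix a' assume "a' \<in> e ` carrier T"
  then obtain a where a: "a \<in> carrier T" "a' = e a" by blast
  obtain x where x: "x \<in> carrier T" "(a \<otimes>\<^bsub>T\<^esub> x) \<otimes>\<^bsub>T\<^esub> a = a"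
    using assms(3) a(1) unfolding regular_def by blast
  have "a \<otimes>\<^bsub>T\<^esub> x \<in> carrier T" using assms(2) a x unfolding semigrp_def by blast
  then have "(a' \<otimes>\<^bsub>transport e T\<^esub> e x) \<otimes>\<^bsub>transport e T\<^esub> a' = a'"
    using a x by (simp add: transport_simps(2)[OF assms(1)])
  then show "\<exists>x\<in>e ` carrier T. (a' \<otimes>\<^bsub>transport e T\<^esub> x) \<otimes>\<^bsub>transport e T\<^esub> a' = a'"
    using x(1) by blast
qed

lemma transport_left_reductive:
  assumes "inj_on e (carrier T)" "semigrp T" "left_reductive T"
  shows "left_reductive (transport e T)"
  unfolding left_reductive_def
proof (rule inj_onI)
  fix x' y' assume "x' \<in> carrier (transport e T)" "y' \<in> carrier (transport e T)"
  then obtain x y where xy: "x \<in> carrier T" "y \<in> carrier T" "x' = e x" "y' = e y"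
    by (auto simp: transport_simps(1)[OF assms(1)])
  assume eq: "(\<lambda>z\<in>carrier (transport e T). z \<otimes>\<^bsub>transport e T\<^esub> x') =
      (\<lambda>z\<in>carrier (transport e T). z \<otimes>\<^bsub>transport e T\<^esub> y')"
  have "z \<otimes>\<^bsub>T\<^esub> x = z \<otimes>\<^bsub>T\<^esub> y" if z: "z \<in> carrier T" for z
  proof -
    have "e (z \<otimes>\<^bsub>T\<^esub> x) = e (z \<otimes>\<^bsub>T\<^esub> y)"
      using fun_cong[OF eq, of "e z"] z xy by (simp add: transport_simps[OF assms(1)])
    then show ?thesis using inj_onD[OF assms(1)] assms(2) z xy unfolding semigrp_def by blast
  qed
  then have "x = y"
    using xy by (intro inj_onD[OF assms(3)[unfolded left_reductive_def]]) (auto intro: restrict_ext)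
  then show "x' = y'" using xy by simp
qed

lemma LRS_isoI:
  assumes "S \<in> Obj (LRS U)" "T \<in> Obj (LRS U)" "\<theta> \<in> semigrp_hom S T" "bij_betw \<theta> (carrier S) (carrier T)"
  shows "iso (LRS U) (S, \<theta>, T)"
proof -
  interpret category_locale "LRS U" by unfold_locales (rule category_LRS)
  let ?\<theta>' = "\<lambda>y\<in>carrier T. inv_into (carrier S) \<theta> y"
  have inj: "inj_on \<theta> (carrier S)" and im: "\<theta> ` carrier S = carrier T"
    using assms(4) by (auto simp: bij_betw_def)
  have "?\<theta>' \<in> semigrp_hom T S"
    unfolding semigrp_hom_def
  proof (intro CollectI conjI ballI)
    show "?\<theta>' \<in> carrier T \<rightarrow>\<^sub>E carrier S" using im by (auto intro: inv_into_into)
    fix x y assume "x \<in> carrier T" "y \<in> carrier T"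
    then obtain a b where ab: "a \<in> carrier S" "b \<in> carrier S" "x = \<theta> a" "y = \<theta> b" using im by blast
    then have "a \<otimes>\<^bsub>S\<^esub> b \<in> carrier S" "x \<otimes>\<^bsub>T\<^esub> y = \<theta> (a \<otimes>\<^bsub>S\<^esub> b)"
      using assms by (auto simp: in_Obj_LRS semigrp_def semigrp_hom_def)
    then show "?\<theta>' (x \<otimes>\<^bsub>T\<^esub> y) = ?\<theta>' x \<otimes>\<^bsub>S\<^esub> ?\<theta>' y"
      using inj ab im by (auto simp: inv_into_f_f)
  qed
  moreover have "compose (carrier S) ?\<theta>' \<theta> = (\<lambda>x\<in>carrier S. x)"
    using inj im by (auto simp: compose_def fun_eq_iff inv_into_f_f)
  moreover have "compose (carrier T) \<theta> ?\<theta>' = (\<lambda>x\<in>carrier T. x)"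
    using im by (auto simp: compose_def fun_eq_iff f_inv_into_f)
  ultimately show ?thesis
    using assms by (intro isoI[of _ S T "(T, ?\<theta>', S)"]) (auto simp: Hom_LRS)
qed

text \<open>Cones are functions on all objects, and a universe need not be closed under function
  spaces. But once an idempotent is chosen in each class, a cone is determined by its class and its
  component at the vertex of that idempotent, so a product suffices.\<close>

lemma (in conn_cat) T_lepoll: "\<Union>D \<lesssim> D \<times> Arr C"
proof -
  have "\<exists>c \<epsilon>. \<epsilon> \<in> d \<and> cone_at C c \<epsilon> \<and> \<epsilon> c = Ide C c" if d: "d \<in> D" for d
  proof -
    obtain \<gamma> where \<gamma>: "\<gamma> \<in> d" using cone_classes_nonempty[OF D_classes[OF d]] by blast
    then obtain z where z: "cone_at C z \<gamma>" using T_coneE d by blast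
    obtain c \<epsilon> where e: "cone_at C c \<epsilon>" "\<epsilon> c = Ide C c" "\<gamma> \<sqsubseteq> \<epsilon>" "\<epsilon> \<sqsubseteq> \<gamma>"
      using idempotent_below_aboveE[OF z] .
    then have "\<epsilon> \<in> d" using D_in[OF d \<gamma>] cone_class_iff[OF in_conesI[OF z]] in_conesI by blast
    then show ?thesis using e by blast
  qed
  then obtain c \<epsilon> where e: "\<And>d. d \<in> D \<Longrightarrow> \<epsilon> d \<in> d \<and> cone_at C (c d) (\<epsilon> d) \<and> \<epsilon> d (c d) = Ide C (c d)"
    by metis
  let ?f = "\<lambda>\<gamma>. (cone_class \<gamma>, \<gamma> (c (cone_class \<gamma>)))"
  have eq: "\<gamma> = cone_star C (\<epsilon> (cone_class \<gamma>)) (\<gamma> (c (cone_class \<gamma>)))" if \<gamma>: "\<gamma> \<in> \<Union>D" for \<gamma>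
  proof -
    obtain z where z: "cone_at C z \<gamma>" using T_coneE[OF \<gamma>] .
    note e = e[OF cone_class_D[OF \<gamma>]]
    have "\<gamma> \<sqsubseteq> \<epsilon> (cone_class \<gamma>)" using e cone_class_iff[OF in_conesI[OF z]] by blast
    then show ?thesis using cone_le_idempotent(1)[OF _ _ z] e by blast
  qed
  have "inj_on ?f (\<Union>D)"
  proof (rule inj_onI)
    fix \<gamma> \<delta> assume g: "\<gamma> \<in> \<Union>D" "\<delta> \<in> \<Union>D" and f: "?f \<gamma> = ?f \<delta>"
    have "cone_star C (\<epsilon> (cone_class \<gamma>)) (\<gamma> (c (cone_class \<gamma>))) =
        cone_star C (\<epsilon> (cone_class \<delta>)) (\<delta> (c (cone_class \<delta>)))"
      using f unfolding prod.inject by (elim conjE) (simp only:)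
    then show "\<gamma> = \<delta>" using eq[OF g(1)] eq[OF g(2)] by metis
  qed
  moreover have "?f ` \<Union>D \<subseteq> D \<times> Arr C"
  proof
    fix p assume "p \<in> ?f ` \<Union>D"
    then obtain \<gamma> where \<gamma>: "\<gamma> \<in> \<Union>D" "p = ?f \<gamma>" by blast
    obtain z where z: "cone_at C z \<gamma>" using T_coneE[OF \<gamma>(1)] .
    have "c (cone_class \<gamma>) \<in> Obj C" using e[OF cone_class_D[OF \<gamma>(1)]] cone_ObjD by blast
    then show "p \<in> D \<times> Arr C" using \<gamma> cone_class_D Hom_D(1)[OF cone_Hom[OF z]] by simp
  qed
  ultimately show ?thesis by (auto simp: lepoll_def)
qed

section \<open>Coding in the universe\<close>

lemma universe_times:
  assumes "universe U" "X \<in> U" "Y \<in> U" "A \<lesssim> X" "B \<lesssim> Y"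
  obtains Z where "Z \<in> U" "A \<times> B \<lesssim> Z"
proof -
  obtain Z where "Z \<in> U" "X \<times> Y \<lesssim> Z" using assms(1-3) unfolding universe_def by blast
  moreover have "A \<times> B \<lesssim> X \<times> Y" using times_lepoll_mono assms(4,5) by blast
  ultimately show ?thesis using that lepoll_trans by blast
qed

lemma universe_encode:
  assumes "universe U" "X \<in> U" "A \<lesssim> X"
  obtains e where "inj_on e A" "e ` A \<in> U"
proof -
  obtain e where "inj_on e A" "e ` A \<subseteq> X" using assms(3) by (auto simp: lepoll_def)
  moreover have "e ` A \<in> U"
    using assms(1,2) subset_imp_lepoll[OF \<open>e ` A \<subseteq> X\<close>] unfolding universe_def by blast
  ultimately show ?thesis using that by blast
qed

context
  fixes U :: "'u set set"
  assumes U: "universe U"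
begin

text \<open>The cones in \<open>\<Union>D\<close> are functions on \<open>'u\<close> and have to be encoded as elements of \<open>'u\<close>.\<close>

definition code :: "('u, 'u) ccat \<Rightarrow> ('u \<Rightarrow> 'u) \<Rightarrow> 'u" where
  "code X = (SOME e. inj_on e (carrier (down_set_semigrp X)) \<and> e ` carrier (down_set_semigrp X) \<in> U)"

lemma code:
  assumes "X \<in> Obj (CC U)"
  shows "inj_on (code X) (carrier (down_set_semigrp X))" "code X ` carrier (down_set_semigrp X) \<in> U"
proof -
  obtain C D where X: "X = (C, D)" by (cases X)
  interpret conn_cat C D using assms X by (simp add: conn_catI in_Obj_CC)
  obtain Z where Z: "Z \<in> U" "D \<lesssim> Z" and A: "Arr C \<in> U" using assms X by (auto simp: in_Obj_CC)
  obtain Y where "Y \<in> U" "D \<times> Arr C \<lesssim> Y"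
    using universe_times[OF U Z(1) A Z(2) lepoll_refl] .
  then obtain e where "inj_on e (\<Union>D)" "e ` \<Union>D \<in> U"
    using universe_encode[OF U] T_lepoll lepoll_trans by metis
  then have "\<exists>e. inj_on e (carrier (down_set_semigrp X)) \<and> e ` carrier (down_set_semigrp X) \<in> U"
    unfolding X down_set_semigrp_simps by blast
  from someI_ex[OF this] show "inj_on (code X) (carrier (down_set_semigrp X))"
    "code X ` carrier (down_set_semigrp X) \<in> U" by (simp_all add: code_def)
qed

definition decode :: "('u, 'u) ccat \<Rightarrow> 'u \<Rightarrow> ('u \<Rightarrow> 'u)" where
  "decode X = inv_into (carrier (down_set_semigrp X)) (code X)"

definition code_semigrp :: "('u, 'u) ccat \<Rightarrow> 'u semigrp" where
  "code_semigrp X = transport (code X) (down_set_semigrp X)"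

lemma decode_code:
  "X \<in> Obj (CC U) \<Longrightarrow> x \<in> carrier (down_set_semigrp X) \<Longrightarrow> decode X (code X x) = x"
  using code(1) by (simp add: decode_def inv_into_f_f)

lemma carrier_code_semigrp: "carrier (code_semigrp X) = code X ` carrier (down_set_semigrp X)"
  by (simp add: code_semigrp_def transport_def)

lemma down_set_semigrp_LRS:
  assumes "connected_category X"
  shows "semigrp (down_set_semigrp X)" "regular (down_set_semigrp X)" "left_reductive (down_set_semigrp X)"
proof -
  obtain C D where X: "X = (C, D)" by (cases X)
  interpret conn_cat C D using assms X by (simp add: conn_catI)
  show "semigrp (down_set_semigrp X)" "regular (down_set_semigrp X)" "left_reductive (down_set_semigrp X)"
    unfolding X by (fact T_semigrp T_regular T_left_reductive)+
qed

lemma code_semigrp_Obj: "X \<in> Obj (CC U) \<Longrightarrow> code_semigrp X \<in> Obj (LRS U)"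
  using code[of X] down_set_semigrp_LRS[of X] transport_semigrp transport_regular transport_left_reductive
  by (auto simp: in_Obj_LRS code_semigrp_def in_Obj_CC transport_simps(1))

definition code_hom :: "('u, 'u) ccat \<Rightarrow> ('u, 'u) ccat \<Rightarrow> (('u \<Rightarrow> 'u) \<Rightarrow> ('u \<Rightarrow> 'u)) \<Rightarrow> 'u \<Rightarrow> 'u" where
  "code_hom X Y \<phi> = (\<lambda>x\<in>carrier (code_semigrp X). code Y (\<phi> (decode X x)))"

definition decode_hom :: "('u, 'u) ccat \<Rightarrow> ('u, 'u) ccat \<Rightarrow> ('u \<Rightarrow> 'u) \<Rightarrow> ('u \<Rightarrow> 'u) \<Rightarrow> ('u \<Rightarrow> 'u)" where
  "decode_hom X Y \<psi> = (\<lambda>x\<in>carrier (down_set_semigrp X). decode Y (\<psi> (code X x)))"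

lemma code_mult:
  "X \<in> Obj (CC U) \<Longrightarrow> x \<in> carrier (down_set_semigrp X) \<Longrightarrow> y \<in> carrier (down_set_semigrp X) \<Longrightarrow>
    code X x \<otimes>\<^bsub>code_semigrp X\<^esub> code X y = code X (x \<otimes>\<^bsub>down_set_semigrp X\<^esub> y)"
  using code(1) by (simp add: code_semigrp_def transport_simps(2))

lemma code_hom:
  assumes X: "X \<in> Obj (CC U)" and Y: "Y \<in> Obj (CC U)"
    and \<phi>: "\<phi> \<in> semigrp_hom (down_set_semigrp X) (down_set_semigrp Y)"
  shows "code_hom X Y \<phi> \<in> semigrp_hom (code_semigrp X) (code_semigrp Y)"
    and "decode_hom X Y (code_hom X Y \<phi>) = \<phi>"
proof -
  have closed: "x \<otimes>\<^bsub>down_set_semigrp X\<^esub> y \<in> carrier (down_set_semigrp X)"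
    if "x \<in> carrier (down_set_semigrp X)" "y \<in> carrier (down_set_semigrp X)" for x y
    using down_set_semigrp_LRS(1)[of X] X that by (auto simp: in_Obj_CC semigrp_def)
  have h: "code_hom X Y \<phi> (code X x) = code Y (\<phi> x)" if "x \<in> carrier (down_set_semigrp X)" for x
    using that by (simp add: code_hom_def carrier_code_semigrp decode_code[OF X])
  show "code_hom X Y \<phi> \<in> semigrp_hom (code_semigrp X) (code_semigrp Y)"
    unfolding semigrp_hom_def
  proof (intro CollectI conjI ballI)
    show "code_hom X Y \<phi> \<in> carrier (code_semigrp X) \<rightarrow>\<^sub>E carrier (code_semigrp Y)"
      using h semigrp_hom_closed[OF \<phi>]
      by (auto simp: carrier_code_semigrp PiE_def extensional_def code_hom_def[of X Y \<phi>] decode_code[OF X])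
    fix x' y' assume "x' \<in> carrier (code_semigrp X)" "y' \<in> carrier (code_semigrp X)"
    then obtain x y where xy: "x \<in> carrier (down_set_semigrp X)" "y \<in> carrier (down_set_semigrp X)"
      "x' = code X x" "y' = code X y" by (auto simp: carrier_code_semigrp)
    then show "code_hom X Y \<phi> (x' \<otimes>\<^bsub>code_semigrp X\<^esub> y') =
        code_hom X Y \<phi> x' \<otimes>\<^bsub>code_semigrp Y\<^esub> code_hom X Y \<phi> y'"
      using \<phi> semigrp_hom_closed[OF \<phi>]
      by (simp add: code_mult[OF X] code_mult[OF Y] h closed) (simp add: semigrp_hom_def)
  qed
  show "decode_hom X Y (code_hom X Y \<phi>) = \<phi>"
  proof (rule extensionalityI[of _ "carrier (down_set_semigrp X)"])
    show "\<phi> \<in> extensional (carrier (down_set_semigrp X))" using \<phi> by (simp add: semigrp_hom_def PiE_def)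
    show "decode_hom X Y (code_hom X Y \<phi>) x = \<phi> x" if "x \<in> carrier (down_set_semigrp X)" for x
      using that h semigrp_hom_closed[OF \<phi>] by (simp add: decode_hom_def decode_code[OF Y])
  qed (simp add: decode_hom_def)
qed

text \<open>Together with \<open>code_hom\<close> this makes coding a bijection on homomorphisms, so
  full faithfulness only concerns \<open>hom_of_cc\<close>.\<close>

lemma decode_hom:
  assumes X: "X \<in> Obj (CC U)" and Y: "Y \<in> Obj (CC U)"
    and \<psi>: "\<psi> \<in> semigrp_hom (code_semigrp X) (code_semigrp Y)"
  shows "decode_hom X Y \<psi> \<in> semigrp_hom (down_set_semigrp X) (down_set_semigrp Y)"
    and "code_hom X Y (decode_hom X Y \<psi>) = \<psi>"
proof -
  have closed: "x \<otimes>\<^bsub>down_set_semigrp Z\<^esub> y \<in> carrier (down_set_semigrp Z)"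
    if "Z \<in> Obj (CC U)" "x \<in> carrier (down_set_semigrp Z)" "y \<in> carrier (down_set_semigrp Z)" for Z x y
    using down_set_semigrp_LRS(1)[of Z] that by (auto simp: in_Obj_CC semigrp_def)
  have h: "\<exists>y. y \<in> carrier (down_set_semigrp Y) \<and> \<psi> (code X x) = code Y y \<and> decode_hom X Y \<psi> x = y"
    if "x \<in> carrier (down_set_semigrp X)" for x
    using semigrp_hom_closed[OF \<psi>, of "code X x"] that
    by (auto simp: carrier_code_semigrp decode_hom_def decode_code[OF Y])
  show "decode_hom X Y \<psi> \<in> semigrp_hom (down_set_semigrp X) (down_set_semigrp Y)"
    unfolding semigrp_hom_def
  proof (intro CollectI conjI ballI)
    show "decode_hom X Y \<psi> \<in> carrier (down_set_semigrp X) \<rightarrow>\<^sub>E carrier (down_set_semigrp Y)"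
      using h by (auto simp: PiE_def extensional_def decode_hom_def)
    fix x y assume xy: "x \<in> carrier (down_set_semigrp X)" "y \<in> carrier (down_set_semigrp X)"
    show "decode_hom X Y \<psi> (x \<otimes>\<^bsub>down_set_semigrp X\<^esub> y) =
        decode_hom X Y \<psi> x \<otimes>\<^bsub>down_set_semigrp Y\<^esub> decode_hom X Y \<psi> y"
    proof -
      have "\<psi> (code X (x \<otimes>\<^bsub>down_set_semigrp X\<^esub> y)) = \<psi> (code X x) \<otimes>\<^bsub>code_semigrp Y\<^esub> \<psi> (code X y)"
        using \<psi> xy by (simp add: semigrp_hom_def code_mult[OF X, symmetric] carrier_code_semigrp)
      moreover obtain a b where ab: "a \<in> carrier (down_set_semigrp Y)" "\<psi> (code X x) = code Y a"
        "decode_hom X Y \<psi> x = a" "b \<in> carrier (down_set_semigrp Y)" "\<psi> (code X y) = code Y b"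
        "decode_hom X Y \<psi> y = b" using h[OF xy(1)] h[OF xy(2)] by blast
      ultimately have "\<psi> (code X (x \<otimes>\<^bsub>down_set_semigrp X\<^esub> y)) = code Y (a \<otimes>\<^bsub>down_set_semigrp Y\<^esub> b)"
        using code_mult[OF Y ab(1,4)] by simp
      then show ?thesis
        using closed[OF X xy] decode_code[OF Y closed[OF Y ab(1,4)]] ab(3,6) by (simp add: decode_hom_def)
    qed
  qed
  show "code_hom X Y (decode_hom X Y \<psi>) = \<psi>"
  proof (rule extensionalityI[of _ "carrier (code_semigrp X)"])
    show "\<psi> \<in> extensional (carrier (code_semigrp X))" using \<psi> by (simp add: semigrp_hom_def PiE_def)
    show "code_hom X Y (decode_hom X Y \<psi>) x = \<psi> x" if "x \<in> carrier (code_semigrp X)" for x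
      using that h by (auto simp: code_hom_def carrier_code_semigrp decode_code[OF X])
  qed (simp add: code_hom_def)
qed

definition code_functor :: "(('u, 'u) ccat, ('u, 'u) ccat \<times> ('u, 'u, 'u, 'u) cc_map \<times> ('u, 'u) ccat,
    'u semigrp, 'u semigrp \<times> ('u \<Rightarrow> 'u) \<times> 'u semigrp) functor_map" where
  "code_functor = \<lparr>on_Obj = code_semigrp,
     on_Arr = (\<lambda>(X, H, Y). (code_semigrp X, code_hom X Y (hom_of_cc X H), code_semigrp Y))\<rparr>"

lemma hom_of_cc_hom:
  assumes "connected_category X" "connected_category Y" "cc_morphism X Y H"
  shows "hom_of_cc X H \<in> semigrp_hom (down_set_semigrp X) (down_set_semigrp Y)"
proof -
  obtain C D C' D' F G where X: "X = (C, D)" "Y = (C', D')" "H = (F, G)" by (metis surj_pair)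
  interpret cc_mor C D C' D' F G using cc_mor_ccI assms X by simp
  show ?thesis using \<phi>_hom by (simp add: X \<phi>_def)
qed

lemma hom_of_cc_inject:
  assumes "connected_category X" "connected_category Y" "cc_morphism X Y H" "cc_morphism X Y K"
    and "hom_of_cc X H = hom_of_cc X K"
  shows "H = K"
proof -
  obtain C D where C: "X = (C, D)" by (cases X)
  obtain C' D' where C': "Y = (C', D')" by (cases Y)
  obtain F G where F: "H = (F, G)" by (cases H)
  obtain F' G' where F': "K = (F', G')" by (cases K)
  note X = C C' F F'
  interpret H: cc_mor C D C' D' F G using cc_mor_ccI assms X by simp
  interpret K: cc_mor C D C' D' F' G' using cc_mor_ccI assms X by simp
  show ?thesis using H.cc_of_hom_of_cc K.cc_of_hom_of_cc assms(5) unfolding X by metis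
qed

lemma hom_of_cc_surj:
  assumes "connected_category X" "connected_category Y"
    "\<phi> \<in> semigrp_hom (down_set_semigrp X) (down_set_semigrp Y)"
  obtains H where "cc_morphism X Y H" "hom_of_cc X H = \<phi>"
proof -
  obtain C D C' D' where X: "X = (C, D)" "Y = (C', D')" by (metis surj_pair)
  interpret A: conn_cat C D using assms X by (simp add: conn_catI)
  interpret B: conn_cat C' D' using assms X by (simp add: conn_catI)
  interpret hom_mor C D C' D' \<phi> by unfold_locales (use assms X in simp)
  show ?thesis using that cc_morphism_cc_of_hom hom_of_cc_of_hom by (simp add: X)
qed

lemma code_functor_is_functor: "is_functor (CC U) (LRS U) code_functor"
proof (rule is_functorI)
  show "category (CC U)" "category (LRS U)" by (fact category_CC category_LRS)+
  show "on_Obj code_functor X \<in> Obj (LRS U)" if "X \<in> Obj (CC U)" for X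
    using code_semigrp_Obj that by (simp add: code_functor_def)
  show "on_Arr code_functor f \<in> Hom (LRS U) (on_Obj code_functor X) (on_Obj code_functor Y)"
    if f: "f \<in> Hom (CC U) X Y" for f X Y
  proof -
    obtain H where H: "f = (X, H, Y)" "cc_morphism X Y H" and O: "X \<in> Obj (CC U)" "Y \<in> Obj (CC U)"
      using f unfolding Hom_CC by blast
    have "hom_of_cc X H \<in> semigrp_hom (down_set_semigrp X) (down_set_semigrp Y)"
      using hom_of_cc_hom[OF _ _ H(2)] O by (simp add: in_Obj_CC)
    then show ?thesis
      using code_hom(1)[OF O] code_semigrp_Obj O H(1) by (simp add: code_functor_def Hom_LRS)
  qed
  show "on_Arr code_functor (Ide (CC U) X) = Ide (LRS U) (on_Obj code_functor X)"
    if X: "X \<in> Obj (CC U)" for X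
  proof -
    obtain C D where c: "X = (C, D)" by (cases X)
    have "hom_of_cc X (cc_id X) = (\<lambda>x\<in>carrier (down_set_semigrp X). x)"
      using hom_of_cc_id[of C D] X unfolding c by (simp add: in_Obj_CC)
    then have "code_hom X X (hom_of_cc X (cc_id X)) x = (\<lambda>x\<in>carrier (code_semigrp X). x) x" for x
      by (auto simp: code_hom_def carrier_code_semigrp decode_code[OF X])
    then show ?thesis by (simp add: code_functor_def fun_eq_iff)
  qed
  show "on_Arr code_functor (f \<cdot>\<^bsub>CC U\<^esub> g) = on_Arr code_functor f \<cdot>\<^bsub>LRS U\<^esub> on_Arr code_functor g"
    if fg: "f \<in> Hom (CC U) X Y" "g \<in> Hom (CC U) Y Z" for f g X Y Z
  proof -
    obtain H K where HK: "f = (X, H, Y)" "g = (Y, K, Z)" "cc_morphism X Y H" "cc_morphism Y Z K"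
      and O: "X \<in> Obj (CC U)" "Y \<in> Obj (CC U)" "Z \<in> Obj (CC U)" using fg by (auto simp: Hom_CC)
    obtain C D C' D' C'' D'' where c: "X = (C, D)" "Y = (C', D')" "Z = (C'', D'')" by (metis surj_pair)
    have comp: "hom_of_cc X (cc_comp X H K) =
        compose (carrier (down_set_semigrp X)) (hom_of_cc Y K) (hom_of_cc X H)"
      using hom_of_cc_comp[of C D C' D' C'' D'' H K] HK O by (simp add: c in_Obj_CC)
    have "hom_of_cc X H x \<in> carrier (down_set_semigrp Y)" if "x \<in> carrier (down_set_semigrp X)" for x
      using semigrp_hom_closed[OF hom_of_cc_hom[OF _ _ HK(3)] that] O by (simp add: in_Obj_CC)
    then show ?thesis
      by (auto simp: HK code_functor_def comp code_hom_def compose_def fun_eq_iff carrier_code_semigrp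
          decode_code[OF O(1)] decode_code[OF O(2)])
  qed
qed

text \<open>Fullness and faithfulness come from \<open>hom_of_cc\<close>; a representation of
  \<open>S\<close> by uncoded cones gives essential surjectivity once it is composed with the
  coding.\<close>

lemma equivalent_if_representable:
  assumes "\<And>S. S \<in> Obj (LRS U) \<Longrightarrow> \<exists>X\<in>Obj (CC U). \<exists>\<theta>. bij_betw \<theta> (carrier S) (carrier (down_set_semigrp X)) \<and>
      (\<forall>x\<in>carrier S. \<forall>y\<in>carrier S. \<theta> (x \<otimes>\<^bsub>S\<^esub> y) = \<theta> x \<otimes>\<^bsub>down_set_semigrp X\<^esub> \<theta> y)"
  shows "equivalent_categories (LRS U) (CC U)"
proof (rule equivalent_categories_if_fully_faithful[OF code_functor_is_functor])
  fix X Y g assume X: "X \<in> Obj (CC U)" and Y: "Y \<in> Obj (CC U)"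
    and g: "g \<in> Hom (LRS U) (on_Obj code_functor X) (on_Obj code_functor Y)"
  obtain \<psi> where \<psi>: "g = (code_semigrp X, \<psi>, code_semigrp Y)"
    "\<psi> \<in> semigrp_hom (code_semigrp X) (code_semigrp Y)"
    using g by (auto simp: Hom_LRS code_functor_def)
  obtain H where H: "cc_morphism X Y H" "hom_of_cc X H = decode_hom X Y \<psi>"
    using hom_of_cc_surj[OF _ _ decode_hom(1)[OF X Y \<psi>(2)]] X Y by (auto simp: in_Obj_CC)
  have "(X, H, Y) \<in> Hom (CC U) X Y" using H X Y by (simp add: Hom_CC)
  moreover have "on_Arr code_functor (X, H, Y) = g"
    using H decode_hom(2)[OF X Y \<psi>(2)] \<psi>(1) by (simp add: code_functor_def)
  ultimately show "\<exists>f\<in>Hom (CC U) X Y. on_Arr code_functor f = g" by blast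
next
  fix X Y f f' assume f: "f \<in> Hom (CC U) X Y" "f' \<in> Hom (CC U) X Y"
    and eq: "on_Arr code_functor f = on_Arr code_functor f'"
  obtain H K where HK: "f = (X, H, Y)" "f' = (X, K, Y)" "cc_morphism X Y H" "cc_morphism X Y K"
    and O: "X \<in> Obj (CC U)" "Y \<in> Obj (CC U)" using f by (auto simp: Hom_CC)
  have c: "connected_category X" "connected_category Y" using O by (simp_all add: in_Obj_CC)
  have "code_hom X Y (hom_of_cc X H) = code_hom X Y (hom_of_cc X K)"
    using eq by (simp add: HK code_functor_def)
  then have "hom_of_cc X H = hom_of_cc X K"
    using code_hom(2)[OF O hom_of_cc_hom[OF c HK(3)]] code_hom(2)[OF O hom_of_cc_hom[OF c HK(4)]] by metis
  then show "f = f'" using hom_of_cc_inject[OF c HK(3,4)] HK by simp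
next
  fix S assume S: "S \<in> Obj (LRS U)"
  obtain X \<theta> where X: "X \<in> Obj (CC U)" and bij: "bij_betw \<theta> (carrier S) (carrier (down_set_semigrp X))"
    and hom: "\<And>x y. x \<in> carrier S \<Longrightarrow> y \<in> carrier S \<Longrightarrow> \<theta> (x \<otimes>\<^bsub>S\<^esub> y) = \<theta> x \<otimes>\<^bsub>down_set_semigrp X\<^esub> \<theta> y"
    using assms[OF S] by blast
  let ?h = "\<lambda>x\<in>carrier S. code X (\<theta> x)"
  have \<theta>: "\<theta> x \<in> carrier (down_set_semigrp X)" if "x \<in> carrier S" for x
    using bij that by (rule bij_betw_apply)
  have "x \<otimes>\<^bsub>S\<^esub> y \<in> carrier S" if "x \<in> carrier S" "y \<in> carrier S" for x y
    using S that by (simp add: in_Obj_LRS semigrp_def)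
  then have h: "?h \<in> semigrp_hom S (code_semigrp X)"
    unfolding semigrp_hom_def using \<theta> hom by (auto simp: carrier_code_semigrp code_mult[OF X])
  have "bij_betw (code X) (carrier (down_set_semigrp X)) (carrier (code_semigrp X))"
    using code(1)[OF X] by (simp add: bij_betw_def carrier_code_semigrp)
  from bij_betw_trans[OF bij this] have "bij_betw ?h (carrier S) (carrier (code_semigrp X))"
    by (subst bij_betw_cong[of _ _ "code X \<circ> \<theta>"]) auto
  then have "iso (LRS U) (S, ?h, code_semigrp X)"
    by (rule LRS_isoI[OF S code_semigrp_Obj[OF X] h])
  moreover have "(S, ?h, code_semigrp X) \<in> Hom (LRS U) S (on_Obj code_functor X)"
    using S code_semigrp_Obj[OF X] h by (simp add: Hom_LRS code_functor_def)
  ultimately show "\<exists>X\<in>Obj (CC U). \<exists>h\<in>Hom (LRS U) S (on_Obj code_functor X). iso (LRS U) h"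
    using X by blast
qed

end

section \<open>The connected category of a left reductive regular semigroup\<close>

text \<open>An element \<open>u\<close> does not determine the domain and codomain of a translation,
  so arrows are triples; \<open>arr\<close> codes them injectively in a type of choice, so that in
  the application they lie in the universe.\<close>

locale lrs_semigrp =
  fixes S :: "'a semigrp" (structure) and arr :: "'a \<times> 'a \<times> 'a \<Rightarrow> 'm"
  assumes semigrp: "semigrp S" and regular: "regular S" and left_reductive: "left_reductive S"
    and inj_arr: "inj_on arr (carrier S \<times> carrier S \<times> carrier S)"
begin

lemma closed [simp, intro]: "x \<in> carrier S \<Longrightarrow> y \<in> carrier S \<Longrightarrow> x \<otimes> y \<in> carrier S"
  using semigrp by (simp add: semigrp_def)

lemma assoc: "x \<in> carrier S \<Longrightarrow> y \<in> carrier S \<Longrightarrow> z \<in> carrier S \<Longrightarrow> (x \<otimes> y) \<otimes> z = x \<otimes> (y \<otimes> z)"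
  using semigrp by (simp add: semigrp_def)

text \<open>Products are normalised to the right by \<open>assoc\<close>, and then
  \<open>x \<otimes> y = z\<close> no longer matches inside
  \<open>x \<otimes> (y \<otimes> w)\<close>. This rule and the next make such relations usable for
  rewriting again.\<close>

lemma absorb:
  "x \<otimes> y = z \<Longrightarrow> x \<in> carrier S \<Longrightarrow> y \<in> carrier S \<Longrightarrow> w \<in> carrier S \<Longrightarrow> x \<otimes> (y \<otimes> w) = z \<otimes> w"
  using assoc[of x y w] by simp

lemma absorb2:
  "x \<otimes> (y \<otimes> z) = w \<Longrightarrow> x \<in> carrier S \<Longrightarrow> y \<in> carrier S \<Longrightarrow> z \<in> carrier S \<Longrightarrow> v \<in> carrier S \<Longrightarrow>
    x \<otimes> (y \<otimes> (z \<otimes> v)) = w \<otimes> v"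
  using assoc[of x "y \<otimes> z" v] assoc[of y z v] by simp

section \<open>Idempotent generators of left ideals\<close>

lemma inverseE:
  assumes "a \<in> carrier S"
  obtains x where "x \<in> carrier S" "a \<otimes> (x \<otimes> a) = a"
proof -
  obtain x where "x \<in> carrier S" "(a \<otimes> x) \<otimes> a = a" using regular assms unfolding regular_def by blast
  then show ?thesis using that assoc assms by simp
qed

text \<open>By regularity \<open>a\<close> belongs to \<open>S a\<close>, so it need not be
  adjoined.\<close>

definition left_ideal :: "'a \<Rightarrow> 'a set" where
  "left_ideal a = (\<lambda>x. x \<otimes> a) ` carrier S"

text \<open>The choice depends only on the left ideal, so elements generating the same left ideal
  share their representative. This makes the inclusions antisymmetric.\<close>

definition rep :: "'a \<Rightarrow> 'a" where
  "rep a = (SOME e. e \<in> carrier S \<and> e \<otimes> e = e \<and> left_ideal e = left_ideal a)"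

lemma left_ideal_subset: "b \<in> carrier S \<Longrightarrow> a \<in> left_ideal b \<Longrightarrow> left_ideal a \<subseteq> left_ideal b"
  by (auto simp: left_ideal_def assoc[symmetric])

lemma left_ideal_self: "a \<in> carrier S \<Longrightarrow> a \<in> left_ideal a"
  using inverseE[of a] assoc unfolding left_ideal_def by (metis closed image_eqI)

text \<open>If \<open>a \<otimes> (x \<otimes> a) = a\<close>, then \<open>x \<otimes> a\<close> is
  an idempotent generating the same left ideal as \<open>a\<close>.\<close>

lemma ex_rep:
  assumes "a \<in> carrier S"
  shows "\<exists>e. e \<in> carrier S \<and> e \<otimes> e = e \<and> left_ideal e = left_ideal a"
proof -
  obtain x where x: "x \<in> carrier S" "a \<otimes> (x \<otimes> a) = a" using inverseE[OF assms] .
  have "a \<in> left_ideal (x \<otimes> a)" using x assms by (auto simp: left_ideal_def intro: image_eqI[of _ _ a])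
  moreover have "x \<otimes> a \<in> left_ideal a" using x by (auto simp: left_ideal_def)
  ultimately have "left_ideal (x \<otimes> a) = left_ideal a"
    using left_ideal_subset x(1) assms by (meson closed subset_antisym)
  moreover have "(x \<otimes> a) \<otimes> (x \<otimes> a) = x \<otimes> a" using x assms by (simp add: assoc)
  ultimately show ?thesis using x(1) assms by blast
qed

lemma rep_props:
  assumes "a \<in> carrier S"
  shows rep_closed [simp]: "rep a \<in> carrier S" and rep_idem [simp]: "rep a \<otimes> rep a = rep a"
    and left_ideal_rep: "left_ideal (rep a) = left_ideal a"
  using someI_ex[OF ex_rep[OF assms]] unfolding rep_def by auto

lemma mult_rep [simp]:
  assumes "a \<in> carrier S"
  shows "a \<otimes> rep a = a"
proof -
  have "a \<in> left_ideal (rep a)" using left_ideal_self[OF assms] left_ideal_rep[OF assms] by simp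
  then obtain y where "y \<in> carrier S" "a = y \<otimes> rep a" by (auto simp: left_ideal_def)
  then show ?thesis using assms rep_idem assoc by (metis rep_closed)
qed

lemma repE:
  assumes "a \<in> carrier S"
  obtains y where "y \<in> carrier S" "rep a = y \<otimes> a"
  using left_ideal_self[OF rep_closed[OF assms]] left_ideal_rep[OF assms] by (auto simp: left_ideal_def)

lemma rep_eqI:
  assumes "a \<in> carrier S" "b \<in> carrier S" "x \<in> carrier S" "y \<in> carrier S" "a = x \<otimes> b" "b = y \<otimes> a"
  shows "rep a = rep b"
proof -
  have "a \<in> left_ideal b" "b \<in> left_ideal a" using assms(3-6) by (auto simp: left_ideal_def)
  then have "left_ideal a = left_ideal b" using left_ideal_subset assms(1,2) by blast
  then show ?thesis by (simp add: rep_def)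
qed

text \<open>\<open>rep a\<close> is a left multiple of \<open>a\<close>, so it inherits right
  identities.\<close>

lemma rep_mult_right: 
  assumes "a \<in> carrier S" "f \<in> carrier S" "a \<otimes> f = a"
  shows "rep a \<otimes> f = rep a"
proof -
  obtain y where "y \<in> carrier S" "rep a = y \<otimes> a" using repE[OF assms(1)] .
  then show ?thesis using assms by (simp add: assoc)
qed

definition reps :: "'a set" where
  "reps = rep ` carrier S"

lemma reps:
  assumes "c \<in> reps"
  shows "c \<in> carrier S" "c \<otimes> c = c" "rep c = c"
proof -
  obtain a where a: "a \<in> carrier S" "c = rep a" using assms by (auto simp: reps_def)
  then show "c \<in> carrier S" "c \<otimes> c = c" by simp_all
  show "rep c = c" using a left_ideal_rep[OF a(1)] unfolding rep_def by simp
qed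

lemma rep_in [simp]: "a \<in> carrier S \<Longrightarrow> rep a \<in> reps"
  by (simp add: reps_def)

lemma reps_antisym:
  assumes "c \<in> reps" "d \<in> reps" "c \<otimes> d = c" "d \<otimes> c = d"
  shows "c = d"
  using rep_eqI[of c d c d] reps assms by simp

section \<open>The category of left ideals\<close>

definition unarr :: "'m \<Rightarrow> 'a \<times> 'a \<times> 'a" where
  "unarr = inv_into (carrier S \<times> carrier S \<times> carrier S) arr"

lemma unarr [simp]:
  "e \<in> carrier S \<Longrightarrow> u \<in> carrier S \<Longrightarrow> f \<in> carrier S \<Longrightarrow> unarr (arr (e, u, f)) = (e, u, f)"
  using inj_arr by (simp add: unarr_def inv_into_f_f)

text \<open>
  The left ideals \<open>S e\<close> are represented by the idempotents in \<open>reps\<close>, and the right translation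
  \<open>S e \<rightarrow> S f\<close> by an element \<open>u \<in> e S f\<close> is represented by the code of \<open>(e, u, f)\<close>.
\<close>

definition L :: "('a, 'm) scat" where
  "L = \<lparr>Obj = reps,
     Arr = arr ` {(e, u, f). e \<in> reps \<and> f \<in> reps \<and> u \<in> carrier S \<and> e \<otimes> u = u \<and> u \<otimes> f = u},
     Dom = (\<lambda>m. fst (unarr m)), Cod = (\<lambda>m. snd (snd (unarr m))), Ide = (\<lambda>e. arr (e, e, e)),
     Comp = (\<lambda>m n. arr (fst (unarr m), fst (snd (unarr m)) \<otimes> fst (snd (unarr n)), snd (snd (unarr n)))),
     Incl = arr ` {(e, u, f). e \<in> reps \<and> f \<in> reps \<and> u = e \<and> e \<otimes> f = e}\<rparr>"

lemma L_simps [simp]: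
  "Obj L = reps" "Ide L e = arr (e, e, e)"
  "e \<in> carrier S \<Longrightarrow> u \<in> carrier S \<Longrightarrow> f \<in> carrier S \<Longrightarrow> Dom L (arr (e, u, f)) = e"
  "e \<in> carrier S \<Longrightarrow> u \<in> carrier S \<Longrightarrow> f \<in> carrier S \<Longrightarrow> Cod L (arr (e, u, f)) = f"
  "e \<in> carrier S \<Longrightarrow> u \<in> carrier S \<Longrightarrow> f \<in> carrier S \<Longrightarrow>
    f' \<in> carrier S \<Longrightarrow> v \<in> carrier S \<Longrightarrow> g \<in> carrier S \<Longrightarrow>
    arr (e, u, f) \<cdot>\<^bsub>L\<^esub> arr (f', v, g) = arr (e, u \<otimes> v, g)"
  by (simp_all add: L_def)

lemma arr_eq_iff:
  "e \<in> carrier S \<Longrightarrow> u \<in> carrier S \<Longrightarrow> f \<in> carrier S \<Longrightarrow>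
    e' \<in> carrier S \<Longrightarrow> u' \<in> carrier S \<Longrightarrow> f' \<in> carrier S \<Longrightarrow>
    arr (e, u, f) = arr (e', u', f') \<longleftrightarrow> e = e' \<and> u = u' \<and> f = f'"
  using unarr by (metis prod.inject)

lemma Hom_L:
  "m \<in> Hom L e f \<longleftrightarrow> e \<in> reps \<and> f \<in> reps \<and>
    (\<exists>u\<in>carrier S. e \<otimes> u = u \<and> u \<otimes> f = u \<and> m = arr (e, u, f))"
  by (auto simp: Hom_def L_def reps)

lemma Incl_L: "j \<in> Incl L \<longleftrightarrow> (\<exists>e f. e \<in> reps \<and> f \<in> reps \<and> e \<otimes> f = e \<and> j = arr (e, e, f))"
  by (auto simp: L_def)

lemma Hom_LI:
  "e \<in> reps \<Longrightarrow> f \<in> reps \<Longrightarrow> u \<in> carrier S \<Longrightarrow> e \<otimes> u = u \<Longrightarrow> u \<otimes> f = u \<Longrightarrow> arr (e, u, f) \<in> Hom L e f"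
  by (auto simp: Hom_L)

lemma Incl_LI: "e \<in> reps \<Longrightarrow> f \<in> reps \<Longrightarrow> e \<otimes> f = e \<Longrightarrow> arr (e, e, f) \<in> Incl L"
  by (auto simp: Incl_L)

lemma category_L: "category L"
proof (rule categoryI)
  show "Dom L m \<in> Obj L \<and> Cod L m \<in> Obj L" if "m \<in> Arr L" for m
    using that by (auto simp: L_def reps)
  show "Ide L e \<in> Hom L e e" if "e \<in> Obj L" for e
    using that reps by (auto simp: Hom_L)
  show "m \<cdot>\<^bsub>L\<^esub> n \<in> Hom L e g" if "m \<in> Hom L e f" "n \<in> Hom L f g" for m n e f g
  proof -
    obtain u v where "e \<in> reps" "f \<in> reps" "g \<in> reps" "u \<in> carrier S" "e \<otimes> u = u" "m = arr (e, u, f)"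
      "v \<in> carrier S" "v \<otimes> g = v" "n = arr (f, v, g)" using \<open>m \<in> _\<close> \<open>n \<in> _\<close> by (auto simp: Hom_L)
    then show ?thesis by (auto simp: Hom_L reps assoc absorb intro!: bexI[of _ "u \<otimes> v"])
  qed
  show "Ide L e \<cdot>\<^bsub>L\<^esub> m = m \<and> m \<cdot>\<^bsub>L\<^esub> Ide L f = m" if "m \<in> Hom L e f" for m e f
    using that by (auto simp: Hom_L reps)
  show "(m \<cdot>\<^bsub>L\<^esub> n) \<cdot>\<^bsub>L\<^esub> p = m \<cdot>\<^bsub>L\<^esub> (n \<cdot>\<^bsub>L\<^esub> p)"
    if "m \<in> Hom L e f" "n \<in> Hom L f g" "p \<in> Hom L g h" for m n p e f g h
    using that by (auto simp: Hom_L reps assoc)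
qed

lemma category_incl_L: "category (incl_cat L)"
proof (rule categoryI)
  have I: "j \<in> Hom (incl_cat L) e f \<longleftrightarrow> e \<in> reps \<and> f \<in> reps \<and> e \<otimes> f = e \<and> j = arr (e, e, f)" for j e f
    by (auto simp: Hom_def incl_cat_def Incl_L reps)
  have s: "Obj (incl_cat L) = reps" "Ide (incl_cat L) = Ide L" "Comp (incl_cat L) = Comp L"
    by (simp_all add: incl_cat_def)
  show "Dom (incl_cat L) m \<in> Obj (incl_cat L) \<and> Cod (incl_cat L) m \<in> Obj (incl_cat L)"
    if "m \<in> Arr (incl_cat L)" for m
    using that by (auto simp: incl_cat_def Incl_L reps)
  show "Ide (incl_cat L) e \<in> Hom (incl_cat L) e e" if "e \<in> Obj (incl_cat L)" for e
    using that reps by (auto simp: I s)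
  show "m \<cdot>\<^bsub>incl_cat L\<^esub> n \<in> Hom (incl_cat L) e g"
    if "m \<in> Hom (incl_cat L) e f" "n \<in> Hom (incl_cat L) f g" for m n e f g
    using that assoc[of e f g] by (auto simp: I s reps)
  show "Ide (incl_cat L) e \<cdot>\<^bsub>incl_cat L\<^esub> m = m \<and> m \<cdot>\<^bsub>incl_cat L\<^esub> Ide (incl_cat L) f = m"
    if "m \<in> Hom (incl_cat L) e f" for m e f
    using that by (auto simp: I s reps)
  show "(m \<cdot>\<^bsub>incl_cat L\<^esub> n) \<cdot>\<^bsub>incl_cat L\<^esub> p = m \<cdot>\<^bsub>incl_cat L\<^esub> (n \<cdot>\<^bsub>incl_cat L\<^esub> p)"
    if "m \<in> Hom (incl_cat L) e f" "n \<in> Hom (incl_cat L) f g" "p \<in> Hom (incl_cat L) g h" for m n p e f g h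
    using that assoc[of e f g] by (auto simp: I s reps)
qed

text \<open>An arrow into \<open>e\<close> is given by some \<open>u\<close> with
  \<open>u \<otimes> e = u\<close>, so composing it with an inclusion of \<open>e\<close> changes
  only the recorded codomain. Hence inclusions are monic, and a left factor of an inclusion through
  an inclusion is one as well.\<close>

lemma category_with_subobjects_L: "category_with_subobjects L"
proof -
  have "strict_preorder (incl_cat L)"
    unfolding strict_preorder_def
  proof (intro conjI ballI allI impI category_incl_L)
    fix m n assume "m \<in> Arr (incl_cat L)" "n \<in> Arr (incl_cat L)"
      "Dom (incl_cat L) m = Dom (incl_cat L) n" "Cod (incl_cat L) m = Cod (incl_cat L) n"
    then show "m = n" by (auto simp: incl_cat_def Incl_L reps)
  next
    fix m assume "iso (incl_cat L) m"
    then obtain n where mn: "m \<in> Incl L" "n \<in> Incl L" "Dom L n = Cod L m" "Cod L n = Dom L m"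
      by (auto simp: iso_def incl_cat_def Hom_def)
    then obtain e f where m: "e \<in> reps" "f \<in> reps" "e \<otimes> f = e" "m = arr (e, e, f)"
      unfolding Incl_L by blast
    with mn have n: "n \<in> Incl L" "Dom L n = f" "Cod L n = e" by (simp_all add: reps)
    then have "f \<otimes> e = f" by (auto simp: Incl_L reps)
    then have "e = f" using reps_antisym m by blast
    then show "m = Ide (incl_cat L) (Dom (incl_cat L) m)" using m by (simp add: incl_cat_def reps)
  qed
  moreover have "Incl L \<subseteq> Arr L" by (auto simp: L_def reps)
  moreover have "monic L j" if "j \<in> Incl L" for j
  proof -
    obtain e f where j: "e \<in> reps" "f \<in> reps" "e \<otimes> f = e" "j = arr (e, e, f)"
      using \<open>j \<in> Incl L\<close> by (auto simp: Incl_L)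
    have "m = n" if mn: "m \<in> Arr L" "n \<in> Arr L" "Cod L m = Dom L j" "Cod L n = Dom L j" "m \<cdot>\<^bsub>L\<^esub> j = n \<cdot>\<^bsub>L\<^esub> j" for m n
    proof -
      have "m \<in> Hom L (Dom L m) e" "n \<in> Hom L (Dom L n) e" using mn j by (auto simp: Hom_def reps)
      then obtain u v where "Dom L m \<in> reps" "Dom L n \<in> reps"
        "u \<in> carrier S" "u \<otimes> e = u" "m = arr (Dom L m, u, e)"
        "v \<in> carrier S" "v \<otimes> e = v" "n = arr (Dom L n, v, e)" unfolding Hom_L by blast
      moreover from this have "arr (Dom L m, u \<otimes> e, f) = arr (Dom L n, v \<otimes> e, f)"
        using mn(5) j by (metis L_simps(5) reps(1))
      ultimately show ?thesis using j by (simp add: arr_eq_iff reps)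
    qed
    moreover have "j \<in> Arr L" using \<open>Incl L \<subseteq> Arr L\<close> \<open>j \<in> Incl L\<close> by blast
    ultimately show ?thesis unfolding monic_def by blast
  qed
  moreover have "h \<in> Incl L"
    if "m \<in> Incl L" "g \<in> Incl L" "h \<in> Arr L" "Cod L h = Dom L g" "m = h \<cdot>\<^bsub>L\<^esub> g" for m g h
  proof -
    obtain f k where g: "f \<in> reps" "k \<in> reps" "f \<otimes> k = f" "g = arr (f, f, k)"
      using \<open>g \<in> Incl L\<close> by (auto simp: Incl_L)
    have "h \<in> Hom L (Dom L h) f" using \<open>h \<in> Arr L\<close> \<open>Cod L h = _\<close> g by (auto simp: Hom_def reps)
    then obtain e u where h: "e \<in> reps" "u \<in> carrier S" "u \<otimes> f = u" "h = arr (e, u, f)"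
      unfolding Hom_L by blast
    then have "m = arr (e, u, k)" using \<open>m = _\<close> g by (simp add: reps)
    then have "u = e" using \<open>m \<in> Incl L\<close> h g by (auto simp: Incl_L arr_eq_iff reps)
    then show ?thesis using h g by (auto simp: Incl_L)
  qed
  ultimately show ?thesis unfolding category_with_subobjects_def using category_L by blast
qed

text \<open>The element \<open>v\<close> need not belong to \<open>f S e\<close>; trimming it to
  \<open>f \<otimes> (v \<otimes> e)\<close> yields the inverse arrow.\<close>

lemma iso_L:
  assumes "e \<in> reps" "f \<in> reps" "u \<in> carrier S" "e \<otimes> u = u" "u \<otimes> f = u"
    "v \<in> carrier S" "u \<otimes> v = e" "v \<otimes> u = f"
  shows "iso L (arr (e, u, f))"
proof -
  interpret category_locale L by unfold_locales (rule category_L)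
  note r = reps[OF assms(1)] reps[OF assms(2)]
  have 1: "u \<otimes> (f \<otimes> (v \<otimes> e)) = e" "f \<otimes> (v \<otimes> (e \<otimes> u)) = f"
    using assms r absorb[of u f u] absorb[of u v e] by simp_all
  show ?thesis
  proof (rule isoI)
    show "arr (e, u, f) \<in> Hom L e f" using assms by (auto simp: Hom_L)
    show "arr (f, f \<otimes> (v \<otimes> e), e) \<in> Hom L f e"
      using assms r by (auto simp: Hom_L assoc absorb[of f f] intro!: bexI[of _ "f \<otimes> (v \<otimes> e)"])
    show "arr (e, u, f) \<cdot>\<^bsub>L\<^esub> arr (f, f \<otimes> (v \<otimes> e), e) = Ide L e"
      "arr (f, f \<otimes> (v \<otimes> e), e) \<cdot>\<^bsub>L\<^esub> arr (e, u, f) = Ide L f"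
      using assms r 1 by (simp_all add: assoc)
  qed
qed

section \<open>Principal cones and normality\<close>

definition rho :: "'a \<Rightarrow> 'a \<Rightarrow> 'm" where
  "rho a = (\<lambda>c\<in>reps. arr (c, c \<otimes> a, rep a))"

lemma rho_cone:
  assumes a: "a \<in> carrier S"
  shows "cone_at L (rep a) (rho a)"
proof -
  obtain x where x: "x \<in> carrier S" "a \<otimes> (x \<otimes> a) = a" using inverseE[OF a] .
  \<comment> \<open>The idempotent \<open>g\<close> generates the same right ideal as
    \<open>a\<close>, so right multiplication by \<open>a\<close> maps \<open>S g\<close>
    bijectively onto \<open>S a\<close>, with inverse given by \<open>x \<otimes> g\<close>. The
    component at \<open>rep g\<close> is therefore invertible.\<close>
  define g where "g = a \<otimes> x"
  have g: "g \<in> carrier S" "g \<otimes> g = g" "g \<otimes> a = a" using a x by (simp_all add: g_def assoc absorb2[OF x(2)])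
  obtain y where y: "y \<in> carrier S" "rep g = y \<otimes> g" using repE[OF g(1)] .
  obtain z where z: "z \<in> carrier S" "rep a = z \<otimes> a" using repE[OF a] .
  have cg: "rep g \<otimes> g = rep g" by (rule rep_mult_right[OF g(1,1,2)])
  have "iso L (arr (rep g, rep g \<otimes> a, rep a))"
  proof (rule iso_L)
    show "rep a \<otimes> (x \<otimes> g) \<in> carrier S" using a x g by simp
    have "(rep g \<otimes> a) \<otimes> (rep a \<otimes> (x \<otimes> g)) = rep g \<otimes> (g \<otimes> g)"
      using a x g by (simp add: assoc absorb[OF mult_rep]) (simp add: g_def assoc)
    then show "(rep g \<otimes> a) \<otimes> (rep a \<otimes> (x \<otimes> g)) = rep g" using g cg by simp
    have "(rep a \<otimes> (x \<otimes> g)) \<otimes> (rep g \<otimes> a) = rep a \<otimes> (x \<otimes> a)"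
      using a x g by (simp add: assoc absorb[OF mult_rep])
    also have "\<dots> = z \<otimes> (a \<otimes> (x \<otimes> a))" using z a x by (simp add: assoc)
    finally show "(rep a \<otimes> (x \<otimes> g)) \<otimes> (rep g \<otimes> a) = rep a" using x z by simp
  qed (use a g in \<open>simp_all add: assoc absorb\<close>)
  then have "\<exists>c\<in>reps. iso L (rho a c)" using g by (intro bexI[of _ "rep g"]) (simp_all add: rho_def)
  moreover have "j \<cdot>\<^bsub>L\<^esub> rho a (Cod L j) = rho a (Dom L j)" if "j \<in> Incl L" for j
    using that a by (auto simp: Incl_L rho_def reps absorb)
  moreover have "rho a \<in> (\<Pi>\<^sub>E c\<in>reps. Hom L c (rep a))"
    using a by (auto simp: rho_def reps assoc absorb intro!: Hom_LI)
  ultimately show ?thesis using a by (simp add: cone_at_def)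
qed

lemma normal_L: "normal_category L"
  unfolding normal_category_def
proof (intro conjI ballI category_with_subobjects_L)
  fix j assume "j \<in> Incl L"
  then obtain e f where j: "e \<in> reps" "f \<in> reps" "e \<otimes> f = e" "j = arr (e, e, f)" by (auto simp: Incl_L)
  \<comment> \<open>Right multiplication by \<open>e\<close> maps \<open>S f\<close> to
    \<open>S e\<close> and fixes \<open>S e\<close>.\<close>
  then have "retraction_of L j (arr (f, f \<otimes> e, e))"
    by (auto simp: retraction_of_def Incl_L Hom_L reps assoc absorb intro!: bexI[of _ "f \<otimes> e"])
  then show "\<exists>q. retraction_of L j q" by blast
next
  fix m assume "m \<in> Arr L"
  then obtain e u f where m: "e \<in> reps" "f \<in> reps" "u \<in> carrier S" "e \<otimes> u = u" "u \<otimes> f = u" "m = arr (e, u, f)"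
    by (auto simp: L_def)
  note r = reps[OF m(1)] reps[OF m(2)]
  obtain x where x: "x \<in> carrier S" "u \<otimes> (x \<otimes> u) = u" using inverseE[OF m(3)] .
  \<comment> \<open>An idempotent below \<open>e\<close> that generates the same right ideal as
    \<open>u\<close>. Translation by \<open>u\<close> then factors into the retraction of
    \<open>S e\<close> onto \<open>S g\<close> by \<open>g\<close>, the isomorphism of
    \<open>S g\<close> with \<open>S u\<close> by \<open>u\<close>, and the inclusion of
    \<open>S u\<close> into \<open>S f\<close>.\<close>
  define g where "g = u \<otimes> (x \<otimes> e)"
  have g: "g \<in> carrier S" "g \<otimes> g = g" "g \<otimes> e = g" "e \<otimes> g = g" "g \<otimes> u = u"
  proof -
    show "g \<in> carrier S" using m x r by (simp add: g_def)
    have "g \<otimes> g = u \<otimes> (x \<otimes> (u \<otimes> (x \<otimes> e)))" using m x r by (simp add: g_def assoc absorb[OF m(4)])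
    also have "\<dots> = g" using m x r by (simp add: g_def absorb2[OF x(2)])
    finally show "g \<otimes> g = g" .
    show "g \<otimes> e = g" "e \<otimes> g = g" "g \<otimes> u = u" using m x r by (simp_all add: g_def assoc absorb[OF m(4)])
  qed
  have gp: "rep g \<otimes> g = rep g" "rep g \<otimes> e = rep g" using rep_mult_right g r by blast+
  obtain y where y: "y \<in> carrier S" "rep u = y \<otimes> u" using repE[OF m(3)] .
  have uf: "rep u \<otimes> f = rep u" using rep_mult_right m r by blast
  let ?q = "arr (e, g, rep g)" and ?w = "arr (rep g, rep g \<otimes> u, rep u)" and ?j = "arr (rep u, rep u, f)"
  have "retraction_of L (arr (rep g, rep g, e)) ?q"
    using m(1) g gp r by (simp add: retraction_of_def Incl_LI Hom_LI)
  then have "retraction L ?q" by (auto simp: retraction_def)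
  moreover have "iso L ?w"
  proof (rule iso_L)
    show "rep u \<otimes> (x \<otimes> g) \<in> carrier S" using m x g by simp
    have "(rep g \<otimes> u) \<otimes> (rep u \<otimes> (x \<otimes> g)) = rep g \<otimes> (u \<otimes> (x \<otimes> g))"
      using m x g by (simp add: assoc absorb[OF mult_rep])
    also have "u \<otimes> (x \<otimes> g) = g" using m x r by (simp add: g_def absorb2[OF x(2)])
    finally show "(rep g \<otimes> u) \<otimes> (rep u \<otimes> (x \<otimes> g)) = rep g" using gp by simp
    have "(rep u \<otimes> (x \<otimes> g)) \<otimes> (rep g \<otimes> u) = rep u \<otimes> (x \<otimes> u)"
      using m x g by (simp add: assoc absorb[OF mult_rep])
    also have "\<dots> = y \<otimes> (u \<otimes> (x \<otimes> u))" using m x y by (simp add: assoc)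
    finally show "(rep u \<otimes> (x \<otimes> g)) \<otimes> (rep g \<otimes> u) = rep u" using x y by simp
  qed (use m g in \<open>simp_all add: assoc absorb\<close>)
  moreover have "?j \<in> Incl L" using m uf by (simp add: Incl_LI)
  moreover have "m = (?q \<cdot>\<^bsub>L\<^esub> ?w) \<cdot>\<^bsub>L\<^esub> ?j"
    using m g r by (simp add: assoc absorb[OF mult_rep])
  ultimately have "normal_factorisation L m ?q ?w ?j"
    using m g r by (simp add: normal_factorisation_def)
  then show "\<exists>q u j. normal_factorisation L m q u j" by blast
next
  fix c assume "c \<in> Obj L"
  then show "\<exists>\<mu>. cone_at L c \<mu> \<and> \<mu> c = Ide L c"
    using rho_cone[of c] reps[of c] by (intro exI[of _ "rho c"]) (simp add: rho_def)
qed

sublocale N: normal_cat L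
  by unfold_locales (rule normal_L)

text \<open>Since \<open>e \<otimes> u = u\<close>, right translation by \<open>u\<close> maps
  \<open>S e\<close> onto \<open>S u\<close>, and \<open>rep u\<close> represents this
  image.\<close>

lemma epi_part_L:
  assumes "e \<in> reps" "f \<in> reps" "u \<in> carrier S" "e \<otimes> u = u" "u \<otimes> f = u"
  shows "epi_part L (arr (e, u, f)) = arr (e, u, rep u)"
proof -
  note r = reps[OF assms(1)] reps[OF assms(2)]
  have uf: "rep u \<otimes> f = rep u" using rep_mult_right assms r by blast
  obtain y where y: "y \<in> carrier S" "rep u = y \<otimes> u" using repE[OF assms(3)] .
  have h: "arr (e, u, rep u) \<in> Hom L e (rep u)" using assms by (auto simp: Hom_L)
  have "N.split_epi (arr (e, u, rep u))"
  proof (rule N.split_epiI[OF h])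
    \<comment> \<open>The section comes from \<open>rep u = y \<otimes> u\<close>; the factors
      \<open>rep u\<close> and \<open>e\<close> put \<open>y\<close> into the right hom-set.\<close>
    show "arr (rep u, rep u \<otimes> (y \<otimes> e), e) \<in> Hom L (rep u) e"
      by (rule Hom_LI) (use assms y(1) r in \<open>simp_all add: assoc absorb[OF rep_idem]\<close>)
    have "(rep u \<otimes> (y \<otimes> e)) \<otimes> u = rep u" using assms y r rep_idem[OF assms(3)] by (simp add: assoc)
    then show "arr (rep u, rep u \<otimes> (y \<otimes> e), e) \<cdot>\<^bsub>L\<^esub> arr (e, u, rep u) = Ide L (rep u)"
      using assms y r by simp
  qed
  moreover have "arr (rep u, rep u, f) \<in> N.Inc (rep u) f"
    using assms uf r by (simp add: N.Inc_def Incl_LI)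
  ultimately have "epi_part L (arr (e, u, rep u) \<cdot>\<^bsub>L\<^esub> arr (rep u, rep u, f)) = arr (e, u, rep u)"
    by (rule N.epi_part_eqI[OF _ h])
  then show ?thesis using assms r by simp
qed

text \<open>Only the component of \<open>\<gamma>\<close> at \<open>rep a\<close> enters the
  product, and it is translation by some \<open>u\<close>. So the product is principal although
  \<open>\<gamma>\<close> need not be.\<close>

lemma rho_mult_cone:
  assumes a: "a \<in> carrier S" and \<gamma>: "cone_at L z \<gamma>"
  obtains u where "u \<in> carrier S" "\<gamma> (rep a) = arr (rep a, u, z)" "rho a \<otimes>\<^bsub>cones L\<^esub> \<gamma> = rho (a \<otimes> u)"
proof -
  obtain u where z: "z \<in> reps"
    and u: "u \<in> carrier S" "rep a \<otimes> u = u" "u \<otimes> z = u" "\<gamma> (rep a) = arr (rep a, u, z)"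
    using N.cone_Hom[OF \<gamma>, of "rep a"] a by (auto simp: Hom_L)
  obtain y where y: "y \<in> carrier S" "rep a = y \<otimes> a" using repE[OF a] .
  \<comment> \<open>From \<open>rep a \<otimes> u = u\<close> and
    \<open>rep a = y \<otimes> a\<close> it follows that
    \<open>u = y \<otimes> (a \<otimes> u)\<close>.\<close>
  have "rep (a \<otimes> u) = rep u"
    by (rule rep_eqI[of "a \<otimes> u" u a y]) (use a u y assoc[of y a u] in simp_all)
  moreover have "rho a \<otimes>\<^bsub>cones L\<^esub> \<gamma> = cone_star L (rho a) (arr (rep a, u, rep u))"
    using a u z by (simp add: N.mult_eq[OF rho_cone[OF a]] epi_part_L)
  ultimately have "rho a \<otimes>\<^bsub>cones L\<^esub> \<gamma> = rho (a \<otimes> u)"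
    using a u by (auto simp: cone_star_def rho_def reps assoc intro!: restrict_ext)
  then show ?thesis using that u by blast
qed

lemma rho_mult:
  assumes a: "a \<in> carrier S" and b: "b \<in> carrier S"
  shows "rho a \<otimes>\<^bsub>cones L\<^esub> rho b = rho (a \<otimes> b)"
proof -
  obtain u where u: "u \<in> carrier S" "rho b (rep a) = arr (rep a, u, rep b)"
    "rho a \<otimes>\<^bsub>cones L\<^esub> rho b = rho (a \<otimes> u)" using rho_mult_cone[OF a rho_cone[OF b]] .
  then have "u = rep a \<otimes> b" using a b by (simp add: rho_def arr_eq_iff)
  then show ?thesis using u(3) a b by (simp add: absorb[OF mult_rep])
qed

lemma rho_down:
  assumes "a \<in> carrier S" "N.cone_le \<gamma> (rho a)"
  shows "\<gamma> \<in> rho ` carrier S"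
proof -
  have "\<gamma> = rho a \<or> (\<exists>x\<in>carrier (cones L). \<gamma> = rho a \<otimes>\<^bsub>cones L\<^esub> x)"
    using assms(2) by (auto simp: right_ideal_def)
  moreover have "rho a \<otimes>\<^bsub>cones L\<^esub> x \<in> rho ` carrier S" if x: "x \<in> carrier (cones L)" for x
  proof -
    obtain z where "cone_at L z x" using x N.in_cones_iff by blast
    then obtain u where "u \<in> carrier S" "rho a \<otimes>\<^bsub>cones L\<^esub> x = rho (a \<otimes> u)" using rho_mult_cone[OF assms(1)] by metis
    then show ?thesis using assms(1) by simp
  qed
  ultimately show ?thesis using assms(1) by auto
qed

text \<open>Components at \<open>rep x\<close> give
  \<open>rep x \<otimes> a = rep x \<otimes> b\<close>, hence
  \<open>x \<otimes> a = x \<otimes> b\<close> because \<open>x = x \<otimes> rep x\<close>; left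
  reductivity then applies.\<close>

lemma rho_inj: "inj_on rho (carrier S)"
proof (rule inj_onI)
  fix a b assume a: "a \<in> carrier S" and b: "b \<in> carrier S" and eq: "rho a = rho b"
  have "x \<otimes> a = x \<otimes> b" if x: "x \<in> carrier S" for x
  proof -
    have "rep x \<otimes> a = rep x \<otimes> b"
      using fun_cong[OF eq, of "rep x"] x a b by (simp add: rho_def arr_eq_iff)
    then show ?thesis using x a b absorb[OF mult_rep[OF x]] by (metis rep_closed)
  qed
  then show "a = b"
    using a b by (intro inj_onD[OF left_reductive[unfolded left_reductive_def]]) (auto intro: restrict_ext)
qed

definition rho_classes :: "('a \<Rightarrow> 'm) set set" where
  "rho_classes = (\<lambda>a. N.cone_class (rho a)) ` carrier S"

lemma rho_in_cones: "a \<in> carrier S \<Longrightarrow> rho a \<in> carrier (cones L)"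
  using N.in_conesI[OF rho_cone] .

text \<open>A cone in the class of \<open>rho a\<close> is below \<open>rho a\<close>, hence
  principal.\<close>

lemma Union_rho_classes: "\<Union>rho_classes = rho ` carrier S"
  using rho_down N.cone_class_iff[OF rho_in_cones] N.self_in_cone_class[OF rho_in_cones]
  unfolding rho_classes_def by blast

lemma connected_L: "connected_category (L, rho_classes)"
proof -
  have cl: "rho_classes \<subseteq> N.cone_classes"
    using N.cone_class_in[OF rho_in_cones] by (auto simp: rho_classes_def)
  have "R_down_set L rho_classes"
    unfolding R_down_set_def
  proof (intro conjI ballI impI cl)
    fix d d' assume d: "d \<in> rho_classes" and d': "d' \<in> N.cone_classes" and le: "R_le (cones L) d' d"
    obtain a where a: "a \<in> carrier S" "d = N.cone_class (rho a)" using d by (auto simp: rho_classes_def)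
    obtain \<gamma> where \<gamma>: "\<gamma> \<in> d'" using N.cone_classes_nonempty[OF d'] by blast
    have "N.cone_le \<gamma> (rho a)"
      using N.R_le_iff[OF d' _ \<gamma>] le d cl a N.self_in_cone_class[OF rho_in_cones[OF a(1)]] by blast
    then obtain b where "b \<in> carrier S" "\<gamma> = rho b" using rho_down[OF a(1)] by blast
    then show "d' \<in> rho_classes" using N.in_cone_classes(2)[OF d' \<gamma>] by (auto simp: rho_classes_def)
  qed
  moreover have "\<exists>d\<in>rho_classes. connected_to L c d" if c: "c \<in> reps" for c
  proof -
    note r = reps[OF c]
    have d: "N.cone_class (rho c) \<in> rho_classes" using r by (simp add: rho_classes_def)
    \<comment> \<open>The representative \<open>c\<close> is itself idempotent, so
      \<open>rho c\<close> serves as the idempotent cone at \<open>c\<close>.\<close>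
    have "rho c c = Ide L c" using c r by (simp add: rho_def)
    then have "idempotent_cone L c (N.cone_class (rho c)) (rho c)"
      using N.idempotent_cone_iff d cl rho_cone[OF r(1)] r N.self_in_cone_class[OF rho_in_cones[OF r(1)]] by auto
    then show ?thesis using d unfolding connected_to_def by blast
  qed
  ultimately show ?thesis using normal_L by (simp add: connected_category_def)
qed

end

theorem theorem3p35:
  fixes U :: "'u set set"
  assumes "universe U"
  shows "equivalent_categories (LRS U) (CC U)"
proof (rule equivalent_if_representable[OF assms])
  fix S assume S: "S \<in> Obj (LRS U)"
  let ?A = "carrier S"
  have A: "?A \<in> U" using S by (simp add: in_Obj_LRS)
  obtain Y where Y: "Y \<in> U" "?A \<times> ?A \<lesssim> Y" using universe_times[OF assms A A lepoll_refl lepoll_refl] .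
  obtain Z where Z: "Z \<in> U" "?A \<times> (?A \<times> ?A) \<lesssim> Z" using universe_times[OF assms A Y(1) lepoll_refl Y(2)] .
  \<comment> \<open>The coding of triples is chosen with its range in \<open>U\<close>, which makes
    the set of arrows small.\<close>
  obtain arr where arr: "inj_on arr (?A \<times> ?A \<times> ?A)" "arr ` (?A \<times> ?A \<times> ?A) \<in> U"
    using universe_encode[OF assms Z] .
  interpret lrs_semigrp S arr by unfold_locales (use S arr in \<open>simp_all add: in_Obj_LRS\<close>)
  have sub: "Y \<in> U" if "X \<in> U" "Y \<subseteq> X" for X Y
    using assms that subset_imp_lepoll unfolding universe_def by blast
  have "(L, rho_classes) \<in> Obj (CC U)"
    unfolding in_Obj_CC fst_conv snd_conv
  proof (intro conjI connected_L bexI[of _ ?A])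
    show "Obj L \<in> U" using sub[OF A] reps(1) by (simp add: subsetI)
    show "Arr L \<in> U" by (rule sub[OF arr(2)]) (auto simp: L_def reps)
    \<comment> \<open>The classes are indexed by the elements of \<open>S\<close>, so the down-set
      is small even if \<open>U\<close> lacks function spaces.\<close>
    show "rho_classes \<lesssim> ?A" unfolding rho_classes_def by (rule image_lepoll)
  qed (rule A)
  moreover have "bij_betw rho ?A (carrier (down_set_semigrp (L, rho_classes)))"
    using rho_inj by (simp add: bij_betw_def Union_rho_classes)
  ultimately show "\<exists>X\<in>Obj (CC U). \<exists>\<theta>. bij_betw \<theta> ?A (carrier (down_set_semigrp X)) \<and>
      (\<forall>x\<in>?A. \<forall>y\<in>?A. \<theta> (x \<otimes>\<^bsub>S\<^esub> y) = \<theta> x \<otimes>\<^bsub>down_set_semigrp X\<^esub> \<theta> y)"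
    using rho_mult by (intro bexI[of _ "(L, rho_classes)"] exI[of _ rho]) auto
qed

end
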